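(* Let $p,p',q,q'\ge 0$ satisfy $p+p'=q+q'=1$ and $p+q>0$. Let $\{e^{tG_\varepsilon}, t\ge 0\}$ be the strongly continuous semigroup in $L^1(S)$ generated by $G_\varepsilon=\frac1\varepsilon A+\frac1{\varepsilon^2}(B-I)$, let $P=\frac12(B+I)$, and let $\widetilde\Delta_{p,q}=J\Delta_{p,q}J^{-1}$ be the isomorphic image of $\Delta_{p,q}$ in $L_0$ (all objects as defined in the context). Then $$\lim_{\varepsilon\to0+} e^{tG_\varepsilon}\varphi = e^{t\frac12\widetilde\Delta_{p,q}}P\varphi,\qquad t>0,\ \varphi\in L^1(S),$$ in the norm of $L^1(S)$, and the limit is uniform in $t$ on compact subsets of $(0,\infty)$. For $\varphi\in L_0$, the limit holds also for $t=0$ and is uniform in $t$ on compact subsets of $[0,\infty)$.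
   Context: Notation: $\mathbb R_*=\mathbb R\setminus\{0\}$, $\mathbb R_+=(0,\infty)$, $\mathbb R_-=(-\infty,0)$; $[Q]$ is the Iverson bracket, equal to $1$ if $Q$ is true and $0$ otherwise. $S=\mathbb R\times\{-1,1\}$, each copy of $\mathbb R$ carrying Lebesgue measure; $L^1(S)$ is the space of integrable functions on $S$. Operator $A$ in $L^1(S)$: its domain $\mathcal D(A)$ consists of $\varphi\in L^1(S)$ such that for each $i\in\{-1,1\}$, $\varphi(\cdot,i)$ is absolutely continuous on each of $\mathbb R_+$ and $\mathbb R_-$ separately, with integrable derivative there (so that one-sided limits $\varphi(0\pm,i)$ exist and are finite), and $$\varphi(0+,1)=p\,\varphi(0-,1)+q'\varphi(0+,-1),\qquad \varphi(0-,-1)=p'\varphi(0-,1)+q\,\varphi(0+,-1).$$ For such $\varphi$, $A\varphi(x,i)=-i\,\varphi'(x,i)$, $(x,i)\in\mathbb R_*\times\{-1,1\}$. ($A$ generates a strongly continuous semigroup of contractions in $L^1(S)$.) $B$ is the bounded operator $B\varphi(x,i)=\varphi(x,-i)$ on $L^1(S)$ and $I$ is the identity. For $\varepsilon>0$, $G_\varepsilon=\frac1\varepsilon A+\frac1{\varepsilon^2}(B-I)$ with domain $\mathcal D(A)$; as a bounded perturbation of a generator it generates a strongly continuous semigroup. $L_0\subset L^1(S)$ is the subspace of $\varphi$ with $\varphi(x,1)=\varphi(x,-1)$, $x\in\mathbb R$. $J:L^1(\mathbb R)\to L_0$ is the isometric isomorphism $J\phi(x,i)=\frac12\phi(x)$.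 $P\varphi(x,i)=\frac12(\varphi(x,1)+\varphi(x,-1))$ is a projection of $L^1(S)$ onto $L_0$. Operator $\Delta_{p,q}$ in $L^1(\mathbb R)$: its domain consists of $\phi\in L^1(\mathbb R)$ of the form $$\phi(x)=\Big(qC+Dx-\int_x^0(x-y)\psi(y)\,dy\Big)[x<0]+\Big(pC+Dx+\int_0^x(x-y)\psi(y)\,dy\Big)[x>0],\quad x\in\mathbb R_*,$$ where $C,D$ are real constants and $\psi\in L^1(\mathbb R)$; for such $\phi$, $\Delta_{p,q}\phi=\psi=\phi''$. (Equivalently, $\phi$ is continuously differentiable on each half-line with $\phi'$ absolutely continuous and $\phi''$ integrable, and $p\phi(0-)=q\phi(0+)$, $\phi'(0+)=\phi'(0-)$.) It is known that $\Delta_{p,q}$, and hence $\frac12\Delta_{p,q}$, generates a strongly continuous semigroup of Markov operators in $L^1(\mathbb R)$. $\widetilde\Delta_{p,q}=J\Delta_{p,q}J^{-1}$ has domain $J(\mathcal D(\Delta_{p,q}))\subset L_0$, and $e^{t\frac12\widetilde\Delta_{p,q}}=Je^{t\frac12\Delta_{p,q}}J^{-1}$ on $L_0$. *)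

theory Defs
  imports "HOL-Analysis.Analysis"
begin

text \<open>The measure underlying an L1 space is attached to the type of points, so that the spaces of
  classes of integrable functions are themselves types.\<close>

class base_measure =
  fixes base_measure :: "'a measure"

definition L1_eq :: "('a::base_measure \<Rightarrow> real) \<Rightarrow> ('a \<Rightarrow> real) \<Rightarrow> bool" where
  "L1_eq f g \<longleftrightarrow>
     integrable base_measure f \<and> integrable base_measure g \<and> (AE x in base_measure. f x = g x)"

quotient_type (overloaded) 'a L1 = "'a::base_measure \<Rightarrow> real" / partial: L1_eq
proof (rule part_equivpI)
  show "\<exists>x::'a \<Rightarrow> real. L1_eq x x"
    by (rule exI[of _ "\<lambda>_. 0"]) (simp add: L1_eq_def)
  show "symp (L1_eq :: ('a \<Rightarrow> real) \<Rightarrow> _)"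
    by (auto simp: symp_def L1_eq_def elim: eventually_mono)
  show "transp (L1_eq :: ('a \<Rightarrow> real) \<Rightarrow> _)"
  proof (rule transpI)
    fix f g h :: "'a \<Rightarrow> real"
    assume "L1_eq f g" "L1_eq g h"
    then show "L1_eq f h"
      unfolding L1_eq_def by (auto elim: eventually_elim2)
  qed
qed

lift_definition represents :: "('a::base_measure \<Rightarrow> real) \<Rightarrow> 'a L1 \<Rightarrow> bool"
  is "\<lambda>f g. integrable base_measure f \<and> (AE x in base_measure. f x = g x)"
  by (auto simp: L1_eq_def fun_eq_iff elim: eventually_elim2)

instantiation L1 :: (base_measure) real_normed_vector
begin

lift_definition zero_L1 :: "'a L1" is "\<lambda>_. 0"
  by (simp add: L1_eq_def)

lift_definition plus_L1 :: "'a L1 \<Rightarrow> 'a L1 \<Rightarrow> 'a L1" is "\<lambda>f g x. f x + g x"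
  by (auto simp: L1_eq_def elim: eventually_elim2)

lift_definition minus_L1 :: "'a L1 \<Rightarrow> 'a L1 \<Rightarrow> 'a L1" is "\<lambda>f g x. f x - g x"
  by (auto simp: L1_eq_def elim: eventually_elim2)

lift_definition uminus_L1 :: "'a L1 \<Rightarrow> 'a L1" is "\<lambda>f x. - f x"
  by (auto simp: L1_eq_def)

lift_definition scaleR_L1 :: "real \<Rightarrow> 'a L1 \<Rightarrow> 'a L1" is "\<lambda>c f x. c * f x"
  by (auto simp: L1_eq_def elim: eventually_mono)

lift_definition norm_L1 :: "'a L1 \<Rightarrow> real" is "\<lambda>f. \<integral>x. \<bar>f x\<bar> \<partial>base_measure"
  by (auto simp: L1_eq_def intro!: integral_cong_AE elim: eventually_mono)

definition sgn_L1 :: "'a L1 \<Rightarrow> 'a L1" where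
  "sgn_L1 f = inverse (norm f) *\<^sub>R f"

definition dist_L1 :: "'a L1 \<Rightarrow> 'a L1 \<Rightarrow> real" where
  "dist_L1 f g = norm (f - g)"

definition uniformity_L1 :: "('a L1 \<times> 'a L1) filter" where
  "uniformity_L1 = (INF e\<in>{0 <..}. principal {(x, y). dist x y < e})"

definition open_L1 :: "'a L1 set \<Rightarrow> bool" where
  "open_L1 U = (\<forall>x\<in>U. eventually (\<lambda>(x', y). x' = x \<longrightarrow> y \<in> U) uniformity)"

instance
proof
  fix a b c :: "'a L1" and r s :: real and U :: "'a L1 set"
  show "a + b + c = a + (b + c)" by transfer (auto simp: L1_eq_def)
  show "a + b = b + a" by transfer (auto simp: L1_eq_def)
  show "0 + a = a" by transfer (auto simp: L1_eq_def)
  show "- a + a = 0" by transfer (auto simp: L1_eq_def)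
  show "a - b = a + - b" by transfer (auto simp: L1_eq_def)
  show "r *\<^sub>R (a + b) = r *\<^sub>R a + r *\<^sub>R b"
    by transfer (auto simp: L1_eq_def algebra_simps)
  show "(r + s) *\<^sub>R a = r *\<^sub>R a + s *\<^sub>R a"
    by transfer (auto simp: L1_eq_def algebra_simps)
  show "r *\<^sub>R s *\<^sub>R a = (r * s) *\<^sub>R a"
    by transfer (auto simp: L1_eq_def algebra_simps)
  show "1 *\<^sub>R a = a" by transfer (auto simp: L1_eq_def)
  show "dist a b = norm (a - b)" by (rule dist_L1_def)
  show "sgn a = inverse (norm a) *\<^sub>R a" by (rule sgn_L1_def)
  show "uniformity = (INF e\<in>{0 <..}. principal {(x, y :: 'a L1). dist x y < e})"
    by (rule uniformity_L1_def)
  show "open U = (\<forall>x\<in>U. eventually (\<lambda>(x', y). x' = x \<longrightarrow> y \<in> U) uniformity)"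
    by (rule open_L1_def)
  show "norm a = 0 \<longleftrightarrow> a = 0"
    by transfer (simp add: L1_eq_def integral_nonneg_eq_0_iff_AE)
  show "norm (a + b) \<le> norm a + norm b"
  proof transfer
    fix f g :: "'a \<Rightarrow> real"
    assume "L1_eq f f" "L1_eq g g"
    then have "integrable base_measure f" "integrable base_measure g"
      by (auto simp: L1_eq_def)
    then have "(\<integral>x. \<bar>f x + g x\<bar> \<partial>base_measure) \<le> (\<integral>x. \<bar>f x\<bar> + \<bar>g x\<bar> \<partial>base_measure)"
      by (intro integral_mono) auto
    then show "(\<integral>x. \<bar>f x + g x\<bar> \<partial>base_measure) \<le>
        (\<integral>x. \<bar>f x\<bar> \<partial>base_measure) + (\<integral>x. \<bar>g x\<bar> \<partial>base_measure)"
      using \<open>integrable base_measure f\<close> \<open>integrable base_measure g\<close> by simp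
  qed
  show "norm (r *\<^sub>R a) = \<bar>r\<bar> * norm a"
    by transfer (simp add: abs_mult)
qed

end

instantiation real :: base_measure
begin
definition base_measure_real :: "real measure" where
  "base_measure_real = lborel"
instance ..
end

text \<open>The two-point set of directions, with \<open>sgn_of\<close> giving the corresponding number in {-1, 1}.\<close>

datatype direction = Pos | Neg

primrec sgn_of :: "direction \<Rightarrow> real" where
  "sgn_of Pos = 1"
| "sgn_of Neg = - 1"

primrec opposite :: "direction \<Rightarrow> direction" where
  "opposite Pos = Neg"
| "opposite Neg = Pos"

lemma UNIV_direction: "(UNIV :: direction set) = {Pos, Neg}"
  using direction.exhaust by auto

lemma opposite_opposite [simp]: "opposite (opposite i) = i"
  by (cases i) simp_all

instance direction :: finite
  by standard (simp add: UNIV_direction)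

instantiation direction :: base_measure
begin
definition base_measure_direction :: "direction measure" where
  "base_measure_direction = count_space UNIV"
instance ..
end

instantiation prod :: (base_measure, base_measure) base_measure
begin
definition base_measure_prod :: "('a \<times> 'b) measure" where
  "base_measure_prod = base_measure \<Otimes>\<^sub>M base_measure"
instance ..
end

type_synonym S = "real \<times> direction"

lemma base_measure_S: "(base_measure :: S measure) = lborel \<Otimes>\<^sub>M count_space UNIV"
  by (simp add: base_measure_prod_def base_measure_real_def base_measure_direction_def)

lemma pair_sigma_finite_S: "pair_sigma_finite lborel (count_space (UNIV :: direction set))"
  by (intro pair_sigma_finite.intro sigma_finite_lborel sigma_finite_measure_count_space_finite)
    simp

text \<open>Unbounded operators are identified with their graphs. The carrier \<open>X\<close> allows for semigroups
  acting on a subspace only.\<close>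

type_synonym 'a op_graph = "('a \<times> 'a) set"

definition C0_semigroup_on :: "'a::real_normed_vector set \<Rightarrow> (real \<Rightarrow> 'a \<Rightarrow> 'a) \<Rightarrow> bool" where
  "C0_semigroup_on X T \<longleftrightarrow>
     subspace X \<and>
     (\<forall>t\<ge>0. T t ` X \<subseteq> X \<and>
        (\<forall>x\<in>X. \<forall>y\<in>X. \<forall>a b. T t (a *\<^sub>R x + b *\<^sub>R y) = a *\<^sub>R T t x + b *\<^sub>R T t y) \<and>
        (\<exists>K. \<forall>x\<in>X. norm (T t x) \<le> K * norm x)) \<and>
     (\<forall>x\<in>X. T 0 x = x) \<and>
     (\<forall>s\<ge>0. \<forall>t\<ge>0. \<forall>x\<in>X. T (s + t) x = T s (T t x)) \<and>
     (\<forall>x\<in>X. ((\<lambda>t. T t x) \<longlongrightarrow> x) (at_right 0))"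

definition generator_on ::
  "'a::real_normed_vector set \<Rightarrow> (real \<Rightarrow> 'a \<Rightarrow> 'a) \<Rightarrow> 'a op_graph" where
  "generator_on X T =
     {(x, y). x \<in> X \<and> y \<in> X \<and> ((\<lambda>h. (1 / h) *\<^sub>R (T h x - x)) \<longlongrightarrow> y) (at_right 0)}"

definition generates_on ::
  "'a::real_normed_vector set \<Rightarrow> 'a op_graph \<Rightarrow> (real \<Rightarrow> 'a \<Rightarrow> 'a) \<Rightarrow> bool" where
  "generates_on X G T \<longleftrightarrow> C0_semigroup_on X T \<and> generator_on X T = G"

definition abs_continuous_on :: "real set \<Rightarrow> (real \<Rightarrow> real) \<Rightarrow> bool" where
  "abs_continuous_on s f \<longleftrightarrow>
     (\<forall>\<epsilon>>0. \<exists>\<delta>>0. \<forall>D. finite D \<longrightarrow> (\<forall>(a, b)\<in>D. a \<le> b \<and> {a..b} \<subseteq> s) \<longrightarrow>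
        pairwise (\<lambda>(a, b) (c, d). {a<..<b} \<inter> {c<..<d} = {}) D \<longrightarrow>
        (\<Sum>(a, b)\<in>D. b - a) < \<delta> \<longrightarrow> (\<Sum>(a, b)\<in>D. \<bar>f b - f a\<bar>) < \<epsilon>)"

text \<open>In \<open>A_op\<close>, the function \<open>f'\<close> is the almost everywhere defined derivative of \<open>f\<close>; its
  integrability is part of \<open>(x, i) \<mapsto> - i f'(x, i)\<close> representing an element of L1. The numbers
  \<open>l i\<close> and \<open>r i\<close> are the one-sided limits of \<open>f\<close> at 0.\<close>

definition A_op :: "real \<Rightarrow> real \<Rightarrow> real \<Rightarrow> real \<Rightarrow> S L1 op_graph" where
  "A_op p p' q q' = {(\<phi>, \<psi>). \<exists>f f' l r.
     represents f \<phi> \<and> represents (\<lambda>(x, i). - sgn_of i * f' (x, i)) \<psi> \<and>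
     (\<forall>i. abs_continuous_on {0<..} (\<lambda>x. f (x, i)) \<and> abs_continuous_on {..<0} (\<lambda>x. f (x, i)) \<and>
          (AE x in lborel. ((\<lambda>y. f (y, i)) has_real_derivative f' (x, i)) (at x)) \<and>
          ((\<lambda>x. f (x, i)) \<longlongrightarrow> l i) (at_left 0) \<and> ((\<lambda>x. f (x, i)) \<longlongrightarrow> r i) (at_right 0)) \<and>
     r Pos = p * l Pos + q' * r Neg \<and>
     l Neg = p' * l Pos + q * r Neg}"

lemma distr_opposite_S:
  "distr (lborel \<Otimes>\<^sub>M count_space UNIV) (lborel \<Otimes>\<^sub>M count_space UNIV) (\<lambda>(x, i). (x, opposite i)) =
     (lborel \<Otimes>\<^sub>M count_space (UNIV :: direction set) :: S measure)"
proof -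
  have bij: "bij_betw opposite UNIV UNIV"
    by (rule bij_betwI[of _ _ _ opposite]) auto
  have c: "distr (count_space UNIV) (count_space UNIV) opposite = count_space UNIV"
    by (rule distr_bij_count_space[OF bij])
  have "distr lborel lborel (\<lambda>x. x) \<Otimes>\<^sub>M distr (count_space UNIV) (count_space UNIV) opposite =
     distr (lborel \<Otimes>\<^sub>M count_space UNIV) (lborel \<Otimes>\<^sub>M count_space UNIV)
       (\<lambda>(x :: real, i). (x, opposite i))"
    by (rule pair_measure_distr)
      (auto simp: c intro!: sigma_finite_measure_count_space_finite)
  then show ?thesis by (simp add: c distr_id)
qed

lift_definition B_op :: "S L1 \<Rightarrow> S L1" is "\<lambda>f (x, i). f (x, opposite i)"
proof -
  fix f g :: "S \<Rightarrow> real"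
  let ?M = "lborel \<Otimes>\<^sub>M count_space UNIV :: S measure"
  let ?s = "\<lambda>(x, i). (x, opposite i) :: S"
  assume "L1_eq f g"
  then have fg: "integrable ?M f" "integrable ?M g" "AE z in ?M. f z = g z"
    unfolding L1_eq_def base_measure_S by auto
  have s [measurable]: "?s \<in> ?M \<rightarrow>\<^sub>M ?M" by measurable
  have [measurable]: "f \<in> borel_measurable ?M" "g \<in> borel_measurable ?M"
    using fg by auto
  have "integrable (distr ?M ?M ?s) f" "integrable (distr ?M ?M ?s) g"
    "AE z in distr ?M ?M ?s. f z = g z"
    unfolding distr_opposite_S by (rule fg)+
  then have "integrable ?M (\<lambda>z. f (?s z))" "integrable ?M (\<lambda>z. g (?s z))"
    "AE z in ?M. f (?s z) = g (?s z)"
    by (auto simp: integrable_distr_eq AE_distr_iff)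
  then show "L1_eq (\<lambda>(x, i). f (x, opposite i)) (\<lambda>(x, i). g (x, opposite i))"
    unfolding L1_eq_def base_measure_S by (simp add: case_prod_unfold)
qed

definition G_op :: "real \<Rightarrow> real \<Rightarrow> real \<Rightarrow> real \<Rightarrow> real \<Rightarrow> S L1 op_graph" where
  "G_op p p' q q' \<epsilon> =
     {(\<phi>, (1 / \<epsilon>) *\<^sub>R \<psi> + (1 / \<epsilon>\<^sup>2) *\<^sub>R (B_op \<phi> - \<phi>)) | \<phi> \<psi>. (\<phi>, \<psi>) \<in> A_op p p' q q'}"

definition P_op :: "S L1 \<Rightarrow> S L1" where
  "P_op \<phi> = (1 / 2) *\<^sub>R (B_op \<phi> + \<phi>)"

definition L_zero :: "S L1 set" where
  "L_zero = {\<phi>. \<exists>f. represents f \<phi> \<and> (\<forall>x. f (x, Pos) = f (x, Neg))}"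

lift_definition J :: "real L1 \<Rightarrow> S L1" is "\<lambda>f (x, i). f x / 2"
proof -
  fix f g :: "real \<Rightarrow> real"
  let ?M = "lborel \<Otimes>\<^sub>M count_space UNIV :: S measure"
  interpret pair_sigma_finite lborel "count_space (UNIV :: direction set)"
    by (rule pair_sigma_finite_S)
  assume "L1_eq f g"
  then have fg: "integrable lborel f" "integrable lborel g" "AE x in lborel. f x = g x"
    unfolding L1_eq_def base_measure_real_def by auto
  have [measurable]: "f \<in> borel_measurable lborel" "g \<in> borel_measurable lborel"
    using fg by auto
  have int: "integrable ?M (\<lambda>(x, i). h x / 2)"
    if h: "integrable lborel h" for h :: "real \<Rightarrow> real"
  proof -
    have [measurable]: "h \<in> borel_measurable lborel" using h by auto
    show ?thesis
      by (rule Fubini_integrable) (use h in \<open>auto simp: integrable_count_space\<close>)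
  qed
  have "AE z in ?M. f (fst z) / 2 = g (fst z) / 2"
    by (rule AE_pair_measure) (use fg in \<open>auto elim: eventually_mono\<close>)
  then show "L1_eq (\<lambda>(x, i :: direction). f x / 2) (\<lambda>(x, i). g x / 2)"
    using int[OF fg(1)] int[OF fg(2)]
    unfolding L1_eq_def base_measure_S by (simp add: case_prod_unfold)
qed

definition Laplace_op :: "real \<Rightarrow> real \<Rightarrow> real L1 op_graph" where
  "Laplace_op p q = {(\<phi>, \<psi>). \<exists>f g C D.
     represents f \<phi> \<and> represents g \<psi> \<and>
     (\<forall>x<0. f x = q * C + D * x - (LBINT y:{x..0}. (x - y) * g y)) \<and>
     (\<forall>x>0. f x = p * C + D * x + (LBINT y:{0..x}. (x - y) * g y))}"

definition Laplace_tilde :: "real \<Rightarrow> real \<Rightarrow> S L1 op_graph" where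
  "Laplace_tilde p q = {(J \<phi>, J \<psi>) | \<phi> \<psi>. (\<phi>, \<psi>) \<in> Laplace_op p q}"

definition scale_op :: "real \<Rightarrow> 'a::real_vector op_graph \<Rightarrow> 'a op_graph" where
  "scale_op c G = {(\<phi>, c *\<^sub>R \<psi>) | \<phi> \<psi>. (\<phi>, \<psi>) \<in> G}"

end

theory Submission
  imports Defs
begin

text \<open>For \<open>\<phi>\<close> in the domain of the square of the Laplace operator, the first order corrector
  \<open>J \<phi> - \<epsilon> i \<phi>' / 4\<close> is turned into an element of the domain of \<open>A\<close> by adding \<open>\<epsilon>\<close> times a fixed profile
  that jumps at 0; then \<open>G\<^sub>\<epsilon>\<close> of the result converges to \<open>(1/2) J \<phi>''\<close>. Since \<open>A\<close> is dissipative, the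
  semigroups generated by \<open>G\<^sub>\<epsilon>\<close> are contractions, so consistency gives convergence: over a grid of
  mesh \<open>h\<close> both semigroups agree with an Euler step up to \<open>O(h\<^sup>2)\<close> per step and a term vanishing with
  \<open>\<epsilon>\<close>, and the errors add up. Functions odd in the direction are damped at rate \<open>2 / \<epsilon>\<^sup>2\<close> while transport acts
  only at rate \<open>1 / \<epsilon>\<close>, so they vanish in the limit for \<open>t > 0\<close>.\<close>

section \<open>Completeness of L1\<close>

text \<open>Both families of semigroups are given and only their generators are known, so every
  estimate starts from pairs in a generator and never from a resolvent. \<open>U\<close> is not
  assumed to be contractive; a bound on bounded time intervals comes from the uniform boundedness
  principle, and domains of powers of a generator are shown dense by vector-valued integrals. Both
  rest on the completeness of L1. The limits \<open>q * C\<close> and \<open>p * C\<close> of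
  \<open>\<phi>\<close> at 0 satisfy the transmission conditions at order 0 because
  \<open>p + p' = 1\<close> and \<open>q + q' = 1\<close>. At order \<open>\<epsilon>\<close> the
  common one-sided derivative \<open>D\<close> leaves a mismatch of opposite signs in the two
  conditions, so one scalar, the height of the jump, repairs both; \<open>p + q > 0\<close> makes
  that scalar exist. Membership in the domain of the square gives \<open>\<phi>''\<close> a
  representative continuous off 0, so the corrector can be differentiated at every point other than
  0. At \<open>t = 0\<close> the odd part has had no time to decay, hence the separate statement for
  \<open>L_zero\<close>.\<close>

lemma represents_integrable: "represents f \<phi> \<Longrightarrow> integrable base_measure f"
  by transfer auto

lemma ex_represents: "\<exists>f. represents f \<phi>"
  by transfer (auto simp: L1_eq_def)

lemma integrable_represents: "integrable base_measure f \<Longrightarrow> \<exists>\<phi>. represents f \<phi>"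
  by transfer (auto simp: L1_eq_def)

lemma represents_unique: "represents f \<phi> \<Longrightarrow> represents f \<psi> \<Longrightarrow> \<phi> = \<psi>"
  by transfer (auto simp: L1_eq_def elim: eventually_elim2)

lemma represents_AE: "represents f \<phi> \<Longrightarrow> represents g \<phi> \<Longrightarrow> AE x in base_measure. f x = g x"
  by transfer (auto elim: eventually_elim2)

lemma represents_norm: "represents f \<phi> \<Longrightarrow> norm \<phi> = (\<integral>x. \<bar>f x\<bar> \<partial>base_measure)"
  by transfer (auto simp: L1_eq_def intro!: integral_cong_AE elim: eventually_mono)

lemma represents_zero: "represents (\<lambda>_. 0) 0"
  by transfer simp

lemma represents_add:
  "represents f \<phi> \<Longrightarrow> represents g \<psi> \<Longrightarrow> represents (\<lambda>x. f x + g x) (\<phi> + \<psi>)"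
  by transfer (auto elim: eventually_elim2)

lemma represents_diff:
  "represents f \<phi> \<Longrightarrow> represents g \<psi> \<Longrightarrow> represents (\<lambda>x. f x - g x) (\<phi> - \<psi>)"
  by transfer (auto elim: eventually_elim2)

lemma represents_scaleR: "represents f \<phi> \<Longrightarrow> represents (\<lambda>x. c * f x) (c *\<^sub>R \<phi>)"
  by transfer (auto elim: eventually_mono)

lemma represents_sum:
  "finite I \<Longrightarrow> (\<And>i. i \<in> I \<Longrightarrow> represents (f i) (\<phi> i)) \<Longrightarrow>
    represents (\<lambda>x. \<Sum>i\<in>I. f i x) (\<Sum>i\<in>I. \<phi> i)"
  by (induction I rule: finite_induct) (auto intro: represents_zero represents_add)

text \<open>Riesz-Fischer: the integral of the sum of the absolute values is finite, so the series
  of representatives converges absolutely almost everywhere. Its pointwise sum represents the limit,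
  since the norm of each remainder is at most the tail of the series of norms.\<close>

lemma L1_abs_convergent_series:
  fixes \<phi> :: "nat \<Rightarrow> 'a::base_measure L1"
  assumes "summable (\<lambda>n. norm (\<phi> n))"
  shows "summable \<phi>"
proof -
  let ?M = "base_measure :: 'a measure"
  obtain f where f: "\<And>n. represents (f n) (\<phi> n)"
    using choice[of "\<lambda>n f. represents f (\<phi> n)"] ex_represents by blast
  have int: "\<And>n. integrable ?M (f n)"
    using f represents_integrable by blast
  have norm_f: "\<And>n. (\<integral>x. norm (f n x) \<partial>?M) = norm (\<phi> n)"
    using represents_norm[OF f] by simp
  have sum_norm: "summable (\<lambda>n. \<integral>x. norm (f n x) \<partial>?M)"
    unfolding norm_f by (rule assms)
  have AE_sum: "AE x in ?M. summable (\<lambda>n. norm (f n x))"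
  proof -
    have "(\<integral>\<^sup>+x. (\<Sum>n. ennreal (norm (f n x))) \<partial>?M) = (\<Sum>n. \<integral>\<^sup>+x. norm (f n x) \<partial>?M)"
      using int by (intro nn_integral_suminf) auto
    also have "\<dots> = (\<Sum>n. ennreal (norm (\<phi> n)))"
      unfolding norm_f[symmetric] using int
      by (intro arg_cong[where f=suminf] ext nn_integral_eq_integral) auto
    also have "\<dots> \<noteq> \<infinity>"
      using assms by (simp add: ennreal_suminf_neq_top)
    finally have "AE x in ?M. (\<Sum>n. ennreal (norm (f n x))) \<noteq> \<infinity>"
      using int by (intro nn_integral_PInf_AE) auto
    then show ?thesis
      by eventually_elim (auto intro: summable_suminf_not_top)
  qed
  let ?F = "\<lambda>x. \<Sum>n. f n x"
  have "integrable ?M ?F"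
    by (rule integrable_suminf[OF int AE_sum sum_norm])
  then obtain \<Phi> where \<Phi>: "represents ?F \<Phi>"
    using integrable_represents by blast
  have tail: "norm (\<Phi> - (\<Sum>n<N. \<phi> n)) \<le> (\<Sum>n. norm (\<phi> (n + N)))" for N
  proof -
    have intN: "\<And>n. integrable ?M (\<lambda>x. norm (f (n + N) x))" using int by auto
    have AE_N: "AE x in ?M. summable (\<lambda>n. norm (norm (f (n + N) x)))"
      using AE_sum by eventually_elim (subst summable_iff_shift, simp)
    have sum_N: "summable (\<lambda>n. \<integral>x. norm (norm (f (n + N) x)) \<partial>?M)"
      using sum_norm by (subst summable_iff_shift) simp
    have rep: "represents (\<lambda>x. ?F x - (\<Sum>n<N. f n x)) (\<Phi> - (\<Sum>n<N. \<phi> n))"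
      by (intro represents_diff \<Phi> represents_sum f) auto
    have "norm (\<Phi> - (\<Sum>n<N. \<phi> n)) = (\<integral>x. \<bar>?F x - (\<Sum>n<N. f n x)\<bar> \<partial>?M)"
      by (rule represents_norm[OF rep])
    also have "\<dots> \<le> (\<integral>x. (\<Sum>n. norm (f (n + N) x)) \<partial>?M)"
    proof (rule integral_mono_AE)
      show "integrable ?M (\<lambda>x. \<bar>?F x - (\<Sum>n<N. f n x)\<bar>)"
        using represents_integrable[OF rep] by auto
      show "integrable ?M (\<lambda>x. \<Sum>n. norm (f (n + N) x))"
        by (rule integrable_suminf[OF intN AE_N sum_N])
      show "AE x in ?M. \<bar>?F x - (\<Sum>n<N. f n x)\<bar> \<le> (\<Sum>n. norm (f (n + N) x))"
        using AE_sum
      proof eventually_elim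
        case (elim x)
        have "?F x - (\<Sum>n<N. f n x) = (\<Sum>n. f (n + N) x)"
          using suminf_split_initial_segment[OF summable_norm_cancel[OF elim], of N] by simp
        moreover have "norm (\<Sum>n. f (n + N) x) \<le> (\<Sum>n. norm (f (n + N) x))"
          using elim by (intro summable_norm) (subst summable_iff_shift, simp)
        ultimately show ?case by simp
      qed
    qed
    also have "\<dots> = (\<Sum>n. \<integral>x. norm (f (n + N) x) \<partial>?M)"
      by (rule integral_suminf[OF intN AE_N sum_N])
    finally show ?thesis unfolding norm_f .
  qed
  have "(\<lambda>N. \<Sum>n. norm (\<phi> (n + N))) \<longlonglongrightarrow> 0"
    using suminf_exist_split2[of "\<lambda>n. norm (\<phi> n)"] assms by simp
  then have "(\<lambda>N. norm (\<Phi> - (\<Sum>n<N. \<phi> n))) \<longlonglongrightarrow> 0"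
    by (rule tendsto_sandwich[OF _ _ tendsto_const, rotated 2])
      (auto simp: tail intro!: always_eventually)
  then have "(\<lambda>N. norm ((\<Sum>n<N. \<phi> n) - \<Phi>)) \<longlonglongrightarrow> 0"
    by (simp add: norm_minus_commute)
  then have "(\<lambda>N. \<Sum>n<N. \<phi> n) \<longlonglongrightarrow> \<Phi>"
    using LIM_zero_iff tendsto_norm_zero_iff by blast
  then show ?thesis
    by (auto simp: summable_def sums_def)
qed

instance L1 :: (base_measure) banach
proof
  fix X :: "nat \<Rightarrow> 'a L1"
  assume X: "Cauchy X"
  \<comment> \<open>A subsequence with geometrically small increments turns into an absolutely
    convergent telescoping series. A Cauchy sequence converges as soon as one of its subsequences
    does.\<close>
  have "\<exists>r. strict_mono r \<and> (\<forall>n. norm (X (r (Suc n)) - X (r n)) < (1/2) ^ n)"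
  proof -
    have "\<exists>N. \<forall>m\<ge>N. \<forall>n\<ge>N. norm (X m - X n) < (1/2) ^ k" for k :: nat
      using X by (auto simp: Cauchy_def dist_norm)
    then obtain N where N: "\<And>k m n. m \<ge> N k \<Longrightarrow> n \<ge> N k \<Longrightarrow> norm (X m - X n) < (1/2) ^ k"
      by metis
    define r where "r = rec_nat (N 0) (\<lambda>k a. max (Suc a) (N (Suc k)))"
    have r_simps: "r 0 = N 0" "\<And>k. r (Suc k) = max (Suc (r k)) (N (Suc k))"
      by (auto simp: r_def)
    have "strict_mono r" by (rule strict_monoI_Suc) (simp add: r_simps)
    moreover have "r k \<ge> N k" for k by (cases k) (auto simp: r_simps)
    moreover have "r (Suc k) \<ge> r k" for k by (simp add: r_simps)
    ultimately show ?thesis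
      using N order_trans by (intro exI[of _ r]) blast
  qed
  then obtain r where r: "strict_mono r" "\<And>n. norm (X (r (Suc n)) - X (r n)) < (1/2) ^ n"
    by auto
  have "summable (\<lambda>n. norm (X (r (Suc n)) - X (r n)))"
    using r(2) less_imp_le by (intro summable_comparison_test'[OF summable_geometric[of "1/2::real"]]) auto
  then have "summable (\<lambda>n. X (r (Suc n)) - X (r n))"
    by (rule L1_abs_convergent_series)
  then obtain L where "(\<lambda>N. \<Sum>n<N. X (r (Suc n)) - X (r n)) \<longlonglongrightarrow> L"
    by (auto simp: summable_def sums_def)
  moreover have "(\<Sum>n<N. X (r (Suc n)) - X (r n)) = X (r N) - X (r 0)" for N
    by (rule sum_lessThan_telescope)
  ultimately have "(\<lambda>N. X (r N) - X (r 0)) \<longlonglongrightarrow> L"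
    by simp
  then have "(\<lambda>N. X (r N) - X (r 0) + X (r 0)) \<longlonglongrightarrow> L + X (r 0)"
    by (intro tendsto_intros)
  then have lim: "(X \<circ> r) \<longlonglongrightarrow> L + X (r 0)"
    by (simp add: o_def)
  have "X \<longlonglongrightarrow> L + X (r 0)"
    by (rule Cauchy_converges_subseq[OF X r(1) lim])
  then show "convergent X"
    by (rule convergentI)
qed

section \<open>Semigroups of operators\<close>

text \<open>By Baire's theorem one of the closed sets \<open>C k\<close>, on which all
  \<open>f n\<close> are bounded by \<open>k\<close>, contains a ball, because these sets cover the
  space. The version for sequences suffices for the operators of a semigroup at times tending to
  0.\<close>

lemma uniform_boundedness:
  fixes f :: "nat \<Rightarrow> 'a::banach \<Rightarrow> 'b::real_normed_vector"
  assumes lin: "\<And>n. bounded_linear (f n)"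
    and ptw: "\<And>x. \<exists>K. \<forall>n. norm (f n x) \<le> K"
  shows "\<exists>M. \<forall>n x. norm (f n x) \<le> M * norm x"
proof -
  define C where "C k = {x. \<forall>n. norm (f n x) \<le> real k}" for k :: nat
  have closed_C: "closed (C k)" for k
  proof -
    have "C k = (\<Inter>n. {x. norm (f n x) \<le> real k})" by (auto simp: C_def)
    moreover have "closed {x. norm (f n x) \<le> real k}" for n
      using lin[of n] by (intro closed_Collect_le continuous_intros)
        (simp add: linear_continuous_on)
    ultimately show ?thesis by auto
  qed
  have cover: "(\<Union>k. C k) = UNIV"
  proof -
    have "\<exists>k. x \<in> C k" for x
    proof -
      obtain K where K: "\<And>n. norm (f n x) \<le> K" using ptw by blast
      obtain k :: nat where "K \<le> real k" using real_arch_simple by blast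
      with K show ?thesis by (auto simp: C_def intro: order_trans)
    qed
    then show ?thesis by blast
  qed
  have "\<exists>k. interior (C k) \<noteq> {}"
  proof (rule ccontr)
    assume "\<not> ?thesis"
    then have "Met_TC.mtopology interior_of (\<Union>(range C)) = {}"
      using closed_C
      by (intro Met_TC.metric_Baire_category_alt) (auto simp: complete_UNIV)
    then show False by (simp add: cover)
  qed
  then obtain k a where "a \<in> interior (C k)" by auto
  then obtain r where r: "r > 0" "cball a r \<subseteq> C k"
    using mem_interior_cball by blast
  \<comment> \<open>Subtracting the value at the center of the ball doubles \<open>k\<close>;
    scaling \<open>x\<close> to length \<open>r\<close> produces the division by
    \<open>r\<close>.\<close>
  have "norm (f n x) \<le> (2 * real k / r) * norm x" for n x
  proof (cases "x = 0")
    case True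
    interpret bounded_linear "f n" by (rule lin)
    show ?thesis by (simp add: True zero)
  next
    case False
    interpret bounded_linear "f n" by (rule lin)
    let ?c = "r / norm x"
    have "a + ?c *\<^sub>R x \<in> cball a r" "a \<in> cball a r"
      using False r(1) by (simp_all add: dist_norm)
    then have "a + ?c *\<^sub>R x \<in> C k" "a \<in> C k"
      using r(2) by blast+
    then have "norm (f n (a + ?c *\<^sub>R x)) \<le> real k" "norm (f n a) \<le> real k"
      by (auto simp: C_def)
    then have "norm (f n (a + ?c *\<^sub>R x) - f n a) \<le> 2 * real k"
      using norm_triangle_ineq4[of "f n (a + ?c *\<^sub>R x)" "f n a"] by linarith
    then have "?c * norm (f n x) \<le> 2 * real k"
      using r(1) by (simp add: add scaleR)
    then show ?thesis using r(1) False by (simp add: field_simps)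
  qed
  then show ?thesis by blast
qed

text \<open>The semigroups of the theorem act on the range of a projection. Composing them with this
  projection gives operators on the whole space, and \<open>S 0\<close> becomes the projection.\<close>

locale degenerate_semigroup =
  fixes S :: "real \<Rightarrow> 'a::banach \<Rightarrow> 'a"
  assumes lin: "t \<ge> 0 \<Longrightarrow> bounded_linear (S t)"
    and add: "s \<ge> 0 \<Longrightarrow> t \<ge> 0 \<Longrightarrow> S (s + t) x = S s (S t x)"
    and right_cont: "((\<lambda>t. S t x) \<longlongrightarrow> S 0 x) (at_right 0)"
begin

text \<open>The equations \<open>S 0 x = x\<close> and \<open>S 0 y = y\<close> stand for membership
  in the range of the projection, that is, in the carrier of the original semigroup.\<close>

definition gen :: "('a \<times> 'a) set" where
  "gen = {(x, y). S 0 x = x \<and> S 0 y = y \<and> ((\<lambda>h. (1 / h) *\<^sub>R (S h x - x)) \<longlongrightarrow> y) (at_right 0)}"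

text \<open>These are the domains of the powers of the generator, where the zeroth power has the
  range of \<open>S 0\<close> as its domain.\<close>

fun iterated_domain :: "nat \<Rightarrow> 'a set" where
  "iterated_domain 0 = {x. S 0 x = x}"
| "iterated_domain (Suc k) = {x. \<exists>y. (x, y) \<in> gen \<and> y \<in> iterated_domain k}"

lemma S_minus: "t \<ge> 0 \<Longrightarrow> S t (x - y) = S t x - S t y"
  by (rule linear_diff[OF bounded_linear.linear[OF lin]])

lemma S_scaleR: "t \<ge> 0 \<Longrightarrow> S t (c *\<^sub>R x) = c *\<^sub>R S t x"
  by (rule linear_scale[OF bounded_linear.linear[OF lin]])

lemma S_zero_right: "t \<ge> 0 \<Longrightarrow> S t (S 0 x) = S t x"
  using add[of t 0] by simp

lemma S_zero_left: "t \<ge> 0 \<Longrightarrow> S 0 (S t x) = S t x"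
  using add[of 0 t] by simp

lemma commute: "s \<ge> 0 \<Longrightarrow> t \<ge> 0 \<Longrightarrow> S s (S t x) = S t (S s x)"
  using add[of s t] add[of t s] by (simp add: add.commute)

text \<open>Otherwise there are times \<open>t n\<close> tending to 0 at which the operator norms
  exceed \<open>n\<close>. Each orbit converges along these times and is therefore bounded, which
  contradicts uniform boundedness.\<close>

lemma bounded_near_zero: "\<exists>\<delta>>0. \<exists>M. \<forall>t\<in>{0..\<delta>}. \<forall>x. norm (S t x) \<le> M * norm x"
proof (rule ccontr)
  assume neg: "\<not> ?thesis"
  have "\<exists>t\<in>{0..inverse (real (Suc n))}. \<exists>x. norm (S t x) > real n * norm x" for n
    using neg by (force simp: not_le)
  then obtain t where t: "\<And>n. t n \<in> {0..inverse (real (Suc n))}"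
    "\<And>n. \<exists>x. norm (S (t n) x) > real n * norm x"
    by metis
  have t0: "t \<longlonglongrightarrow> 0"
    by (rule tendsto_sandwich[OF _ _ tendsto_const LIMSEQ_inverse_real_of_nat])
      (use t(1) in auto)
  have bdd: "\<exists>K. \<forall>n. norm (S (t n) x) \<le> K" for x
  proof -
    \<comment> \<open>Some \<open>t n\<close> may be 0, so the limit is taken within
      \<open>{0..}\<close> and not along \<open>at_right 0\<close>.\<close>
    have "continuous (at 0 within {0..}) (\<lambda>s. S s x)"
      using right_cont[of x] by (simp add: continuous_within at_within_Ici_at_right)
    then have "(\<lambda>n. S (t n) x) \<longlonglongrightarrow> S 0 x"
      using t(1) t0 by (auto simp: continuous_within_sequentially o_def)
    then have "Bseq (\<lambda>n. S (t n) x)"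
      by (intro convergent_imp_Bseq convergentI)
    then show ?thesis by (auto simp: Bseq_def)
  qed
  have "\<exists>M. \<forall>n x. norm (S (t n) x) \<le> M * norm x"
    by (rule uniform_boundedness) (use t(1) lin bdd in auto)
  then obtain M where M: "\<And>n x. norm (S (t n) x) \<le> M * norm x" by blast
  obtain n :: nat where n: "M \<le> real n" using real_arch_simple by blast
  obtain x where "norm (S (t n) x) > real n * norm x" using t(2) by blast
  with M[of n x] n show False
    using mult_right_mono[OF n norm_ge_zero[of x]] by linarith
qed

text \<open>The semigroup law extends the bound on \<open>[0, \<delta>]\<close> to
  \<open>[0, (n + 1) \<delta>]\<close> with constant \<open>M ^ Suc n\<close>. Keeping
  \<open>M \<ge> 1\<close> makes the powers monotone, so one of them serves all shorter
  times.\<close>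

lemma locally_bounded:
  obtains M where "M \<ge> 1" "\<And>t x. t \<in> {0..\<tau>} \<Longrightarrow> norm (S t x) \<le> M * norm x"
proof -
  obtain \<delta> M0 where \<delta>: "\<delta> > 0" and M0: "\<And>t x. t \<in> {0..\<delta>} \<Longrightarrow> norm (S t x) \<le> M0 * norm x"
    using bounded_near_zero by blast
  define M where "M = max 1 M0"
  have M1: "M \<ge> 1" by (simp add: M_def)
  have M: "norm (S t x) \<le> M * norm x" if "t \<in> {0..\<delta>}" for t x
  proof -
    have "M0 * norm x \<le> M * norm x" by (rule mult_right_mono) (auto simp: M_def)
    with M0[OF that, of x] show ?thesis by linarith
  qed
  have *: "norm (S t x) \<le> M ^ Suc n * norm x" if "t \<in> {0..real (Suc n) * \<delta>}" for n t x
    using that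
  proof (induction n arbitrary: t)
    case 0
    then show ?case using M by simp
  next
    case (Suc n)
    show ?case
    proof (cases "t \<le> \<delta>")
      case True
      have "norm (S t x) \<le> M * norm x" using M True Suc.prems by auto
      also have "\<dots> \<le> M ^ Suc (Suc n) * norm x"
        using self_le_power[OF M1, of "Suc (Suc n)"] by (intro mult_right_mono) auto
      finally show ?thesis .
    next
      case False
      have "S t x = S \<delta> (S (t - \<delta>) x)"
        using add[of \<delta> "t - \<delta>" x] False \<delta> by simp
      then have "norm (S t x) \<le> M * norm (S (t - \<delta>) x)"
        using M[of \<delta>] \<delta> by simp
      also have "\<dots> \<le> M * (M ^ Suc n * norm x)"
        using Suc False M1 by (intro mult_left_mono Suc.IH) (auto simp: algebra_simps)
      finally show ?thesis by (simp add: mult_ac)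
    qed
  qed
  obtain n :: nat where "\<tau> < real n * \<delta>" using reals_Archimedean3[OF \<delta>] by blast
  then have "\<tau> \<le> real (Suc n) * \<delta>" using \<delta> by (simp add: algebra_simps)
  then show ?thesis
    using * M1 by (intro that[of "M ^ Suc n"]) (auto simp: one_le_power simp del: power_Suc)
qed

lemma continuous: "continuous_on {0..} (\<lambda>t. S t x)"
proof (unfold continuous_on_iff, intro ballI allI impI)
  fix t e :: real assume t: "t \<in> {0..}" and e: "e > 0"
  obtain M where M1: "M \<ge> 1" and M: "\<And>s y. s \<in> {0..t} \<Longrightarrow> norm (S s y) \<le> M * norm y"
    using locally_bounded by blast
  have "eventually (\<lambda>u. dist (S u x) (S 0 x) < e / M) (at_right 0)"
    using right_cont[of x] e M1 by (auto simp: tendsto_iff)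
  then obtain d where d: "d > 0" "\<And>u. 0 < u \<Longrightarrow> u < d \<Longrightarrow> dist (S u x) (S 0 x) < e / M"
    by (auto simp: eventually_at_right_field)
  \<comment> \<open>Here \<open>a\<close> is the earlier of the two times compared. Left and right
    continuity thus both reduce to the right limit at 0, transported by the bounded operator
    \<open>S a\<close>.\<close>
  have key: "dist (S (a + u) x) (S a x) < e" if "0 \<le> a" "a \<le> t" "0 \<le> u" "u < d" for a u
  proof (cases "u = 0")
    case False
    have "S (a + u) x - S a x = S a (S u x - S 0 x)"
      using that by (simp add: add S_minus S_zero_right)
    then have "dist (S (a + u) x) (S a x) \<le> M * norm (S u x - S 0 x)"
      using M[of a] that by (simp add: dist_norm)
    also have "\<dots> < e"
      using d(2)[of u] that False M1 by (simp add: dist_norm field_simps)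
    finally show ?thesis .
  qed (use e in simp)
  show "\<exists>d>0. \<forall>s\<in>{0..}. dist s t < d \<longrightarrow> dist (S s x) (S t x) < e"
  proof (intro exI[of _ d] conjI ballI impI d(1))
    fix s :: real assume "s \<in> {0..}" "dist s t < d"
    then show "dist (S s x) (S t x) < e"
      using key[of t "s - t"] key[of s "t - s"] t
      by (cases "s \<ge> t") (auto simp: dist_norm norm_minus_commute)
  qed
qed

lemma gen_invariant:
  assumes "(x, y) \<in> gen" "t \<ge> 0"
  shows "(S t x, S t y) \<in> gen"
proof -
  have "((\<lambda>h. S t ((1 / h) *\<^sub>R (S h x - x))) \<longlongrightarrow> S t y) (at_right 0)"
    by (rule bounded_linear.tendsto[OF lin[OF assms(2)]]) (use assms(1) in \<open>simp add: gen_def\<close>)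
  moreover have "eventually (\<lambda>h. S t ((1 / h) *\<^sub>R (S h x - x)) = (1 / h) *\<^sub>R (S h (S t x) - S t x))
      (at_right 0)"
    using eventually_at_right_less[of "0::real"]
    by eventually_elim (use assms in \<open>simp add: S_scaleR S_minus commute\<close>)
  ultimately have "((\<lambda>h. (1 / h) *\<^sub>R (S h (S t x) - S t x)) \<longlongrightarrow> S t y) (at_right 0)"
    by (rule Lim_transform_eventually)
  then show ?thesis
    using assms by (auto simp: gen_def S_zero_left)
qed

lemma iterated_domain_invariant: "x \<in> iterated_domain k \<Longrightarrow> t \<ge> 0 \<Longrightarrow> S t x \<in> iterated_domain k"
  by (induction k arbitrary: x) (auto simp: S_zero_left intro: gen_invariant)

lemma iterated_domain_Suc_subset: "iterated_domain (Suc k) \<subseteq> iterated_domain k"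
proof (induction k)
  case 0
  then show ?case by (auto simp: gen_def)
next
  case (Suc k)
  then show ?case by auto
qed

text \<open>A telescoping sum over a partition of \<open>[0, r]\<close> replaces integrating the derivative
  \<open>S s y\<close> of \<open>S s x\<close>.\<close>

lemma increment_bound:
  assumes xy: "(x, y) \<in> gen" and r: "r \<ge> 0"
    and B: "\<And>s. s \<in> {0..r} \<Longrightarrow> norm (S s y - w) \<le> B"
  shows "norm (S r x - x - r *\<^sub>R w) \<le> r * B"
proof (cases "r = 0")
  case True
  then show ?thesis using xy by (simp add: gen_def)
next
  case False
  then have r: "r > 0" using r by simp
  obtain M where M1: "M \<ge> 1" and M: "\<And>s y. s \<in> {0..r} \<Longrightarrow> norm (S s y) \<le> M * norm y"
    using locally_bounded by blast
  \<comment> \<open>This is the error of the difference quotient at time 0. Carried along the orbit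
    by \<open>S (real k * h)\<close> it grows at most by the factor \<open>M\<close>, so all steps
    share one error bound.\<close>
  define \<eta> where "\<eta> h = norm ((1 / h) *\<^sub>R (S h x - x) - y)" for h
  have x0: "S 0 x = x" using xy by (simp add: gen_def)
  have bound: "norm (S r x - x - r *\<^sub>R w) \<le> r * (M * \<eta> (r / real (Suc n)) + B)" for n
  proof -
    define h where "h = r / real (Suc n)"
    have h: "h > 0" and nh: "real (Suc n) * h = r" using r by (auto simp: h_def)
    have step: "norm (S (real (Suc k) * h) x - S (real k * h) x - h *\<^sub>R w) \<le> h * (M * \<eta> h + B)"
      if k: "k < Suc n" for k
    proof -
      have kh: "0 \<le> real k * h" "real k * h \<le> r"
        using h k nh mult_right_mono[of "real k" "real (Suc n)" h] by auto
      have "S (real (Suc k) * h) x = S (real k * h) (S h x)"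
        using add[of "real k * h" h x] h by (simp add: algebra_simps)
      then have "S (real (Suc k) * h) x - S (real k * h) x - h *\<^sub>R w
        = S (real k * h) (h *\<^sub>R ((1 / h) *\<^sub>R (S h x - x) - y)) + h *\<^sub>R (S (real k * h) y - w)"
        using h kh by (simp add: S_minus S_scaleR scaleR_diff_right)
      also have "norm \<dots> \<le> M * (h * \<eta> h) + h * B"
        using M[of "real k * h" "h *\<^sub>R ((1 / h) *\<^sub>R (S h x - x) - y)"] B[of "real k * h"] kh h
        by (intro norm_triangle_le add_mono) (auto simp: \<eta>_def)
      finally show ?thesis by (simp add: algebra_simps)
    qed
    have "S r x - x - r *\<^sub>R w = (\<Sum>k<Suc n. S (real (Suc k) * h) x - S (real k * h) x - h *\<^sub>R w)"
      using sum_lessThan_telescope[of "\<lambda>k. S (real k * h) x" "Suc n"]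
      by (simp only: sum_subtractf nh sum_constant_scaleR card_lessThan) (simp add: x0 nh[symmetric])
    also have "norm \<dots> \<le> (\<Sum>k<Suc n. h * (M * \<eta> h + B))"
      by (rule sum_norm_le) (use step in auto)
    also have "\<dots> = r * (M * \<eta> h + B)"
      by (simp only: sum_constant card_lessThan mult.assoc[symmetric] nh)
    finally show ?thesis by (simp add: h_def)
  qed
  have "(\<lambda>n. r / real (Suc n)) \<longlonglongrightarrow> 0"
    by (rule LIMSEQ_Suc[OF lim_const_over_n])
  then have "filterlim (\<lambda>n. r / real (Suc n)) (at_right 0) sequentially"
    using r by (auto simp: filterlim_at intro!: always_eventually)
  moreover have "(\<eta> \<longlongrightarrow> 0) (at_right 0)"
    using xy unfolding \<eta>_def gen_def by (auto intro: tendsto_norm_zero simp: LIM_zero_iff)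
  ultimately have "(\<lambda>n. \<eta> (r / real (Suc n))) \<longlonglongrightarrow> 0"
    by (rule filterlim_compose[rotated])
  then have "(\<lambda>n. r * (M * \<eta> (r / real (Suc n)) + B)) \<longlonglongrightarrow> r * (M * 0 + B)"
    by (intro tendsto_intros)
  then show ?thesis
    using bound by (intro tendsto_lowerbound[where F=sequentially]) (auto intro!: always_eventually)
qed

lemma increment_bound_zero:
  assumes "(x, y) \<in> gen" "r \<ge> 0" "\<And>s. s \<in> {0..r} \<Longrightarrow> norm (S s y) \<le> B"
  shows "norm (S r x - x) \<le> r * B"
  using increment_bound[OF assms(1,2), of 0 B] assms(3) by simp

section \<open>Time averages of orbits and the density of the domains of powers of the
  generator\<close>

definition average :: "real \<Rightarrow> 'a \<Rightarrow> 'a" where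
  "average h x = (1 / h) *\<^sub>R integral {0..h} (\<lambda>s. S s x)"

lemma continuous_Icc: "0 \<le> a \<Longrightarrow> continuous_on {a..b} (\<lambda>s. S s x)"
  by (rule continuous_on_subset[OF continuous]) auto

lemma integral_mean_tendsto:
  assumes "a \<ge> 0"
  shows "((\<lambda>r. (1 / r) *\<^sub>R integral {a..a + r} (\<lambda>s. S s x)) \<longlongrightarrow> S a x) (at_right 0)"
proof (unfold tendsto_iff, intro allI impI)
  fix e :: real assume e: "e > 0"
  obtain d where d: "d > 0" "\<And>s. s \<in> {0..} \<Longrightarrow> dist s a < d \<Longrightarrow> dist (S s x) (S a x) < e / 2"
    using continuous[of x] assms e unfolding continuous_on_iff
    by (metis atLeast_iff half_gt_zero)
  have "eventually (\<lambda>r. r < d) (at_right 0)"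
    using d(1) by (auto simp: eventually_at_right_field)
  then show "eventually (\<lambda>r. dist ((1 / r) *\<^sub>R integral {a..a + r} (\<lambda>s. S s x)) (S a x) < e) (at_right 0)"
    using eventually_at_right_less[of "0::real"]
  proof eventually_elim
    case (elim r)
    have int: "(\<lambda>s. S s x) integrable_on {a..a + r}"
      using assms by (intro integrable_continuous_real continuous_Icc)
    have "integral {a..a + r} (\<lambda>s. S s x - S a x) = integral {a..a + r} (\<lambda>s. S s x) - r *\<^sub>R S a x"
      using int elim by (subst integral_diff) (auto intro: integrable_const_ivl)
    moreover have "norm (integral {a..a + r} (\<lambda>s. S s x - S a x)) \<le> e / 2 * (a + r - a)"
    proof (rule integral_bound)
      show "a \<le> a + r" using elim by simp
      show "continuous_on {a..a + r} (\<lambda>s. S s x - S a x)"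
        using assms by (intro continuous_intros continuous_Icc)
      show "norm (S t x - S a x) \<le> e / 2" if "t \<in> {a..a + r}" for t
        using d(2)[of t] that elim assms by (auto simp: dist_norm)
    qed
    moreover have "(1 / r) *\<^sub>R integral {a..a + r} (\<lambda>s. S s x) - S a x
        = (1 / r) *\<^sub>R (integral {a..a + r} (\<lambda>s. S s x) - r *\<^sub>R S a x)"
      using elim by (simp add: scaleR_diff_right)
    ultimately have "dist ((1 / r) *\<^sub>R integral {a..a + r} (\<lambda>s. S s x)) (S a x)
        = (1 / r) * norm (integral {a..a + r} (\<lambda>s. S s x - S a x))"
      "norm (integral {a..a + r} (\<lambda>s. S s x - S a x)) \<le> e / 2 * r"
      using elim by (simp_all add: dist_norm)
    then have "dist ((1 / r) *\<^sub>R integral {a..a + r} (\<lambda>s. S s x)) (S a x) \<le> e / 2"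
      using elim mult_left_mono[of "norm (integral {a..a + r} (\<lambda>s. S s x - S a x))" "e / 2 * r" "1 / r"]
      by simp
    then show ?case using e by simp
  qed
qed

lemma S_average:
  assumes "r \<ge> 0" "h \<ge> 0"
  shows "S r (average h x) = average h (S r x)"
    and "S r (average h x) = (1 / h) *\<^sub>R (integral {0..h + r} (\<lambda>s. S s x) - integral {0..r} (\<lambda>s. S s x))"
proof -
  have int: "(\<lambda>s. S s x) integrable_on {0..h}"
    by (intro integrable_continuous_real continuous_Icc) simp
  have "S r (integral {0..h} (\<lambda>s. S s x)) = integral {0..h} (S r \<circ> (\<lambda>s. S s x))"
    by (rule integral_linear[OF int lin[OF assms(1)], symmetric])
  then have *: "S r (average h x) = (1 / h) *\<^sub>R integral {0..h} (\<lambda>s. S r (S s x))"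
    using assms by (simp add: average_def S_scaleR o_def)
  also have "integral {0..h} (\<lambda>s. S r (S s x)) = integral {0..h} (\<lambda>s. S s (S r x))"
    using assms by (intro integral_cong) (auto intro: commute)
  finally show "S r (average h x) = average h (S r x)" by (simp add: average_def)
  have "integral {0..h} (\<lambda>s. S r (S s x)) = integral {0..h} (\<lambda>s. S (s + r) x)"
    using assms by (intro integral_cong) (auto simp: add commute)
  also have "\<dots> = integral {0 + r..h + r} (\<lambda>s. S s x)"
    using integral_shift_Icc_real[of 0 h "\<lambda>s. S s x" r] by (simp add: o_def add.commute)
  also have "\<dots> = integral {0..h + r} (\<lambda>s. S s x) - integral {0..r} (\<lambda>s. S s x)"
    using Henstock_Kurzweil_Integration.integral_combine[of 0 r "h + r" "\<lambda>s. S s x"] assms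
    by (simp add: integrable_continuous_real continuous_Icc eq_diff_eq add.commute)
  finally show "S r (average h x) = (1 / h) *\<^sub>R (integral {0..h + r} (\<lambda>s. S s x) - integral {0..r} (\<lambda>s. S s x))"
    using * by simp
qed

text \<open>Applying \<open>S r\<close> shifts the window of integration, so the increment of the
  average is the integral over \<open>[h, h + r]\<close> minus the integral over
  \<open>[0, r]\<close>, divided by \<open>h\<close>. After division by \<open>r\<close> the two
  integrals tend to \<open>S h x\<close> and \<open>S 0 x\<close>.\<close>

lemma average_gen:
  assumes h: "h > 0" and x: "S 0 x = x"
  shows "(average h x, (1 / h) *\<^sub>R (S h x - x)) \<in> gen"
proof -
  let ?I = "\<lambda>a b. integral {a..b} (\<lambda>s. S s x)"
  have "((\<lambda>r. (1 / h) *\<^sub>R ((1 / r) *\<^sub>R ?I h (h + r) - (1 / r) *\<^sub>R ?I 0 (0 + r)))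
      \<longlongrightarrow> (1 / h) *\<^sub>R (S h x - S 0 x)) (at_right 0)"
    using h by (intro tendsto_intros integral_mean_tendsto) auto
  moreover have "eventually (\<lambda>r. (1 / h) *\<^sub>R ((1 / r) *\<^sub>R ?I h (h + r) - (1 / r) *\<^sub>R ?I 0 (0 + r))
      = (1 / r) *\<^sub>R (S r (average h x) - average h x)) (at_right 0)"
    using eventually_at_right_less[of "0::real"]
  proof eventually_elim
    case (elim r)
    have "?I 0 h + ?I h (h + r) = ?I 0 (h + r)"
      using elim h by (intro Henstock_Kurzweil_Integration.integral_combine
        integrable_continuous_real continuous_Icc) auto
    then have "?I h (h + r) = ?I 0 (h + r) - ?I 0 h" by (simp add: algebra_simps)
    then show ?case
      using S_average(2)[of r h x] elim h by (simp add: average_def scaleR_diff_right mult.commute)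
  qed
  ultimately have "((\<lambda>r. (1 / r) *\<^sub>R (S r (average h x) - average h x)) \<longlongrightarrow> (1 / h) *\<^sub>R (S h x - S 0 x)) (at_right 0)"
    by (rule Lim_transform_eventually)
  moreover have "S 0 (average h x) = average h x"
    using S_average(1)[of 0 h x] h x by simp
  ultimately show ?thesis
    using x h by (simp add: gen_def S_scaleR S_minus S_zero_left)
qed

lemma average_diff: "h \<ge> 0 \<Longrightarrow> average h (x - y) = average h x - average h y"
proof -
  assume h: "h \<ge> 0"
  have "integral {0..h} (\<lambda>s. S s (x - y)) = integral {0..h} (\<lambda>s. S s x - S s y)"
    by (intro integral_cong) (auto simp: S_minus)
  also have "\<dots> = integral {0..h} (\<lambda>s. S s x) - integral {0..h} (\<lambda>s. S s y)"
    by (intro integral_diff integrable_continuous_real continuous_Icc) auto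
  finally show ?thesis by (simp add: average_def scaleR_diff_right)
qed

lemma average_scaleR: "h \<ge> 0 \<Longrightarrow> average h (c *\<^sub>R x) = c *\<^sub>R average h x"
proof -
  assume h: "h \<ge> 0"
  have "integral {0..h} (\<lambda>s. S s (c *\<^sub>R x)) = integral {0..h} (\<lambda>s. c *\<^sub>R S s x)"
    by (intro integral_cong) (auto simp: S_scaleR)
  then show ?thesis by (simp add: average_def)
qed

lemma average_bound:
  assumes "h > 0" and "\<And>t x. t \<in> {0..h} \<Longrightarrow> norm (S t x) \<le> M * norm x"
  shows "norm (average h x) \<le> M * norm x"
proof -
  have "norm (integral {0..h} (\<lambda>s. S s x)) \<le> (M * norm x) * (h - 0)"
    using assms by (intro integral_bound continuous_Icc) auto
  then show ?thesis using assms(1) by (simp add: average_def field_simps)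
qed

text \<open>Averaging is bounded and commutes with every \<open>S r\<close>, hence it commutes with
  difference quotients and with their limits.\<close>

lemma average_preserves_gen:
  assumes xy: "(x, y) \<in> gen" and h: "h > 0"
  shows "(average h x, average h y) \<in> gen"
proof -
  obtain M where M: "\<And>s y. s \<in> {0..h} \<Longrightarrow> norm (S s y) \<le> M * norm y"
    using locally_bounded by blast
  have "((\<lambda>r. (1 / r) *\<^sub>R (S r x - x) - y) \<longlongrightarrow> 0) (at_right 0)"
    using xy by (auto simp: gen_def LIM_zero_iff)
  then have "((\<lambda>r. M * norm ((1 / r) *\<^sub>R (S r x - x) - y)) \<longlongrightarrow> 0) (at_right 0)"
    by (intro tendsto_mult_right_zero tendsto_norm_zero)
  then have "((\<lambda>r. (1 / r) *\<^sub>R (S r (average h x) - average h x) - average h y) \<longlongrightarrow> 0) (at_right 0)"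
  proof (rule Lim_null_comparison[rotated])
    show "eventually (\<lambda>r. norm ((1 / r) *\<^sub>R (S r (average h x) - average h x) - average h y)
        \<le> M * norm ((1 / r) *\<^sub>R (S r x - x) - y)) (at_right 0)"
      using eventually_at_right_less[of "0::real"]
    proof eventually_elim
      case (elim r)
      have "(1 / r) *\<^sub>R (S r (average h x) - average h x) - average h y
          = average h ((1 / r) *\<^sub>R (S r x - x) - y)"
        using h elim by (simp add: average_diff average_scaleR S_average(1))
      then show ?case using average_bound[OF h M] by simp
    qed
  qed
  then show ?thesis
    using xy h by (auto simp: gen_def LIM_zero_iff S_average(1))
qed

text \<open>\<open>average_gen\<close> gains the first power of the generator, and commutation with
  the generator carries this gain through the induction.\<close>

lemma average_iterated_domain:
  "x \<in> iterated_domain k \<Longrightarrow> h > 0 \<Longrightarrow> average h x \<in> iterated_domain (Suc k)"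
proof (induction k arbitrary: x)
  case 0
  then have "S 0 x = x" by simp
  then have "S 0 ((1 / h) *\<^sub>R (S h x - x)) = (1 / h) *\<^sub>R (S h x - x)"
    using 0(2) by (simp add: S_scaleR S_minus S_zero_left)
  with average_gen[OF 0(2) \<open>S 0 x = x\<close>] show ?case by auto
next
  case (Suc k)
  then obtain y where y: "(x, y) \<in> gen" "y \<in> iterated_domain k" by auto
  have "(average h x, average h y) \<in> gen" "average h y \<in> iterated_domain (Suc k)"
    using average_preserves_gen[OF y(1) Suc.prems(2)] Suc.IH[OF y(2) Suc.prems(2)] by auto
  then show ?case
    unfolding iterated_domain.simps(2)[of "Suc k"] by blast
qed

text \<open>Each induction step averages once more over a window so short that at most half of the
  permitted error is spent.\<close>

lemma iterated_domain_dense: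
  assumes "S 0 x = x" "e > 0"
  shows "\<exists>x'\<in>iterated_domain k. norm (x - x') < e"
  using assms(2)
proof (induction k arbitrary: e)
  case 0
  then show ?case using assms(1) by (intro bexI[of _ x]) auto
next
  case (Suc k)
  obtain x' where x': "x' \<in> iterated_domain k" "norm (x - x') < e / 2"
    using Suc.IH[of "e / 2"] Suc.prems by auto
  have "iterated_domain k \<subseteq> iterated_domain 0"
    by (induction k) (use iterated_domain_Suc_subset in blast)+
  then have "S 0 x' = x'" using x'(1) by auto
  then have "((\<lambda>h. average h x') \<longlongrightarrow> x') (at_right 0)"
    using integral_mean_tendsto[of 0 x'] by (simp add: average_def)
  then have "eventually (\<lambda>h. dist (average h x') x' < e / 2) (at_right 0)"
    by (rule tendstoD) (use Suc.prems in simp)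
  then have "eventually (\<lambda>h. dist (average h x') x' < e / 2 \<and> 0 < h) (at_right 0)"
    by (intro eventually_conj eventually_at_right_less)
  then obtain h where h: "dist (average h x') x' < e / 2" "h > 0"
    by (auto dest!: eventually_happens)
  have "norm (x - average h x') \<le> norm (x - x') + norm (x' - average h x')"
    using norm_triangle_ineq[of "x - x'" "x' - average h x'"] by simp
  also have "\<dots> < e" using x'(2) h(1) by (simp add: dist_norm norm_minus_commute)
  finally show ?case using average_iterated_domain[OF x'(1) h(2)] by blast
qed

text \<open>This is the implicit Euler scheme read backwards. On a pair of the generator,
  \<open>S (k h + h) x - h S (k h + h) y\<close> differs from \<open>S (k h) x\<close> by o(h), and
  dissipativity bounds \<open>S (k h + h) x\<close> by the norm of that difference. The n + 1 errors
  add up to t times a quantity tending to 0; density and boundedness extend the inequality to the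
  whole range of \<open>S 0\<close>.\<close>

lemma dissipative_imp_contraction:
  assumes diss: "\<And>x y h. (x, y) \<in> gen \<Longrightarrow> h > 0 \<Longrightarrow> norm x \<le> norm (x - h *\<^sub>R y)"
    and x: "S 0 x = x" and t: "t \<ge> 0"
  shows "norm (S t x) \<le> norm x"
proof -
  obtain M where M1: "M \<ge> 1" and M: "\<And>s y. s \<in> {0..t} \<Longrightarrow> norm (S s y) \<le> M * norm y"
    using locally_bounded by blast
  have dom: "norm (S t x) \<le> norm x" if xy: "(x, y) \<in> gen" and t: "t > 0"
    and M: "\<And>s y. s \<in> {0..t} \<Longrightarrow> norm (S s y) \<le> M * norm y" for x y
  proof -
    \<comment> \<open>The quotient is compared with \<open>S h y\<close>, the derivative at the
      right end of the step, because dissipativity is applied there.\<close>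
    define \<eta> where "\<eta> h = norm ((1 / h) *\<^sub>R (S h x - x) - S h y)" for h
    have bound: "norm (S t x) \<le> norm x + t * (M * \<eta> (t / real (Suc n)))" for n
    proof -
      define h where "h = t / real (Suc n)"
      have h: "h > 0" and nh: "real (Suc n) * h = t" using t by (auto simp: h_def)
      have step: "norm (S (real k * h) x) \<le> norm x + real k * h * (M * \<eta> h)" if "k \<le> Suc n" for k
        using that
      proof (induction k)
        case 0
        then show ?case using xy by (simp add: gen_def)
      next
        case (Suc k)
        have kh: "0 \<le> real k * h" "real k * h \<le> t"
          using h Suc.prems nh mult_right_mono[of "real k" "real (Suc n)" h] by auto
        let ?s = "real (Suc k) * h"
        have s: "?s = real k * h + h" by (simp add: algebra_simps)
        have "norm (S ?s x) \<le> norm (S ?s x - h *\<^sub>R S ?s y)"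
          using h by (intro diss gen_invariant xy) auto
        also have "S ?s x - h *\<^sub>R S ?s y = S (real k * h) x
            + S (real k * h) (h *\<^sub>R ((1 / h) *\<^sub>R (S h x - x) - S h y))"
          using h kh unfolding s by (simp add: S_minus S_scaleR scaleR_diff_right add)
        also have "norm \<dots> \<le> norm x + real k * h * (M * \<eta> h) + M * (h * \<eta> h)"
          using M[of "real k * h" "h *\<^sub>R ((1 / h) *\<^sub>R (S h x - x) - S h y)"] Suc kh h
          by (intro norm_triangle_le add_mono) (auto simp: \<eta>_def)
        finally show ?case by (simp add: algebra_simps)
      qed
      have "norm (S t x) \<le> norm x + t * (M * \<eta> h)"
        using step[OF le_refl] by (simp only: nh)
      then show ?thesis by (simp only: h_def)
    qed
    have "(\<lambda>n. t / real (Suc n)) \<longlonglongrightarrow> 0"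
      by (rule LIMSEQ_Suc[OF lim_const_over_n])
    then have "filterlim (\<lambda>n. t / real (Suc n)) (at_right 0) sequentially"
      using t by (auto simp: filterlim_at intro!: always_eventually)
    moreover have "(\<eta> \<longlongrightarrow> norm (y - S 0 y)) (at_right 0)"
      unfolding \<eta>_def by (intro tendsto_intros right_cont) (use xy in \<open>simp add: gen_def\<close>)
    ultimately have "(\<lambda>n. \<eta> (t / real (Suc n))) \<longlonglongrightarrow> 0"
      using xy filterlim_compose by (fastforce simp: gen_def)
    then have "(\<lambda>n. norm x + t * (M * \<eta> (t / real (Suc n)))) \<longlonglongrightarrow> norm x + t * (M * 0)"
      by (intro tendsto_intros)
    then show ?thesis
      using bound by (intro tendsto_lowerbound[where F=sequentially]) (auto intro!: always_eventually)
  qed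
  show ?thesis
  proof (cases "t = 0")
    case False
    show ?thesis
    proof (rule field_le_epsilon)
      fix e :: real assume e: "e > 0"
      \<comment> \<open>Replacing \<open>x\<close> by \<open>x'\<close> costs \<open>M\<close> times
        their distance at time \<open>t\<close> and once their distance at time 0, hence the
        denominator \<open>M + 1\<close>.\<close>
      obtain x' where x': "x' \<in> iterated_domain 1" "norm (x - x') < e / (M + 1)"
        using iterated_domain_dense[OF x, of "e / (M + 1)" 1] e M1 by auto
      then obtain y' where "(x', y') \<in> gen" by auto
      then have "norm (S t x') \<le> norm x'" using dom M False t by (metis less_eq_real_def)
      moreover have "norm (S t x) \<le> norm (S t x') + norm (S t (x - x'))"
        using t norm_triangle_ineq[of "S t x'" "S t (x - x')"] by (simp add: S_minus)
      moreover have "norm (S t (x - x')) \<le> M * norm (x - x')" using M t by auto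
      moreover have "norm x' \<le> norm x + norm (x - x')"
        using norm_triangle_ineq2[of x' x] by (simp add: norm_minus_commute)
      moreover have "(M + 1) * norm (x - x') \<le> e"
        using x'(2) M1 by (simp add: field_simps)
      ultimately show "norm (S t x) \<le> norm x + e" by (simp add: algebra_simps)
    qed
  qed (use x in simp)
qed

end

section \<open>Convergence of contraction semigroups\<close>

text \<open>First order Taylor expansion: \<open>increment_bound_zero\<close> for
  \<open>(y, z)\<close> controls the change of the derivative, and \<open>increment_bound\<close>
  for \<open>(x, y)\<close> turns this into the remainder. The bound is in terms of \<open>h\<close>
  so as to hold uniformly for all \<open>r\<close> up to \<open>h\<close>.\<close>

lemma (in degenerate_semigroup) second_order_bound:
  assumes xy: "(x, y) \<in> gen" and yz: "(y, z) \<in> gen" and r: "0 \<le> r" "r \<le> h"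
    and M: "\<And>s u. s \<in> {0..h} \<Longrightarrow> norm (S s u) \<le> M * norm u"
  shows "norm (S r x - x - r *\<^sub>R y) \<le> h\<^sup>2 * (M * norm z)"
proof -
  have Mz: "0 \<le> M * norm z"
    using M[of 0 z] r by (auto intro: order_trans[OF norm_ge_zero])
  have "norm (S s y - y) \<le> h * (M * norm z)" if s: "s \<in> {0..r}" for s
  proof -
    have "norm (S s y - y) \<le> s * (M * norm z)"
      using s r by (intro increment_bound_zero[OF yz]) (auto intro!: M)
    also have "\<dots> \<le> h * (M * norm z)"
      using s r Mz by (intro mult_right_mono) auto
    finally show ?thesis .
  qed
  then have "norm (S r x - x - r *\<^sub>R y) \<le> r * (h * (M * norm z))"
    using r by (intro increment_bound[OF xy]) auto
  also have "\<dots> \<le> h * (h * (M * norm z))"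
    using r Mz by (intro mult_right_mono) auto
  finally show ?thesis by (simp add: power2_eq_square mult.assoc)
qed

text \<open>\<open>approximants\<close> says that the graph of the limit generator is reached by the
  graphs of the generators of \<open>T \<epsilon>\<close>. It asks for this only when
  \<open>y\<close> lies in the domain again, which is the regularity used to construct
  correctors.\<close>

locale semigroup_approximation = limit: degenerate_semigroup U
  for U :: "real \<Rightarrow> 'a::banach \<Rightarrow> 'a" +
  fixes T :: "real \<Rightarrow> real \<Rightarrow> 'a \<Rightarrow> 'a"
  assumes semigroup: "\<epsilon> > 0 \<Longrightarrow> degenerate_semigroup (T \<epsilon>)"
    and contraction: "\<epsilon> > 0 \<Longrightarrow> t \<ge> 0 \<Longrightarrow> norm (T \<epsilon> t x) \<le> norm x"
    and at_zero: "\<epsilon> > 0 \<Longrightarrow> T \<epsilon> 0 x = x"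
    and approximants: "(x, y) \<in> limit.gen \<Longrightarrow> y \<in> limit.iterated_domain 1 \<Longrightarrow>
      \<exists>xe ye. (\<forall>\<epsilon>>0. (xe \<epsilon>, ye \<epsilon>) \<in> degenerate_semigroup.gen (T \<epsilon>)) \<and>
        (xe \<longlongrightarrow> x) (at_right 0) \<and> (ye \<longlongrightarrow> y) (at_right 0)"
begin

text \<open>Both semigroups are compared with the Euler step \<open>x + r y\<close>. For
  \<open>T \<epsilon>\<close> the derivative \<open>ye \<epsilon>\<close> need not lie in the
  domain, so its variation is estimated through \<open>ve \<epsilon>\<close>, a second approximant
  of \<open>y\<close> whose own derivative \<open>ze \<epsilon>\<close> stays bounded.\<close>

lemma one_step:
  assumes xy: "(x, y) \<in> limit.gen" and yz: "(y, z) \<in> limit.gen" and z: "z \<in> limit.iterated_domain 1"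
    and e: "e > 0" and h: "h > 0"
    and M: "\<And>s u. s \<in> {0..h} \<Longrightarrow> norm (U s u) \<le> M * norm u"
  shows "eventually (\<lambda>\<epsilon>. \<forall>r\<in>{0..h}. norm (T \<epsilon> r x - U r x) \<le> e + h\<^sup>2 * ((M + 1) * norm z + 1)) (at_right 0)"
proof -
  have y: "y \<in> limit.iterated_domain 1"
    using yz z limit.iterated_domain_Suc_subset[of 0] by auto
  obtain xe ye where a: "\<And>\<epsilon>. \<epsilon> > 0 \<Longrightarrow> (xe \<epsilon>, ye \<epsilon>) \<in> degenerate_semigroup.gen (T \<epsilon>)"
    "(xe \<longlongrightarrow> x) (at_right 0)" "(ye \<longlongrightarrow> y) (at_right 0)"
    using approximants[OF xy y] by blast
  obtain ve ze where b: "\<And>\<epsilon>. \<epsilon> > 0 \<Longrightarrow> (ve \<epsilon>, ze \<epsilon>) \<in> degenerate_semigroup.gen (T \<epsilon>)"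
    "(ve \<longlongrightarrow> y) (at_right 0)" "(ze \<longlongrightarrow> z) (at_right 0)"
    using approximants[OF yz z] by blast
  \<comment> \<open>In the final sum \<open>d\<close> occurs twice for replacing \<open>x\<close> by
    \<open>xe \<epsilon>\<close>, \<open>4 * h\<close> times for replacing
    \<open>ye \<epsilon>\<close> by \<open>ve \<epsilon>\<close>, and \<open>h\<close> times for
    replacing \<open>y\<close> by \<open>ye \<epsilon>\<close>.\<close>
  define d where "d = e / (2 + 5 * h)"
  have d: "d > 0" using e h by (simp add: d_def)
  have "eventually (\<lambda>\<epsilon>. dist (xe \<epsilon>) x < d) (at_right 0)" "eventually (\<lambda>\<epsilon>. dist (ye \<epsilon>) y < d) (at_right 0)"
    "eventually (\<lambda>\<epsilon>. dist (ve \<epsilon>) y < d) (at_right 0)" "eventually (\<lambda>\<epsilon>. dist (ze \<epsilon>) z < 1) (at_right 0)"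
    using a(2,3) b(2,3) d by (auto intro: tendstoD)
  then show ?thesis
    using eventually_at_right_less[of "0::real"]
  proof eventually_elim
    case (elim \<epsilon>)
    interpret T: degenerate_semigroup "T \<epsilon>" by (rule semigroup) (rule elim)
    have c: "\<And>t x. t \<ge> 0 \<Longrightarrow> norm (T \<epsilon> t x) \<le> norm x" using contraction elim by auto
    have xye: "(xe \<epsilon>, ye \<epsilon>) \<in> T.gen" and vze: "(ve \<epsilon>, ze \<epsilon>) \<in> T.gen" using a b elim by auto
    have zn: "norm (ze \<epsilon>) \<le> norm z + 1"
      using norm_triangle_ineq2[of "ze \<epsilon>" z] elim by (simp add: dist_norm)
    have vy: "norm (ve \<epsilon> - ye \<epsilon>) \<le> 2 * d"
      using norm_triangle_ineq4[of "ve \<epsilon> - y" "ye \<epsilon> - y"] elim by (simp add: dist_norm)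
    show ?case
    proof
      fix r assume r: "r \<in> {0..h}"
      \<comment> \<open>The distance of \<open>ve \<epsilon>\<close> and
        \<open>ye \<epsilon>\<close> is at most \<open>2 * d\<close> and is paid twice, before and
        after applying the contraction.\<close>
      have ys: "norm (T \<epsilon> s (ye \<epsilon>) - ye \<epsilon>) \<le> 4 * d + h * (norm z + 1)" if s: "s \<in> {0..r}" for s
      proof -
        have "norm (T \<epsilon> s (ve \<epsilon>) - ve \<epsilon>) \<le> s * (norm z + 1)"
          using s zn by (intro T.increment_bound_zero[OF vze]) (auto intro!: order_trans[OF c])
        also have "\<dots> \<le> h * (norm z + 1)" using s r by (intro mult_right_mono) auto
        finally have 1: "norm (T \<epsilon> s (ve \<epsilon>) - ve \<epsilon>) \<le> h * (norm z + 1)" .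
        have eq: "T \<epsilon> s (ye \<epsilon>) - ye \<epsilon> = (T \<epsilon> s (ve \<epsilon>) - ve \<epsilon>) + ((ve \<epsilon> - ye \<epsilon>) - T \<epsilon> s (ve \<epsilon> - ye \<epsilon>))"
          using s by (simp add: T.S_minus)
        have 2: "norm ((ve \<epsilon> - ye \<epsilon>) - T \<epsilon> s (ve \<epsilon> - ye \<epsilon>)) \<le> 4 * d"
          using norm_triangle_ineq4[of "ve \<epsilon> - ye \<epsilon>" "T \<epsilon> s (ve \<epsilon> - ye \<epsilon>)"] c[of s "ve \<epsilon> - ye \<epsilon>"] vy s
          by auto
        show ?thesis
          unfolding eq using 1 2 norm_triangle_ineq[of "T \<epsilon> s (ve \<epsilon>) - ve \<epsilon>" "(ve \<epsilon> - ye \<epsilon>) - T \<epsilon> s (ve \<epsilon> - ye \<epsilon>)"]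
          by linarith
      qed
      have "norm (T \<epsilon> r (xe \<epsilon>) - xe \<epsilon> - r *\<^sub>R ye \<epsilon>) \<le> r * (4 * d + h * (norm z + 1))"
        using r ys by (intro T.increment_bound[OF xye]) auto
      also have "\<dots> \<le> h * (4 * d + h * (norm z + 1))"
        using r d h by (intro mult_right_mono) auto
      finally have 2: "norm (T \<epsilon> r (xe \<epsilon>) - xe \<epsilon> - r *\<^sub>R ye \<epsilon>) \<le> h * (4 * d + h * (norm z + 1))" .
      have 3: "norm (U r x - x - r *\<^sub>R y) \<le> h\<^sup>2 * (M * norm z)"
        using r M by (intro limit.second_order_bound[OF xy yz]) auto
      have 4: "norm (T \<epsilon> r (x - xe \<epsilon>)) \<le> d" "norm (xe \<epsilon> - x) \<le> d"
        using c[of r "x - xe \<epsilon>"] r elim by (auto simp: dist_norm norm_minus_commute)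
      have 5: "norm (r *\<^sub>R (ye \<epsilon> - y)) \<le> h * d"
        using r elim d by (auto simp: dist_norm intro!: mult_mono)
      have "T \<epsilon> r x - U r x = T \<epsilon> r (x - xe \<epsilon>) + (T \<epsilon> r (xe \<epsilon>) - xe \<epsilon> - r *\<^sub>R ye \<epsilon>)
          + (xe \<epsilon> - x) + r *\<^sub>R (ye \<epsilon> - y) - (U r x - x - r *\<^sub>R y)"
        using r by (simp add: T.S_minus scaleR_diff_right)
      also have "norm \<dots> \<le> d + h * (4 * d + h * (norm z + 1)) + d + h * d + h\<^sup>2 * (M * norm z)"
        by (rule order_trans[OF norm_triangle_ineq4] add_mono order_trans[OF norm_triangle_ineq] 2 3 4 5)+
      also have "\<dots> = (2 + 5 * h) * d + h\<^sup>2 * ((M + 1) * norm z + 1)"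
        by (simp add: algebra_simps power2_eq_square)
      also have "(2 + 5 * h) * d = e" using h by (simp add: d_def)
      finally show "norm (T \<epsilon> r x - U r x) \<le> e + h\<^sup>2 * ((M + 1) * norm z + 1)" .
    qed
  qed
qed

text \<open>Three powers of the generator are what \<open>one_step\<close> consumes: two for the
  second order expansion of the orbit, and a third so that the pair \<open>(y, z)\<close> has
  approximants as well.\<close>

lemma uniform_convergence_core:
  assumes x: "x \<in> limit.iterated_domain 3" and e: "e > 0" and \<tau>: "\<tau> > 0"
  shows "eventually (\<lambda>\<epsilon>. \<forall>t\<in>{0..\<tau>}. norm (T \<epsilon> t x - U t x) \<le> e) (at_right 0)"
proof -
  obtain y z where xy: "(x, y) \<in> limit.gen" and yz: "(y, z) \<in> limit.gen" and z: "z \<in> limit.iterated_domain 1"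
    using x by (auto simp: numeral_3_eq_3)
  obtain M where M1: "M \<ge> 1" and M: "\<And>s u. s \<in> {0..\<tau>} \<Longrightarrow> norm (U s u) \<le> M * norm u"
    using limit.locally_bounded by blast
  \<comment> \<open>This dominates the constant of \<open>one_step\<close> at every grid point,
    where \<open>z\<close> is replaced by \<open>U (real k * h) z\<close> of norm at most
    \<open>M * norm z\<close>.\<close>
  define C where "C = (M + 1) * (M * norm z) + 1"
  have C: "C > 0" using M1 by (auto simp: C_def intro!: add_nonneg_pos mult_nonneg_nonneg)
  \<comment> \<open>With mesh \<open>\<tau> / n\<close>, the n + 1 consistency errors
    \<open>h\<^sup>2 * C\<close> sum to at most \<open>2 * \<tau>\<^sup>2 * C / n\<close>, which
    this choice makes at most \<open>e / 2\<close>.\<close>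
  obtain n :: nat where n: "n > 0" "4 * \<tau>\<^sup>2 * C / e \<le> real n"
  proof -
    obtain m :: nat where "4 * \<tau>\<^sup>2 * C / e \<le> real m" using real_arch_simple by blast
    then show ?thesis by (intro that[of "Suc m"]) auto
  qed
  define h where "h = \<tau> / real n"
  have h: "h > 0" "h \<le> \<tau>" "real n * h = \<tau>"
    using n \<tau> by (auto simp: h_def field_simps)
  \<comment> \<open>The permitted error per step: one share of \<open>e / 2\<close> for the limit in
    \<open>\<epsilon>\<close> and one consistency error. There are \<open>Suc n\<close> shares
    because a time in the cell starting at \<open>k = n\<close> takes one more partial step.\<close>
  define a where "a = e / (2 * real (Suc n)) + h\<^sup>2 * C"
  have a: "a > 0" using e C h by (simp add: a_def add_pos_nonneg)
  have "real (Suc n) * (h\<^sup>2 * C) \<le> (2 * real n) * (h\<^sup>2 * C)"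
    using n C by (intro mult_right_mono) auto
  also have "\<dots> = 2 * \<tau>\<^sup>2 * C / real n"
    using n by (simp add: h_def power2_eq_square)
  also have "\<dots> \<le> e / 2"
    using n e by (simp add: field_simps)
  finally have na: "real (Suc n) * a \<le> e"
    by (simp add: a_def distrib_left del: of_nat_Suc)
  have "eventually (\<lambda>\<epsilon>. \<forall>r\<in>{0..h}. norm (T \<epsilon> r (U (real k * h) x) - U r (U (real k * h) x)) \<le> a) (at_right 0)"
    if k: "k \<in> {..n}" for k
  proof -
    have kh: "0 \<le> real k * h" "real k * h \<le> \<tau>"
      using k h mult_right_mono[of "real k" "real n" h] by auto
    let ?z = "U (real k * h) z"
    have "eventually (\<lambda>\<epsilon>. \<forall>r\<in>{0..h}. norm (T \<epsilon> r (U (real k * h) x) - U r (U (real k * h) x))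
        \<le> e / (2 * real (Suc n)) + h\<^sup>2 * ((M + 1) * norm ?z + 1)) (at_right 0)"
      using kh e h by (intro one_step[OF limit.gen_invariant[OF xy] limit.gen_invariant[OF yz]]
          limit.iterated_domain_invariant[OF z] M) auto
    moreover have "h\<^sup>2 * ((M + 1) * norm ?z + 1) \<le> h\<^sup>2 * C"
      unfolding C_def using M[of "real k * h" z] kh M1 h
      by (intro mult_left_mono add_mono) auto
    ultimately show ?thesis
      by (auto simp: a_def elim!: eventually_mono intro: order_trans)
  qed
  \<comment> \<open>For a fixed mesh there are finitely many grid points, so a single range of
    \<open>\<epsilon>\<close> serves all of them.\<close>
  then have "eventually (\<lambda>\<epsilon>. \<forall>k\<in>{..n}. \<forall>r\<in>{0..h}.
      norm (T \<epsilon> r (U (real k * h) x) - U r (U (real k * h) x)) \<le> a) (at_right 0)"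
    by (intro eventually_ball_finite) auto
  then show ?thesis
    using eventually_at_right_less[of "0::real"]
  proof eventually_elim
    case (elim \<epsilon>)
    interpret T: degenerate_semigroup "T \<epsilon>" by (rule semigroup) (rule elim)
    \<comment> \<open>The old error passes through the contraction \<open>T \<epsilon> r\<close> and
      is not amplified; the new error is that of one step started on the limit orbit.\<close>
    have extend: "norm (T \<epsilon> (real k * h + r) x - U (real k * h + r) x)
        \<le> norm (T \<epsilon> (real k * h) x - U (real k * h) x) + a" if "k \<le> n" "r \<in> {0..h}" for k r
    proof -
      have "T \<epsilon> (real k * h + r) x - U (real k * h + r) x
          = T \<epsilon> r (T \<epsilon> (real k * h) x - U (real k * h) x)
            + (T \<epsilon> r (U (real k * h) x) - U r (U (real k * h) x))"
        using that h T.add[of r "real k * h" x] limit.add[of r "real k * h" x]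
        by (simp add: T.S_minus add.commute)
      moreover have "norm (T \<epsilon> r (T \<epsilon> (real k * h) x - U (real k * h) x))
          \<le> norm (T \<epsilon> (real k * h) x - U (real k * h) x)"
        using that elim contraction by auto
      moreover have "norm (T \<epsilon> r (U (real k * h) x) - U r (U (real k * h) x)) \<le> a"
        using elim that by auto
      ultimately show ?thesis
        by (simp only: norm_triangle_le[OF add_mono])
    qed
    have grid: "norm (T \<epsilon> (real k * h) x - U (real k * h) x) \<le> real k * a" if "k \<le> n" for k
      using that
    proof (induction k)
      case 0
      then show ?case using xy elim at_zero by (simp add: limit.gen_def)
    next
      case (Suc k)
      then show ?case using extend[of k h] h by (simp add: algebra_simps)
    qed
    show ?case
    proof
      fix t assume t: "t \<in> {0..\<tau>}"
      define k where "k = nat \<lfloor>t / h\<rfloor>"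
      have kt: "real k \<le> t / h" "t / h < real k + 1"
        using t h by (auto simp: k_def)
      then have r: "t - real k * h \<in> {0..h}"
        using h by (auto simp: field_simps)
      have "t / h \<le> real n" using t h by (simp add: field_simps)
      then have kn: "k \<le> n" using kt by linarith
      have "norm (T \<epsilon> t x - U t x) \<le> real k * a + a"
        using extend[OF kn r] grid[OF kn] by simp
      also have "\<dots> \<le> real (Suc n) * a"
        using kn a by (simp add: algebra_simps)
      finally show "norm (T \<epsilon> t x - U t x) \<le> e" using na by linarith
    qed
  qed
qed

theorem uniform_convergence:
  assumes x: "U 0 x = x"
  shows "uniform_limit {0..\<tau>} (\<lambda>\<epsilon> t. T \<epsilon> t x) (\<lambda>t. U t x) (at_right 0)"
proof (rule uniform_limitI)
  fix e :: real assume e: "e > 0"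
  \<comment> \<open>Taking the maximum with 1 provides the positive horizon required by
    \<open>uniform_convergence_core\<close>, also when \<open>\<tau>\<close> is not
    positive.\<close>
  define \<sigma> where "\<sigma> = max \<tau> 1"
  obtain M where M1: "M \<ge> 1" and M: "\<And>s u. s \<in> {0..\<sigma>} \<Longrightarrow> norm (U s u) \<le> M * norm u"
    using limit.locally_bounded by blast
  obtain x' where x': "x' \<in> limit.iterated_domain 3" "norm (x - x') < e / (2 * (M + 1))"
    using limit.iterated_domain_dense[OF x, of "e / (2 * (M + 1))" 3] e M1 by auto
  have small: "(M + 1) * norm (x - x') < e / 2" using x'(2) M1 by (simp add: field_simps)
  have "eventually (\<lambda>\<epsilon>. \<forall>t\<in>{0..\<sigma>}. norm (T \<epsilon> t x' - U t x') \<le> e / 2) (at_right 0)"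
    using e by (intro uniform_convergence_core x') (auto simp: \<sigma>_def)
  then show "\<forall>\<^sub>F \<epsilon> in at_right 0. \<forall>t\<in>{0..\<tau>}. dist (T \<epsilon> t x) (U t x) < e"
    using eventually_at_right_less[of "0::real"]
  proof eventually_elim
    case (elim \<epsilon>)
    interpret T: degenerate_semigroup "T \<epsilon>" by (rule semigroup) (rule elim)
    show ?case
    proof
      fix t assume "t \<in> {0..\<tau>}"
      then have t: "t \<in> {0..\<sigma>}" by (auto simp: \<sigma>_def)
      have "T \<epsilon> t x - U t x = T \<epsilon> t (x - x') + (T \<epsilon> t x' - U t x') - U t (x - x')"
        using t by (simp add: T.S_minus limit.S_minus)
      also have "norm \<dots> \<le> norm (T \<epsilon> t (x - x')) + norm (T \<epsilon> t x' - U t x') + norm (U t (x - x'))"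
        by (intro order_trans[OF norm_triangle_ineq4] add_mono norm_triangle_ineq order_refl)
      also have "\<dots> \<le> norm (x - x') + e / 2 + M * norm (x - x')"
        using elim t contraction by (intro add_mono M) auto
      finally show "dist (T \<epsilon> t x) (U t x) < e"
        using small by (simp add: dist_norm algebra_simps)
    qed
  qed
qed

end

section \<open>The fundamental theorem of calculus for absolutely continuous functions\<close>

lemma open_cover_negligible:
  fixes N :: "real set"
  assumes "negligible N" "\<delta> > 0"
  obtains V where "open V" "N \<subseteq> V" "V \<in> lmeasurable" "measure lebesgue V < \<delta>"
proof -
  have N: "N \<in> null_sets lebesgue" using assms negligible_iff_null_sets by blast
  then obtain V where V: "open V" "N \<subseteq> V" "V - N \<in> lmeasurable" "emeasure lebesgue (V - N) < ennreal \<delta>"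
    using sets_lebesgue_outer_open[of N \<delta>] assms by (auto dest: null_setsD2)
  have "emeasure lebesgue (V - N) = emeasure lebesgue V"
    by (rule emeasure_Diff_null_set[OF N]) (use V(1) in \<open>auto intro: borel_open\<close>)
  with V have "emeasure lebesgue V < ennreal \<delta>" by simp
  then have fin: "emeasure lebesgue V < \<infinity>"
    using less_top order.strict_trans by fastforce
  then have "V \<in> lmeasurable"
    using V(1) by (auto intro!: fmeasurableI borel_open)
  moreover have "ennreal (measure lebesgue V) < ennreal \<delta>"
    using \<open>emeasure lebesgue V < ennreal \<delta>\<close> fin by (simp add: emeasure_eq_ennreal_measure less_top)
  then have "measure lebesgue V < \<delta>" by (simp add: ennreal_less_iff)
  ultimately show ?thesis using V that by blast
qed

lemma sum_interval_lengths_le: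
  fixes D :: "(real \<times> real) set"
  assumes "finite D" "\<And>u v. (u, v) \<in> D \<Longrightarrow> u \<le> v"
    and disj: "pairwise (\<lambda>(a, b) (c, d). {a<..<b} \<inter> {c<..<d} = {}) D"
    and sub: "\<And>u v. (u, v) \<in> D \<Longrightarrow> {u<..<v} \<subseteq> V" and V: "V \<in> lmeasurable"
  shows "(\<Sum>(u, v)\<in>D. v - u) \<le> measure lebesgue V"
proof -
  have "(\<Sum>(u, v)\<in>D. v - u) = (\<Sum>d\<in>D. measure lebesgue {fst d<..<snd d})"
    using assms(2) by (intro sum.cong) auto
  also have "\<dots> = measure lebesgue (\<Union>d\<in>D. {fst d<..<snd d})"
  proof (rule measure_finite_Union[symmetric])
    show "disjoint_family_on (\<lambda>d. {fst d<..<snd d}) D"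
      using disj by (force simp: disjoint_family_on_def pairwise_def case_prod_beta)
  qed (use assms(1,2) in auto)
  also have "\<dots> \<le> measure lebesgue V"
  proof (rule measure_mono_fmeasurable[OF _ _ V])
    show "(\<Union>d\<in>D. {fst d<..<snd d}) \<subseteq> V" using sub by (intro UN_least) auto
  qed (use assms(1) in auto)
  finally show ?thesis .
qed

text \<open>The tags in the exceptional null set contribute only the increments of \<open>F\<close> over disjoint
  intervals of small total length, which absolute continuity controls.\<close>

theorem fundamental_theorem_of_calculus_abs_continuous:
  fixes F F' :: "real \<Rightarrow> real"
  assumes ac: "abs_continuous_on s F" and sub: "{a..b} \<subseteq> s" and ab: "a \<le> b"
    and N: "negligible N"
    and deriv: "\<And>x. x \<in> {a..b} - N \<Longrightarrow> (F has_real_derivative F' x) (at x)"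
  shows "(F' has_integral F b - F a) {a..b}"
proof (cases "a = b")
  case False
  then have ab: "a < b" using ab by simp
  \<comment> \<open>With the value 0 on \<open>N\<close>, a tag in \<open>N\<close> adds nothing to
    the Riemann sum, and only the increment of \<open>F\<close> over its interval remains to be
    estimated.\<close>
  define f where "f x = (if x \<in> N then 0 else F' x)" for x
  have "(f has_integral F b - F a) {a..b}"
    unfolding has_integral_real
  proof (intro allI impI)
    fix e :: real assume e: "e > 0"
    obtain \<delta> where \<delta>: "\<delta> > 0" and ac': "\<And>D. finite D \<Longrightarrow> (\<forall>(a, b)\<in>D. a \<le> b \<and> {a..b} \<subseteq> s) \<Longrightarrow>
        pairwise (\<lambda>(a, b) (c, d). {a<..<b} \<inter> {c<..<d} = {}) D \<Longrightarrow>
        (\<Sum>(a, b)\<in>D. b - a) < \<delta> \<Longrightarrow> (\<Sum>(a, b)\<in>D. \<bar>F b - F a\<bar>) < e / 2"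
      using ac[unfolded abs_continuous_on_def, THEN spec, THEN mp, OF half_gt_zero[OF e]] by auto
    obtain V where V: "open V" "N \<subseteq> V" "V \<in> lmeasurable" "measure lebesgue V < \<delta>"
      using open_cover_negligible[OF N \<delta>] by blast
    define e' where "e' = e / 2 / (b - a)"
    have e': "e' > 0" using e ab by (simp add: e'_def)
    have "\<exists>d>0. \<forall>y. \<bar>y - x\<bar> < d \<longrightarrow> \<bar>F y - F x - F' x * (y - x)\<bar> \<le> e' * \<bar>y - x\<bar>"
      if "x \<in> {a..b} - N" for x
    proof -
      have "(F has_derivative (*) (F' x)) (at x)"
        using deriv[OF that] by (simp only: has_field_derivative_def)
      then show ?thesis
        unfolding has_derivative_at_alt real_norm_def using e' by blast
    qed
    then have "\<exists>d. \<forall>x\<in>{a..b} - N. d x > 0 \<and>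
        (\<forall>y. \<bar>y - x\<bar> < d x \<longrightarrow> \<bar>F y - F x - F' x * (y - x)\<bar> \<le> e' * \<bar>y - x\<bar>)"
      by (intro bchoice ballI)
    then obtain d where "\<forall>x\<in>{a..b} - N. d x > 0 \<and>
        (\<forall>y. \<bar>y - x\<bar> < d x \<longrightarrow> \<bar>F y - F x - F' x * (y - x)\<bar> \<le> e' * \<bar>y - x\<bar>)" ..
    then have d: "\<And>x. x \<in> {a..b} - N \<Longrightarrow> d x > 0"
      "\<And>x y. x \<in> {a..b} - N \<Longrightarrow> \<bar>y - x\<bar> < d x \<Longrightarrow> \<bar>F y - F x - F' x * (y - x)\<bar> \<le> e' * \<bar>y - x\<bar>"
      by blast+
    \<comment> \<open>At a tag in \<open>N\<close> the gauge keeps the interval inside the small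
      open set \<open>V\<close>; at the other tags in \<open>[a, b]\<close> it keeps the interval
      where \<open>F\<close> is almost affine.\<close>
    define \<gamma> where "\<gamma> x = (if x \<in> N then V else if x \<in> {a..b} then ball x (d x) else UNIV)" for x
    show "\<exists>\<gamma>. gauge \<gamma> \<and> (\<forall>\<D>. \<D> tagged_division_of {a..b} \<and> \<gamma> fine \<D> \<longrightarrow>
        norm ((\<Sum>(x, k)\<in>\<D>. measure lborel k *\<^sub>R f x) - (F b - F a)) < e)"
    proof (intro exI[of _ \<gamma>] conjI allI impI)
      show "gauge \<gamma>"
        using V d(1) by (auto simp: gauge_def \<gamma>_def)
      fix p assume "p tagged_division_of {a..b} \<and> \<gamma> fine p"
      then have p: "p tagged_division_of {a..b}" and fine: "\<gamma> fine p" by auto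
      note pD = tagged_division_ofD[OF p]
      have interval: "\<exists>u v. k = {u..v} \<and> u \<le> v \<and> Inf k = u \<and> Sup k = v \<and> x \<in> {u..v} \<and> {u..v} \<subseteq> {a..b} \<and> {u..v} \<subseteq> \<gamma> x"
        if xk: "(x, k) \<in> p" for x k
      proof -
        obtain u v where k: "k = cbox u v" using pD(4)[OF xk] by blast
        moreover have "x \<in> k" "k \<subseteq> {a..b}" "k \<subseteq> \<gamma> x"
          using pD(2,3)[OF xk] fineD[OF fine xk] by auto
        ultimately show ?thesis by (intro exI[of _ u] exI[of _ v]) auto
      qed
      let ?t = "\<lambda>(x, k). measure lborel k *\<^sub>R f x - (F (Sup k) - F (Inf k))"
      define pN where "pN = {q \<in> p. fst q \<in> N}"
      have fin: "finite p" "finite pN" using pD(1) by (auto simp: pN_def)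
      \<comment> \<open>The tag lies between the end points \<open>u\<close> and \<open>v\<close>,
        so the two linearization errors add up to at most \<open>e' * (v - u)\<close>, and these
        lengths sum to at most \<open>b - a\<close>.\<close>
      have regular: "norm (?t q) \<le> e' * (case q of (x, k) \<Rightarrow> Sup k - Inf k)" if q: "q \<in> p - pN" for q
      proof -
        obtain x k where qe: "q = (x, k)" by force
        have xk: "(x, k) \<in> p" "x \<notin> N" using q by (auto simp: qe pN_def)
        obtain u v where uv: "k = {u..v}" "u \<le> v" "Inf k = u" "Sup k = v" "x \<in> {u..v}" "{u..v} \<subseteq> {a..b}"
          "{u..v} \<subseteq> \<gamma> x" using interval[OF xk(1)] by blast
        have x: "x \<in> {a..b} - N" using uv xk by auto
        have "u \<in> ball x (d x)" "v \<in> ball x (d x)" using uv x by (auto simp: \<gamma>_def subset_iff)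
        then have "\<bar>F u - F x - F' x * (u - x)\<bar> \<le> e' * \<bar>u - x\<bar>" "\<bar>F v - F x - F' x * (v - x)\<bar> \<le> e' * \<bar>v - x\<bar>"
          using d(2)[OF x] by (auto simp: dist_real_def abs_minus_commute)
        then have "\<bar>(v - u) * F' x - (F v - F u)\<bar> \<le> e' * (v - u)"
          using uv by (auto simp: algebra_simps abs_if split: if_splits)
        then show ?thesis using uv x by (simp add: qe f_def)
      qed
      have "norm (\<Sum>q\<in>p - pN. ?t q) \<le> (\<Sum>q\<in>p - pN. e' * (case q of (x, k) \<Rightarrow> Sup k - Inf k))"
        by (rule sum_norm_le) (use regular in auto)
      also have "\<dots> \<le> (\<Sum>q\<in>p. e' * (case q of (x, k) \<Rightarrow> Sup k - Inf k))"
        using fin e' interval by (intro sum_mono2) (force intro: mult_nonneg_nonneg)+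
      also have "\<dots> = e' * (b - a)"
        unfolding sum_distrib_left[symmetric]
        using additive_tagged_division_1[OF less_imp_le[OF ab] p, of "\<lambda>x. x"] by simp
      also have "\<dots> = e / 2" using e'_def ab unfolding eq_divide_eq by simp
      finally have 1: "norm (\<Sum>q\<in>p - pN. ?t q) \<le> e / 2" .
      define D where "D = (\<lambda>(x, k). (Inf k, Sup k)) ` pN"
      have Dp: "\<exists>x k. (x, k) \<in> p \<and> x \<in> N \<and> k = {u..v} \<and> u \<le> v \<and> {u..v} \<subseteq> {a..b} \<and> {u..v} \<subseteq> V"
        if "(u, v) \<in> D" for u v
      proof -
        obtain x k where xk: "(x, k) \<in> p" "x \<in> N" "u = Inf k" "v = Sup k"
          using \<open>(u, v) \<in> D\<close> by (auto simp: D_def pN_def)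
        obtain u' v' where "k = {u'..v'}" "u' \<le> v'" "Inf k = u'" "Sup k = v'" "{u'..v'} \<subseteq> {a..b}"
          "{u'..v'} \<subseteq> \<gamma> x" using interval[OF xk(1)] by blast
        with xk have "(x, k) \<in> p" "x \<in> N" "k = {u..v}" "u \<le> v" "{u..v} \<subseteq> {a..b}" "{u..v} \<subseteq> V"
          unfolding \<gamma>_def by simp_all
        then show ?thesis by blast
      qed
      have disj: "{u<..<v} \<inter> {u'<..<v'} = {}" if uv: "(u, v) \<in> D" "(u', v') \<in> D" "(u, v) \<noteq> (u', v')" for u v u' v'
      proof -
        obtain x k where 1: "(x, k) \<in> p" "k = {u..v}" "u \<le> v" using Dp[OF uv(1)] by blast
        obtain y l where 2: "(y, l) \<in> p" "l = {u'..v'}" "u' \<le> v'" using Dp[OF uv(2)] by blast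
        have "k \<noteq> l" using 1 2 uv(3) by (auto simp: Icc_eq_Icc)
        then have "interior k \<inter> interior l = {}" using pD(5)[OF 1(1) 2(1)] by blast
        then show ?thesis using 1 2 by (simp add: interior_atLeastAtMost_real)
      qed
      have pw: "pairwise (\<lambda>(a, b) (c, d). {a<..<b} \<inter> {c<..<d} = {}) D"
        using disj unfolding pairwise_def by fastforce
      have finD: "finite D" using fin by (simp add: D_def)
      have Dsub: "\<forall>(u, v)\<in>D. u \<le> v \<and> {u..v} \<subseteq> s" using Dp sub by blast
      have "(\<Sum>(u, v)\<in>D. v - u) \<le> measure lebesgue V"
      proof (rule sum_interval_lengths_le[OF finD _ pw _ V(3)])
        show "u \<le> v" if "(u, v) \<in> D" for u v using Dp[OF that] by blast
        show "{u<..<v} \<subseteq> V" if "(u, v) \<in> D" for u v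
          using Dp[OF that] greaterThanLessThan_subseteq_atLeastAtMost_iff by fastforce
      qed
      then have "(\<Sum>(u, v)\<in>D. \<bar>F v - F u\<bar>) < e / 2"
        using V(4) by (intro ac' finD Dsub pw) auto
      also have "(\<Sum>(u, v)\<in>D. \<bar>F v - F u\<bar>) = (\<Sum>q\<in>pN. (\<lambda>(u, v). \<bar>F v - F u\<bar>) ((\<lambda>(x, k). (Inf k, Sup k)) q))"
        unfolding D_def
      proof (rule sum.reindex_nontrivial[OF fin(2), unfolded o_def])
        \<comment> \<open>Two different elements of the division with the same end points have
          disjoint interiors, so their common interval is a single point and its increment is
          0.\<close>
        fix q r assume qr: "q \<in> pN" "r \<in> pN" "q \<noteq> r"
          and eq: "(\<lambda>(x, k). (Inf k, Sup k)) q = (\<lambda>(x, k). (Inf k, Sup k)) r"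
        obtain x k y l where q: "q = (x, k)" "r = (y, l)" by (metis surj_pair)
        have xk: "(x, k) \<in> p" "(y, l) \<in> p" using qr by (auto simp: q pN_def)
        obtain u v where u: "k = {u..v}" "u \<le> v" "Inf k = u" "Sup k = v" using interval[OF xk(1)] by blast
        obtain u' v' where v: "l = {u'..v'}" "u' \<le> v'" "Inf l = u'" "Sup l = v'" using interval[OF xk(2)] by blast
        have "k = l" using u v eq by (auto simp: q)
        moreover have "interior k \<inter> interior l = {}" using pD(5)[OF xk] qr by (simp add: q)
        ultimately have "u = v" using u by (auto simp: interior_atLeastAtMost_real)
        then show "(case (case q of (x, k) \<Rightarrow> (Inf k, Sup k)) of (u, v) \<Rightarrow> \<bar>F v - F u\<bar>) = 0"
          using u by (simp add: q)
      qed
      also have "\<dots> = (\<Sum>q\<in>pN. norm (?t q))"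
        by (intro sum.cong) (auto simp: pN_def f_def)
      finally have 2: "norm (\<Sum>q\<in>pN. ?t q) < e / 2"
        using norm_sum[of ?t pN] by linarith
      have "(\<Sum>(x, k)\<in>p. measure lborel k *\<^sub>R f x) - (F b - F a) = (\<Sum>q\<in>p. ?t q)"
        using additive_tagged_division_1[OF less_imp_le[OF ab] p, of F]
        by (simp add: sum_subtractf case_prod_beta)
      also have "\<dots> = (\<Sum>q\<in>p - pN. ?t q) + (\<Sum>q\<in>pN. ?t q)"
        using fin by (intro sum.subset_diff) (auto simp: pN_def)
      finally show "norm ((\<Sum>(x, k)\<in>p. measure lborel k *\<^sub>R f x) - (F b - F a)) < e"
        using 1 2 norm_triangle_ineq[of "\<Sum>q\<in>p - pN. ?t q" "\<Sum>q\<in>pN. ?t q"] by simp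
    qed
  qed
  then show ?thesis
    by (rule has_integral_spike[OF N, rotated]) (simp add: f_def)
qed auto

section \<open>Dissipativity of the transport operator\<close>

lemma abs_continuous_onE:
  assumes "abs_continuous_on s f" "e > 0"
  obtains \<delta> where "\<delta> > 0" "\<And>D. finite D \<Longrightarrow> (\<forall>(a, b)\<in>D. a \<le> b \<and> {a..b} \<subseteq> s) \<Longrightarrow>
        pairwise (\<lambda>(a, b) (c, d). {a<..<b} \<inter> {c<..<d} = {}) D \<Longrightarrow>
        (\<Sum>(a, b)\<in>D. b - a) < \<delta> \<Longrightarrow> (\<Sum>(a, b)\<in>D. \<bar>f b - f a\<bar>) < e"
  using assms(1)[unfolded abs_continuous_on_def, THEN spec, THEN mp, OF assms(2)] by auto

lemma abs_continuous_on_Lipschitz_compose: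
  assumes ac: "abs_continuous_on s f" and lip: "\<And>x y. \<bar>j x - j y\<bar> \<le> L * \<bar>x - y\<bar>"
  shows "abs_continuous_on s (\<lambda>x. j (f x))"
  unfolding abs_continuous_on_def
proof (intro allI impI)
  fix e :: real assume e: "e > 0"
  \<comment> \<open>The added 1 keeps the denominator positive when \<open>L = 0\<close>.\<close>
  have "e / (\<bar>L\<bar> + 1) > 0" using e by (simp add: add_nonneg_pos)
  from abs_continuous_onE[OF ac this] obtain \<delta> where \<delta>: "\<delta> > 0" "\<And>D. finite D \<Longrightarrow> (\<forall>(a, b)\<in>D. a \<le> b \<and> {a..b} \<subseteq> s) \<Longrightarrow>
        pairwise (\<lambda>(a, b) (c, d). {a<..<b} \<inter> {c<..<d} = {}) D \<Longrightarrow>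
        (\<Sum>(a, b)\<in>D. b - a) < \<delta> \<Longrightarrow> (\<Sum>(a, b)\<in>D. \<bar>f b - f a\<bar>) < e / (\<bar>L\<bar> + 1)"
    by blast
  show "\<exists>\<delta>>0. \<forall>D. finite D \<longrightarrow> (\<forall>(a, b)\<in>D. a \<le> b \<and> {a..b} \<subseteq> s) \<longrightarrow>
        pairwise (\<lambda>(a, b) (c, d). {a<..<b} \<inter> {c<..<d} = {}) D \<longrightarrow>
        (\<Sum>(a, b)\<in>D. b - a) < \<delta> \<longrightarrow> (\<Sum>(a, b)\<in>D. \<bar>j (f b) - j (f a)\<bar>) < e"
  proof (intro exI[of _ \<delta>] conjI allI impI \<delta>(1))
    fix D :: "(real \<times> real) set"
    assume "finite D" "\<forall>(a, b)\<in>D. a \<le> b \<and> {a..b} \<subseteq> s"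
      "pairwise (\<lambda>(a, b) (c, d). {a<..<b} \<inter> {c<..<d} = {}) D" "(\<Sum>(a, b)\<in>D. b - a) < \<delta>"
    then have 1: "(\<Sum>(a, b)\<in>D. \<bar>f b - f a\<bar>) < e / (\<bar>L\<bar> + 1)" by (rule \<delta>(2))
    have "\<bar>j x - j y\<bar> \<le> (\<bar>L\<bar> + 1) * \<bar>x - y\<bar>" for x y
      by (rule order_trans[OF lip mult_right_mono]) auto
    then have "(\<Sum>(a, b)\<in>D. \<bar>j (f b) - j (f a)\<bar>) \<le> (\<bar>L\<bar> + 1) * (\<Sum>(a, b)\<in>D. \<bar>f b - f a\<bar>)"
      unfolding sum_distrib_left by (intro sum_mono) auto
    also have "\<dots> < e" using 1 by (simp add: field_simps add_nonneg_pos)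
    finally show "(\<Sum>(a, b)\<in>D. \<bar>j (f b) - j (f a)\<bar>) < e" .
  qed
qed

section \<open>A smooth approximation of the absolute value\<close>

definition smooth_abs :: "real \<Rightarrow> real \<Rightarrow> real" where
  "smooth_abs \<eta> x = sqrt (x\<^sup>2 + \<eta>\<^sup>2)"

lemma smooth_abs_bounds:
  assumes "\<eta> > 0"
  shows "\<bar>x\<bar> \<le> smooth_abs \<eta> x" "smooth_abs \<eta> x \<le> \<bar>x\<bar> + \<eta>"
  using assms sqrt_add_le_add_sqrt[of "x\<^sup>2" "\<eta>\<^sup>2"]
  by (auto simp: smooth_abs_def intro: real_le_rsqrt)

lemma smooth_abs_deriv:
  assumes "\<eta> > 0"
  shows "(smooth_abs \<eta> has_real_derivative x / smooth_abs \<eta> x) (at x)"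
proof -
  have "x\<^sup>2 + \<eta>\<^sup>2 > 0" using assms by (simp add: add_nonneg_pos)
  then show ?thesis
    unfolding smooth_abs_def
    by (auto intro!: derivative_eq_intros simp: field_simps)
qed

text \<open>The slope replaces the sign function: it has modulus at most 1, and its product with
  \<open>x\<close> recovers the absolute value up to \<open>\<eta>\<close>, because (|x| -
  \<eta>)(|x| + \<eta>) is at most the square of x.\<close>

lemma smooth_abs_slope:
  assumes "\<eta> > 0"
  shows "\<bar>x / smooth_abs \<eta> x\<bar> \<le> 1" "\<bar>x\<bar> - \<eta> \<le> x * (x / smooth_abs \<eta> x)"
proof -
  have pos: "smooth_abs \<eta> x > 0" using assms by (simp add: smooth_abs_def add_nonneg_pos)
  show "\<bar>x / smooth_abs \<eta> x\<bar> \<le> 1" using pos smooth_abs_bounds(1)[OF assms, of x] by simp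
  have "(\<bar>x\<bar> - \<eta>) * smooth_abs \<eta> x \<le> x\<^sup>2"
  proof (cases "\<bar>x\<bar> \<le> \<eta>")
    case True
    then have "(\<bar>x\<bar> - \<eta>) * smooth_abs \<eta> x \<le> 0" using pos by (intro mult_nonpos_nonneg) auto
    then show ?thesis using zero_le_power2[of x] by linarith
  next
    case False
    then have "(\<bar>x\<bar> - \<eta>) * smooth_abs \<eta> x \<le> (\<bar>x\<bar> - \<eta>) * (\<bar>x\<bar> + \<eta>)"
      using smooth_abs_bounds(2)[OF assms] by (intro mult_left_mono) auto
    also have "\<dots> = x\<^sup>2 - \<eta>\<^sup>2" by (simp add: algebra_simps power2_eq_square)
    finally show ?thesis using zero_le_power2[of \<eta>] by linarith
  qed
  then show "\<bar>x\<bar> - \<eta> \<le> x * (x / smooth_abs \<eta> x)"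
    using pos by (simp add: field_simps power2_eq_square)
qed

lemma smooth_abs_Lipschitz:
  assumes "\<eta> > 0"
  shows "\<bar>smooth_abs \<eta> x - smooth_abs \<eta> y\<bar> \<le> \<bar>x - y\<bar>"
proof -
  have "norm (smooth_abs \<eta> x - smooth_abs \<eta> y) \<le> 1 * norm (x - y)"
    using smooth_abs_deriv[OF assms] smooth_abs_slope(1)[OF assms]
    by (intro field_differentiable_bound[where S=UNIV and f'="\<lambda>x. x / smooth_abs \<eta> x"])
      (auto intro: has_field_derivative_at_within)
  then show ?thesis by simp
qed

text \<open>This is the inequality for \<open>\<bar>f\<bar>' = sgn f f'\<close>, with \<open>\<bar>f\<bar>\<close> smoothed to \<open>sqrt (f\<^sup>2 + \<eta>\<^sup>2)\<close>
  because \<open>\<bar>\<cdot>\<bar>\<close> is not differentiable.\<close>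

lemma abs_flux_le_interval:
  assumes ac: "abs_continuous_on s f" and sub: "{a..b} \<subseteq> s" and ab: "a \<le> b"
    and deriv: "AE x in lborel. (f has_real_derivative f' x) (at x)"
    and f: "integrable lborel f" and f': "integrable lborel f'"
    and \<sigma>: "\<bar>\<sigma>\<bar> = 1" and \<mu>: "\<mu> > 0"
  shows "\<sigma> * (\<bar>f b\<bar> - \<bar>f a\<bar>) + \<mu> * (LINT x:{a..b}|lborel. \<bar>f x\<bar>) \<le> (LINT x:{a..b}|lborel. \<bar>\<mu> * f x + \<sigma> * f' x\<bar>)"
proof -
  obtain N where N: "N \<in> null_sets lborel" "{x. \<not> (f has_real_derivative f' x) (at x)} \<subseteq> N"
    using deriv by (auto simp: eventually_ae_filter)
  have negN: "negligible N"
    using N(1) null_sets_completionI negligible_iff_null_sets by blast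
  have si: "set_integrable lborel {a..b} (\<lambda>x. \<bar>f x\<bar>)"
    "set_integrable lborel {a..b} (\<lambda>x. \<bar>\<mu> * f x + \<sigma> * f' x\<bar>)"
    unfolding set_integrable_def by (rule integrable_mult_indicator; use f f' in simp)+
  have I1: "((\<lambda>x. \<bar>f x\<bar>) has_integral (LINT x:{a..b}|lborel. \<bar>f x\<bar>)) {a..b}"
    using set_borel_integral_eq_integral[OF si(1)] by (simp add: has_integral_iff)
  have I2: "((\<lambda>x. \<bar>\<mu> * f x + \<sigma> * f' x\<bar>) has_integral (LINT x:{a..b}|lborel. \<bar>\<mu> * f x + \<sigma> * f' x\<bar>)) {a..b}"
    using set_borel_integral_eq_integral[OF si(2)] by (simp add: has_integral_iff)
  \<comment> \<open>The extra \<open>\<mu> * \<eta> * (b - a)\<close> is the loss in the lower bound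
    \<open>\<bar>f x\<bar> - \<eta> \<le> f x * j' x\<close>, integrated over the interval.\<close>
  have approx: "\<sigma> * (smooth_abs \<eta> (f b) - smooth_abs \<eta> (f a)) + \<mu> * (LINT x:{a..b}|lborel. \<bar>f x\<bar>)
      \<le> (LINT x:{a..b}|lborel. \<bar>\<mu> * f x + \<sigma> * f' x\<bar>) + \<mu> * \<eta> * (b - a)" if \<eta>: "\<eta> > 0" for \<eta>
  proof -
    define j' where "j' x = f x / smooth_abs \<eta> (f x)" for x
    have "((\<lambda>x. if x \<in> N then 0 else j' x * f' x) has_integral smooth_abs \<eta> (f b) - smooth_abs \<eta> (f a)) {a..b}"
    proof (rule fundamental_theorem_of_calculus_abs_continuous[OF _ sub ab negN])
      show "abs_continuous_on s (\<lambda>x. smooth_abs \<eta> (f x))"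
        using \<eta> by (intro abs_continuous_on_Lipschitz_compose[OF ac, where L=1]) (simp add: smooth_abs_Lipschitz)
      show "((\<lambda>x. smooth_abs \<eta> (f x)) has_real_derivative (if x \<in> N then 0 else j' x * f' x)) (at x)"
        if "x \<in> {a..b} - N" for x
        using that N(2) DERIV_chain2[OF smooth_abs_deriv[OF \<eta>], of f "f' x" x]
        by (auto simp: j'_def)
    qed
    then have L: "((\<lambda>x. \<sigma> * (if x \<in> N then 0 else j' x * f' x)) has_integral \<sigma> * (smooth_abs \<eta> (f b) - smooth_abs \<eta> (f a))) {a..b}"
      by (rule has_integral_mult_right)
    have R: "((\<lambda>x. \<bar>\<mu> * f x + \<sigma> * f' x\<bar> + \<mu> * \<eta> - \<mu> * \<bar>f x\<bar>) has_integral
        (LINT x:{a..b}|lborel. \<bar>\<mu> * f x + \<sigma> * f' x\<bar>) + \<mu> * \<eta> * (b - a) - \<mu> * (LINT x:{a..b}|lborel. \<bar>f x\<bar>)) {a..b}"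
      using has_integral_const_real[of "\<mu> * \<eta>" a b] ab
      by (intro has_integral_diff has_integral_add I2 has_integral_mult_right I1) (simp add: mult.commute)
    then have R: "((\<lambda>x. if x \<in> N then 0 else \<bar>\<mu> * f x + \<sigma> * f' x\<bar> + \<mu> * \<eta> - \<mu> * \<bar>f x\<bar>) has_integral
        (LINT x:{a..b}|lborel. \<bar>\<mu> * f x + \<sigma> * f' x\<bar>) + \<mu> * \<eta> * (b - a) - \<mu> * (LINT x:{a..b}|lborel. \<bar>f x\<bar>)) {a..b}"
      by (rule has_integral_spike[OF negN, rotated]) simp
    have "\<sigma> * (smooth_abs \<eta> (f b) - smooth_abs \<eta> (f a)) \<le>
        (LINT x:{a..b}|lborel. \<bar>\<mu> * f x + \<sigma> * f' x\<bar>) + \<mu> * \<eta> * (b - a) - \<mu> * (LINT x:{a..b}|lborel. \<bar>f x\<bar>)"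
    proof (rule has_integral_le[OF L R])
      fix x assume "x \<in> {a..b}"
      \<comment> \<open>Testing against \<open>j'\<close> produces the derivative of the smoothed
        modulus from \<open>f'\<close>, and approximately the modulus from \<open>f\<close>.\<close>
      have "j' x * (\<mu> * f x + \<sigma> * f' x) \<le> \<bar>\<mu> * f x + \<sigma> * f' x\<bar>"
      proof -
        have "\<bar>j' x * (\<mu> * f x + \<sigma> * f' x)\<bar> \<le> 1 * \<bar>\<mu> * f x + \<sigma> * f' x\<bar>"
          unfolding abs_mult j'_def by (intro mult_right_mono smooth_abs_slope \<eta>) auto
        then show ?thesis by simp
      qed
      moreover have "\<mu> * (\<bar>f x\<bar> - \<eta>) \<le> \<mu> * (f x * j' x)"
        unfolding j'_def using \<mu> by (intro mult_left_mono smooth_abs_slope \<eta>) auto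
      ultimately show "\<sigma> * (if x \<in> N then 0 else j' x * f' x)
          \<le> (if x \<in> N then 0 else \<bar>\<mu> * f x + \<sigma> * f' x\<bar> + \<mu> * \<eta> - \<mu> * \<bar>f x\<bar>)"
        by (simp add: algebra_simps)
    qed
    then show ?thesis by simp
  qed
  show ?thesis
  proof (rule field_le_epsilon)
    fix e :: real assume e: "e > 0"
    \<comment> \<open>One \<open>\<eta>\<close> pays for smoothing at the end points and
      \<open>\<mu> * \<eta> * (b - a)\<close> for the error of \<open>approx\<close>; together they
      make \<open>e\<close>.\<close>
    define \<eta> where "\<eta> = e / (1 + \<mu> * (b - a))"
    have den: "1 + \<mu> * (b - a) > 0" using \<mu> ab by (simp add: add_pos_nonneg)
    then have \<eta>: "\<eta> > 0" using e by (simp add: \<eta>_def)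
    have "\<sigma> * (\<bar>f b\<bar> - \<bar>f a\<bar>) \<le> \<sigma> * (smooth_abs \<eta> (f b) - smooth_abs \<eta> (f a)) + \<eta>"
      using smooth_abs_bounds[OF \<eta>, of "f a"] smooth_abs_bounds[OF \<eta>, of "f b"] \<sigma>
      by (auto simp: abs_if split: if_splits)
    moreover have "\<eta> + \<mu> * \<eta> * (b - a) = e"
      using \<eta>_def den unfolding eq_divide_eq by (simp add: algebra_simps)
    ultimately show "\<sigma> * (\<bar>f b\<bar> - \<bar>f a\<bar>) + \<mu> * (LINT x:{a..b}|lborel. \<bar>f x\<bar>)
        \<le> (LINT x:{a..b}|lborel. \<bar>\<mu> * f x + \<sigma> * f' x\<bar>) + e"
      using approx[OF \<eta>] by linarith
  qed
qed

lemma set_integral_exhaustion: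
  fixes f :: "real \<Rightarrow> real"
  assumes f: "integrable lborel f" and s: "s \<in> sets borel"
    and lim: "\<And>x. eventually (\<lambda>n. x \<in> {a n..b n} \<longleftrightarrow> x \<in> s) sequentially"
  shows "(\<lambda>n. LINT x:{a n..b n}|lborel. f x) \<longlonglongrightarrow> (LINT x:s|lborel. f x)"
  unfolding set_lebesgue_integral_def
proof (rule integral_dominated_convergence[where w="\<lambda>x. \<bar>f x\<bar>"])
  show "AE x in lborel. (\<lambda>n. indicator {a n..b n} x *\<^sub>R f x) \<longlonglongrightarrow> indicator s x *\<^sub>R f x"
  proof (rule AE_I2)
    fix x
    have "eventually (\<lambda>n. indicator {a n..b n} x *\<^sub>R f x = indicator s x *\<^sub>R f x) sequentially"
      using lim[of x] by eventually_elim (auto simp: indicator_def)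
    then show "(\<lambda>n. indicator {a n..b n} x *\<^sub>R f x) \<longlonglongrightarrow> indicator s x *\<^sub>R f x"
      by (rule tendsto_eventually)
  qed
qed (use f s in \<open>auto simp: abs_mult indicator_def\<close>)

lemma abs_flux_le:
  assumes ac: "abs_continuous_on s f" and s: "s \<in> sets borel"
    and lim: "\<And>x. eventually (\<lambda>n. x \<in> {a n..b n} \<longleftrightarrow> x \<in> s) sequentially"
    and sub: "\<And>n. {a n..b n} \<subseteq> s" "\<And>n. a n \<le> b n"
    and deriv: "AE x in lborel. (f has_real_derivative f' x) (at x)"
    and f: "integrable lborel f" and f': "integrable lborel f'"
    and \<sigma>: "\<bar>\<sigma>\<bar> = 1" and \<mu>: "\<mu> > 0"
    and ends: "(\<lambda>n. f (a n)) \<longlonglongrightarrow> \<alpha>" "(\<lambda>n. f (b n)) \<longlonglongrightarrow> \<beta>"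
  shows "\<sigma> * (\<bar>\<beta>\<bar> - \<bar>\<alpha>\<bar>) + \<mu> * (LINT x:s|lborel. \<bar>f x\<bar>) \<le> (LINT x:s|lborel. \<bar>\<mu> * f x + \<sigma> * f' x\<bar>)"
proof (rule LIMSEQ_le)
  show "(\<lambda>n. \<sigma> * (\<bar>f (b n)\<bar> - \<bar>f (a n)\<bar>) + \<mu> * (LINT x:{a n..b n}|lborel. \<bar>f x\<bar>))
      \<longlonglongrightarrow> \<sigma> * (\<bar>\<beta>\<bar> - \<bar>\<alpha>\<bar>) + \<mu> * (LINT x:s|lborel. \<bar>f x\<bar>)"
    using f by (intro tendsto_intros ends set_integral_exhaustion s lim) auto
  show "(\<lambda>n. LINT x:{a n..b n}|lborel. \<bar>\<mu> * f x + \<sigma> * f' x\<bar>) \<longlonglongrightarrow> (LINT x:s|lborel. \<bar>\<mu> * f x + \<sigma> * f' x\<bar>)"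
    using f f' by (intro set_integral_exhaustion s lim) auto
  show "\<exists>N. \<forall>n\<ge>N. \<sigma> * (\<bar>f (b n)\<bar> - \<bar>f (a n)\<bar>) + \<mu> * (LINT x:{a n..b n}|lborel. \<bar>f x\<bar>)
      \<le> (LINT x:{a n..b n}|lborel. \<bar>\<mu> * f x + \<sigma> * f' x\<bar>)"
    using abs_flux_le_interval[OF ac sub deriv f f' \<sigma> \<mu>] by blast
qed

text \<open>Otherwise the constant \<open>e\<close> would be integrable on a half-line. Small values
  at arbitrarily distant points are all that is needed to make the flux at infinity
  disappear.\<close>

lemma integrable_small_value:
  fixes f :: "real \<Rightarrow> real"
  assumes f: "integrable lborel f" and e: "e > 0"
  shows "\<exists>x\<ge>B. \<bar>f x\<bar> < e"
proof (rule ccontr)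
  assume neg: "\<not> ?thesis"
  have "integrable lborel (\<lambda>x. indicator {B..} x * e)"
  proof (rule Bochner_Integration.integrable_bound[OF f])
    show "AE x in lborel. norm (indicator {B..} x * e) \<le> norm (f x)"
      using neg e by (auto simp: indicator_def not_less)
  qed simp
  then have "integrable lborel (indicator {B..} :: real \<Rightarrow> real)"
    using e by simp
  then have "emeasure lborel {B..} < \<infinity>"
    by (subst (asm) integrable_indicator_iff) auto
  moreover have "ennreal (real n) \<le> emeasure lborel {B..}" for n
    using emeasure_mono[of "{B..B + real n}" "{B..}" lborel] by simp
  ultimately have "ennreal (real n) \<le> ennreal (measure lborel {B..})" for n
    using emeasure_eq_ennreal_measure[of lborel "{B..}"] by (simp add: less_top)
  then have "real n \<le> measure lborel {B..}" for n
    by (simp add: ennreal_le_iff)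
  then show False
    using reals_Archimedean2[of "measure lborel {B..}"] not_less by blast
qed


lemma integrable_lborel_reflect: "integrable lborel f \<Longrightarrow> integrable lborel (\<lambda>x. f (- x :: real) :: real)"
  using lborel_integrable_real_affine[of f "-1" 0] by simp

text \<open>The right end points run to infinity through points where \<open>f\<close> is small and
  the left end points tend to 0, so of the two boundary terms only the trace \<open>r\<close>
  survives.\<close>

lemma half_line_flux_pos:
  assumes ac: "abs_continuous_on {0<..} f"
    and deriv: "AE x in lborel. (f has_real_derivative f' x) (at x)"
    and f: "integrable lborel f" and f': "integrable lborel f'"
    and \<sigma>: "\<bar>\<sigma>\<bar> = 1" and \<mu>: "\<mu> > 0" and r: "(f \<longlongrightarrow> r) (at_right 0)"
  shows "\<mu> * (LINT x:{0<..}|lborel. \<bar>f x\<bar>) \<le> (LINT x:{0<..}|lborel. \<bar>\<mu> * f x + \<sigma> * f' x\<bar>) + \<sigma> * \<bar>r\<bar>"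
proof -
  have "\<exists>x\<ge>real n + 1. \<bar>f x\<bar> < 1 / real (Suc n)" for n
    by (rule integrable_small_value[OF f]) simp
  then obtain b where b: "\<And>n. b n \<ge> real n + 1" "\<And>n. \<bar>f (b n)\<bar> < 1 / real (Suc n)" by metis
  define a where "a n = 1 / real (Suc n)" for n
  have a: "a n > 0" "a n \<le> 1" for n by (auto simp: a_def)
  have a0: "a \<longlonglongrightarrow> 0" unfolding a_def by (rule LIMSEQ_Suc[OF lim_const_over_n])
  have "filterlim a (at_right 0) sequentially"
    using a0 a less_imp_neq[OF a(1)] by (auto simp: filterlim_at intro!: always_eventually)
  then have fa: "(\<lambda>n. f (a n)) \<longlonglongrightarrow> r" by (rule filterlim_compose[OF r])
  have fb: "(\<lambda>n. f (b n)) \<longlonglongrightarrow> 0"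
    using b(2) by (intro Lim_null_comparison[OF _ LIMSEQ_Suc[OF lim_const_over_n[of 1]]])
      (auto intro!: always_eventually less_imp_le)
  have lim: "eventually (\<lambda>n. x \<in> {a n..b n} \<longleftrightarrow> x \<in> {0<..}) sequentially" for x
  proof (cases "x > 0")
    case True
    have "eventually (\<lambda>n. a n < x) sequentially" using order_tendstoD(2)[OF a0 True] .
    moreover have "eventually (\<lambda>n. x \<le> real n) sequentially"
      using eventually_ge_at_top[of "nat \<lceil>x\<rceil>"] by eventually_elim linarith
    ultimately show ?thesis
    proof eventually_elim
      case (elim n)
      then show ?case using b(1)[of n] True by auto
    qed
  next
    case False
    have "x < a n" for n using a(1)[of n] False by linarith
    then show ?thesis using False by (auto intro!: always_eventually simp: not_le)
  qed
  have "\<sigma> * (\<bar>0\<bar> - \<bar>r\<bar>) + \<mu> * (LINT x:{0<..}|lborel. \<bar>f x\<bar>) \<le> (LINT x:{0<..}|lborel. \<bar>\<mu> * f x + \<sigma> * f' x\<bar>)"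
  proof (rule abs_flux_le[OF ac _ lim _ _ deriv f f' \<sigma> \<mu> fa fb])
    show "{a n..b n} \<subseteq> {0<..}" for n using a(1)[of n] by auto
    show "a n \<le> b n" for n using a(2)[of n] b(1)[of n] by simp
  qed simp
  then show ?thesis by simp
qed

lemma half_line_flux_neg:
  assumes ac: "abs_continuous_on {..<0} f"
    and deriv: "AE x in lborel. (f has_real_derivative f' x) (at x)"
    and f: "integrable lborel f" and f': "integrable lborel f'"
    and \<sigma>: "\<bar>\<sigma>\<bar> = 1" and \<mu>: "\<mu> > 0" and l: "(f \<longlongrightarrow> l) (at_left 0)"
  shows "\<mu> * (LINT x:{..<0}|lborel. \<bar>f x\<bar>) \<le> (LINT x:{..<0}|lborel. \<bar>\<mu> * f x + \<sigma> * f' x\<bar>) - \<sigma> * \<bar>l\<bar>"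
proof -
  have "\<exists>x\<ge>real n + 1. \<bar>f (- x)\<bar> < 1 / real (Suc n)" for n
    by (rule integrable_small_value[OF integrable_lborel_reflect[OF f]]) simp
  then obtain c where c: "\<And>n. c n \<ge> real n + 1" "\<And>n. \<bar>f (- c n)\<bar> < 1 / real (Suc n)" by metis
  define a where "a n = - c n" for n
  define b where "b n = - (1 / real (Suc n))" for n
  have a: "a n \<le> - real n - 1" "\<bar>f (a n)\<bar> < 1 / real (Suc n)" for n using c[of n] by (auto simp: a_def)
  have b: "b n < 0" "b n \<ge> - 1" for n by (auto simp: b_def)
  have b0: "b \<longlonglongrightarrow> 0" unfolding b_def
    using tendsto_minus[OF LIMSEQ_Suc[OF lim_const_over_n[of "1::real"]]] by simp
  have "filterlim b (at_left 0) sequentially"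
    using b0 b less_imp_neq[OF b(1)] by (auto simp: filterlim_at intro!: always_eventually)
  then have fb: "(\<lambda>n. f (b n)) \<longlonglongrightarrow> l" by (rule filterlim_compose[OF l])
  have fa: "(\<lambda>n. f (a n)) \<longlonglongrightarrow> 0"
    using a(2) by (intro Lim_null_comparison[OF _ LIMSEQ_Suc[OF lim_const_over_n[of 1]]])
      (auto intro!: always_eventually less_imp_le)
  have lim: "eventually (\<lambda>n. x \<in> {a n..b n} \<longleftrightarrow> x \<in> {..<0}) sequentially" for x
  proof (cases "x < 0")
    case True
    have "eventually (\<lambda>n. x < b n) sequentially" using order_tendstoD(1)[OF b0 True] .
    moreover have "eventually (\<lambda>n. - x \<le> real n) sequentially"
      using eventually_ge_at_top[of "nat \<lceil>- x\<rceil>"] by eventually_elim linarith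
    ultimately show ?thesis
    proof eventually_elim
      case (elim n)
      then show ?case using a(1)[of n] True by auto
    qed
  next
    case False
    have "b n < x" for n using b(1)[of n] False by linarith
    then show ?thesis using False by (auto intro!: always_eventually simp: not_le)
  qed
  have "\<sigma> * (\<bar>l\<bar> - \<bar>0\<bar>) + \<mu> * (LINT x:{..<0}|lborel. \<bar>f x\<bar>) \<le> (LINT x:{..<0}|lborel. \<bar>\<mu> * f x + \<sigma> * f' x\<bar>)"
  proof (rule abs_flux_le[OF ac _ lim _ _ deriv f f' \<sigma> \<mu> fa fb])
    show "{a n..b n} \<subseteq> {..<0}" for n using b(1)[of n] by auto
    show "a n \<le> b n" for n using b(2)[of n] a(1)[of n] by linarith
  qed simp
  then show ?thesis by simp
qed

lemma integral_split_at_zero: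
  fixes f :: "real \<Rightarrow> real"
  assumes "integrable lborel f"
  shows "integral\<^sup>L lborel f = (LINT x:{..<0}|lborel. f x) + (LINT x:{0<..}|lborel. f x)"
proof -
  have "integral\<^sup>L lborel f = (\<integral>x. indicator {..<0} x *\<^sub>R f x + indicator {0<..} x *\<^sub>R f x \<partial>lborel)"
  proof (rule integral_cong_AE)
    show "AE x in lborel. f x = indicator {..<0} x *\<^sub>R f x + indicator {0<..} x *\<^sub>R f x"
      using AE_lborel_singleton[of "0::real"] by eventually_elim (auto simp: indicator_def)
  qed (use assms in auto)
  also have "\<dots> = (LINT x:{..<0}|lborel. f x) + (LINT x:{0<..}|lborel. f x)"
    unfolding set_lebesgue_integral_def using assms
    by (intro Bochner_Integration.integral_add integrable_mult_indicator) auto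
  finally show ?thesis .
qed

lemma integrable_S_iff:
  fixes F :: "S \<Rightarrow> real"
  shows "integrable base_measure F \<longleftrightarrow> (\<forall>i. integrable lborel (\<lambda>x. F (x, i)))"
    and "integrable base_measure F \<Longrightarrow>
      integral\<^sup>L base_measure F = (\<integral>x. F (x, Pos) \<partial>lborel) + (\<integral>x. F (x, Neg) \<partial>lborel)"
proof -
  interpret pair_sigma_finite lborel "count_space (UNIV :: direction set)" by (rule pair_sigma_finite_S)
  let ?M = "lborel \<Otimes>\<^sub>M count_space UNIV :: S measure"
  have int: "\<forall>i. integrable lborel (\<lambda>x. F (x, i))" if F: "integrable ?M F"
  proof
    fix i
    \<comment> \<open>Integrating this product over the discrete coordinate returns the single
      section at \<open>i\<close>.\<close>
    have "integrable ?M (\<lambda>z. F z * indicator (UNIV \<times> {i}) z)"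
      by (rule integrable_real_mult_indicator[OF _ F]) auto
    then have "integrable lborel (\<lambda>x. \<integral>j. F (x, j) * indicator (UNIV \<times> {i}) (x, j) \<partial>count_space UNIV)"
      by (rule integrable_fst')
    moreover have "(\<integral>j. F (x, j) * indicator (UNIV \<times> {i}) (x, j) \<partial>count_space UNIV) = F (x, i)" for x
      by (subst lebesgue_integral_count_space_finite)
        (cases i; auto simp: UNIV_direction indicator_def)+
    ultimately show "integrable lborel (\<lambda>x. F (x, i))" by simp
  qed
  have conv: "integrable ?M F" if F: "\<forall>i. integrable lborel (\<lambda>x. F (x, i))"
  proof (rule Fubini_integrable)
    have "F = (\<lambda>(x, i). if i = Pos then F (x, Pos) else F (x, Neg))"
      by (auto simp: fun_eq_iff) (metis direction.exhaust)
    moreover have "(\<lambda>(x, i). if i = Pos then F (x, Pos) else F (x, Neg)) \<in> borel_measurable ?M"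
    proof -
      have [measurable]: "(\<lambda>x. F (x, Pos)) \<in> borel_measurable lborel" "(\<lambda>x. F (x, Neg)) \<in> borel_measurable lborel"
        by (rule borel_measurable_integrable, use F in blast)+
      show ?thesis by measurable
    qed
    ultimately show "F \<in> borel_measurable ?M" by simp
    have "(\<lambda>x. \<integral>i. norm (F (x, i)) \<partial>count_space UNIV) = (\<lambda>x. norm (F (x, Pos)) + norm (F (x, Neg)))"
      by (simp add: lebesgue_integral_count_space_finite UNIV_direction)
    then show "integrable lborel (\<lambda>x. \<integral>i. norm (F (x, i)) \<partial>count_space UNIV)"
      using F by auto
    show "AE x in lborel. integrable (count_space UNIV) (\<lambda>i. F (x, i))"
      by (simp add: integrable_count_space)
  qed
  show "integrable base_measure F \<longleftrightarrow> (\<forall>i. integrable lborel (\<lambda>x. F (x, i)))"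
    unfolding base_measure_S using int conv by blast
  assume "integrable base_measure F"
  then have F: "integrable ?M F" by (simp add: base_measure_S)
  have "integral\<^sup>L ?M F = (\<integral>x. (\<integral>i. F (x, i) \<partial>count_space UNIV) \<partial>lborel)"
    by (rule integral_fst'[OF F, symmetric])
  also have "\<dots> = (\<integral>x. F (x, Pos) + F (x, Neg) \<partial>lborel)"
    by (simp add: lebesgue_integral_count_space_finite UNIV_direction)
  also have "\<dots> = (\<integral>x. F (x, Pos) \<partial>lborel) + (\<integral>x. F (x, Neg) \<partial>lborel)"
    using int[OF F] by (intro Bochner_Integration.integral_add) auto
  finally show "integral\<^sup>L base_measure F = (\<integral>x. F (x, Pos) \<partial>lborel) + (\<integral>x. F (x, Neg) \<partial>lborel)"
    by (simp add: base_measure_S)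
qed

text \<open>Adding the flux inequalities of both directions and both half-lines leaves the modulus
  of the outgoing traces \<open>r Pos\<close>, \<open>l Neg\<close> minus that of the incoming
  traces \<open>l Pos\<close>, \<open>r Neg\<close>. This is not positive, since the transmission
  matrix has nonnegative entries and its columns \<open>p, p'\<close> and \<open>q', q\<close> sum
  to 1.\<close>

theorem A_op_dissipative:
  assumes pq: "p \<ge> 0" "p' \<ge> 0" "q \<ge> 0" "q' \<ge> 0" "p + p' = 1" "q + q' = 1"
    and A: "(\<phi>, \<psi>) \<in> A_op p p' q q'" and \<mu>: "\<mu> > 0"
  shows "\<mu> * norm \<phi> \<le> norm (\<mu> *\<^sub>R \<phi> - \<psi>)"
proof -
  obtain f f' l r where rep: "represents f \<phi>" "represents (\<lambda>(x, i). - sgn_of i * f' (x, i)) \<psi>"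
    and ac: "\<And>i. abs_continuous_on {0<..} (\<lambda>x. f (x, i))" "\<And>i. abs_continuous_on {..<0} (\<lambda>x. f (x, i))"
    and deriv: "\<And>i. AE x in lborel. ((\<lambda>y. f (y, i)) has_real_derivative f' (x, i)) (at x)"
    and lim: "\<And>i. ((\<lambda>x. f (x, i)) \<longlongrightarrow> l i) (at_left 0)" "\<And>i. ((\<lambda>x. f (x, i)) \<longlongrightarrow> r i) (at_right 0)"
    and bc: "r Pos = p * l Pos + q' * r Neg" "l Neg = p' * l Pos + q * r Neg"
    using A unfolding A_op_def by blast
  have f: "integrable lborel (\<lambda>x. f (x, i))" for i
    using represents_integrable[OF rep(1)] integrable_S_iff(1) by blast
  have sf': "integrable lborel (\<lambda>x. - sgn_of i * f' (x, i))" for i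
    using represents_integrable[OF rep(2)] integrable_S_iff(1) by fastforce
  have f': "integrable lborel (\<lambda>x. f' (x, i))" for i
    using sf'[of i] by (cases i) auto
  let ?G = "\<lambda>i x. \<mu> * f (x, i) + sgn_of i * f' (x, i)"
  have G: "integrable lborel (?G i)" for i using f f' by auto
  have rep_G: "represents (\<lambda>z. \<mu> * f z - (case z of (x, i) \<Rightarrow> - sgn_of i * f' (x, i))) (\<mu> *\<^sub>R \<phi> - \<psi>)"
    by (intro represents_diff represents_scaleR rep)
  have norm_G: "norm (\<mu> *\<^sub>R \<phi> - \<psi>) = (\<integral>x. \<bar>?G Pos x\<bar> \<partial>lborel) + (\<integral>x. \<bar>?G Neg x\<bar> \<partial>lborel)"
    unfolding represents_norm[OF rep_G]
    by (subst integrable_S_iff(2)) (use represents_integrable[OF rep_G] in \<open>auto simp: \<close>)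
  have norm_f: "norm \<phi> = (\<integral>x. \<bar>f (x, Pos)\<bar> \<partial>lborel) + (\<integral>x. \<bar>f (x, Neg)\<bar> \<partial>lborel)"
    unfolding represents_norm[OF rep(1)]
    by (subst integrable_S_iff(2)) (use represents_integrable[OF rep(1)] in auto)
  have branch: "\<mu> * (\<integral>x. \<bar>f (x, i)\<bar> \<partial>lborel) \<le> (\<integral>x. \<bar>?G i x\<bar> \<partial>lborel) + sgn_of i * \<bar>r i\<bar> - sgn_of i * \<bar>l i\<bar>" for i
  proof -
    have \<sigma>: "\<bar>sgn_of i\<bar> = 1" by (cases i) auto
    have "\<mu> * (LINT x:{0<..}|lborel. \<bar>f (x, i)\<bar>) \<le> (LINT x:{0<..}|lborel. \<bar>?G i x\<bar>) + sgn_of i * \<bar>r i\<bar>"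
      by (rule half_line_flux_pos[OF ac(1) deriv f f' \<sigma> \<mu> lim(2)])
    moreover have "\<mu> * (LINT x:{..<0}|lborel. \<bar>f (x, i)\<bar>) \<le> (LINT x:{..<0}|lborel. \<bar>?G i x\<bar>) - sgn_of i * \<bar>l i\<bar>"
      by (rule half_line_flux_neg[OF ac(2) deriv f f' \<sigma> \<mu> lim(1)])
    moreover have "integrable lborel (\<lambda>x. \<bar>f (x, i)\<bar>)" "integrable lborel (\<lambda>x. \<bar>?G i x\<bar>)"
      using f G by auto
    ultimately show ?thesis
      by (simp add: integral_split_at_zero distrib_left)
  qed
  have "\<bar>r Pos\<bar> \<le> p * \<bar>l Pos\<bar> + q' * \<bar>r Neg\<bar>"
    unfolding bc(1) using pq by (intro order_trans[OF abs_triangle_ineq]) (simp add: abs_mult)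
  moreover have "\<bar>l Neg\<bar> \<le> p' * \<bar>l Pos\<bar> + q * \<bar>r Neg\<bar>"
    unfolding bc(2) using pq by (intro order_trans[OF abs_triangle_ineq]) (simp add: abs_mult)
  moreover have "p * \<bar>l Pos\<bar> + p' * \<bar>l Pos\<bar> = \<bar>l Pos\<bar>" "q * \<bar>r Neg\<bar> + q' * \<bar>r Neg\<bar> = \<bar>r Neg\<bar>"
    using pq by (simp_all add: distrib_right[symmetric])
  ultimately show ?thesis
    using branch[of Pos] branch[of Neg] unfolding norm_G norm_f by (simp add: distrib_left)
qed

section \<open>Membership in the domain of the transport operator\<close>

lemma abs_continuous_on_scale:
  assumes "abs_continuous_on s f"
  shows "abs_continuous_on s (\<lambda>x. c * f x)"
  by (rule abs_continuous_on_Lipschitz_compose[OF assms, where j="\<lambda>y. c * y" and L="\<bar>c\<bar>"])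
    (simp add: abs_mult right_diff_distrib[symmetric])

lemma abs_continuous_on_add:
  assumes "abs_continuous_on s f" "abs_continuous_on s g"
  shows "abs_continuous_on s (\<lambda>x. f x + g x)"
  unfolding abs_continuous_on_def
proof (intro allI impI)
  fix e :: real assume e: "e > 0"
  then have "e / 2 > 0" by simp
  from abs_continuous_onE[OF assms(1) this] obtain \<delta>1 where \<delta>1: "\<delta>1 > 0" "\<And>D. finite D \<Longrightarrow> (\<forall>(a, b)\<in>D. a \<le> b \<and> {a..b} \<subseteq> s) \<Longrightarrow>
        pairwise (\<lambda>(a, b) (c, d). {a<..<b} \<inter> {c<..<d} = {}) D \<Longrightarrow>
        (\<Sum>(a, b)\<in>D. b - a) < \<delta>1 \<Longrightarrow> (\<Sum>(a, b)\<in>D. \<bar>f b - f a\<bar>) < e / 2"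
    by blast
  from abs_continuous_onE[OF assms(2) \<open>e / 2 > 0\<close>] obtain \<delta>2 where \<delta>2: "\<delta>2 > 0" "\<And>D. finite D \<Longrightarrow> (\<forall>(a, b)\<in>D. a \<le> b \<and> {a..b} \<subseteq> s) \<Longrightarrow>
        pairwise (\<lambda>(a, b) (c, d). {a<..<b} \<inter> {c<..<d} = {}) D \<Longrightarrow>
        (\<Sum>(a, b)\<in>D. b - a) < \<delta>2 \<Longrightarrow> (\<Sum>(a, b)\<in>D. \<bar>g b - g a\<bar>) < e / 2"
    by blast
  show "\<exists>\<delta>>0. \<forall>D. finite D \<longrightarrow> (\<forall>(a, b)\<in>D. a \<le> b \<and> {a..b} \<subseteq> s) \<longrightarrow>
        pairwise (\<lambda>(a, b) (c, d). {a<..<b} \<inter> {c<..<d} = {}) D \<longrightarrow>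
        (\<Sum>(a, b)\<in>D. b - a) < \<delta> \<longrightarrow> (\<Sum>(a, b)\<in>D. \<bar>f b + g b - (f a + g a)\<bar>) < e"
  proof (intro exI[of _ "min \<delta>1 \<delta>2"] conjI allI impI)
    fix D :: "(real \<times> real) set"
    assume D: "finite D" "\<forall>(a, b)\<in>D. a \<le> b \<and> {a..b} \<subseteq> s"
      "pairwise (\<lambda>(a, b) (c, d). {a<..<b} \<inter> {c<..<d} = {}) D" "(\<Sum>(a, b)\<in>D. b - a) < min \<delta>1 \<delta>2"
    have "(\<Sum>(a, b)\<in>D. \<bar>f b + g b - (f a + g a)\<bar>) \<le> (\<Sum>(a, b)\<in>D. \<bar>f b - f a\<bar>) + (\<Sum>(a, b)\<in>D. \<bar>g b - g a\<bar>)"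
      unfolding sum.distrib[symmetric] by (intro sum_mono) auto
    also have "\<dots> < e" using \<delta>1(2)[OF D(1-3)] \<delta>2(2)[OF D(1-3)] D(4) by simp
    finally show "(\<Sum>(a, b)\<in>D. \<bar>f b + g b - (f a + g a)\<bar>) < e" .
  qed (use \<delta>1 \<delta>2 in auto)
qed

lemma integral_truncation_small:
  fixes g :: "real \<Rightarrow> real"
  assumes g: "integrable lborel g" and e: "e > 0"
  obtains n :: nat where "(\<integral>x. \<bar>g x\<bar> - min \<bar>g x\<bar> (real n) \<partial>lborel) < e"
proof -
  have "(\<lambda>n. \<integral>x. \<bar>g x\<bar> - min \<bar>g x\<bar> (real n) \<partial>lborel) \<longlonglongrightarrow> integral\<^sup>L lborel (\<lambda>x::real. 0)"
  proof (rule integral_dominated_convergence[where w="\<lambda>x. \<bar>g x\<bar>"])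
    show "AE x in lborel. (\<lambda>n. \<bar>g x\<bar> - min \<bar>g x\<bar> (real n)) \<longlonglongrightarrow> 0"
    proof (rule AE_I2, rule tendsto_eventually)
      fix x
      show "eventually (\<lambda>n. \<bar>g x\<bar> - min \<bar>g x\<bar> (real n) = 0) sequentially"
        using eventually_ge_at_top[of "nat \<lceil>\<bar>g x\<bar>\<rceil>"]
      proof eventually_elim
        case (elim n)
        then have "\<bar>g x\<bar> \<le> real n" by linarith
        then show ?case by simp
      qed
    qed
  qed (use g in auto)
  then have "eventually (\<lambda>n. (\<integral>x. \<bar>g x\<bar> - min \<bar>g x\<bar> (real n) \<partial>lborel) < e) sequentially"
    using e by (intro order_tendstoD) auto
  then show ?thesis using that by (auto simp: eventually_sequentially)
qed

lemma integrable_indicator_mult: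
  fixes g :: "'a \<Rightarrow> real"
  shows "A \<in> sets M \<Longrightarrow> integrable M g \<Longrightarrow> integrable M (\<lambda>x. indicator A x * g x)"
  using integrable_mult_indicator[of A M g] by simp

text \<open>The modulus of \<open>f'\<close> splits into a part bounded by \<open>n\<close> and a
  part \<open>h\<close> of integral below \<open>e / 2\<close>. Over disjoint intervals of total
  length below \<open>\<delta>\<close> the first contributes at most \<open>n * \<delta>\<close>,
  and the second at most its whole integral.\<close>

lemma abs_continuous_on_integrable_deriv:
  assumes s: "is_interval s"
    and deriv: "\<And>x. x \<in> s \<Longrightarrow> (f has_real_derivative f' x) (at x)"
    and f': "integrable lborel f'"
  shows "abs_continuous_on s f"
  unfolding abs_continuous_on_def
proof (intro allI impI)
  fix e :: real assume e: "e > 0"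
  obtain n :: nat where n: "(\<integral>x. \<bar>f' x\<bar> - min \<bar>f' x\<bar> (real n) \<partial>lborel) < e / 2"
    using integral_truncation_small[OF f', of "e / 2"] e by auto
  define h where "h x = \<bar>f' x\<bar> - min \<bar>f' x\<bar> (real n)" for x
  have "integrable lborel h"
  proof (rule Bochner_Integration.integrable_bound[OF f'])
    have [measurable]: "f' \<in> borel_measurable lborel" by (rule borel_measurable_integrable[OF f'])
    show "h \<in> borel_measurable lborel" unfolding h_def by measurable
  qed (auto simp: h_def min_def)
  then have h: "integrable lborel h" "\<And>x. h x \<ge> 0"
    by (auto simp: h_def)
  define \<delta> where "\<delta> = e / (2 * (real n + 1))"
  have \<delta>: "\<delta> > 0" using e by (simp add: \<delta>_def)
  have incr: "\<bar>f b - f a\<bar> \<le> (\<integral>x. indicator {a<..<b} x * h x \<partial>lborel) + real n * (b - a)"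
    if ab: "a \<le> b" "{a..b} \<subseteq> s" for a b
  proof -
    have "(f' has_integral f b - f a) {a..b}"
    proof (rule fundamental_theorem_of_calculus[OF ab(1)])
      fix x assume "x \<in> {a..b}"
      then have "(f has_real_derivative f' x) (at x within {a..b})"
        by (rule has_field_derivative_at_within[OF deriv[OF subsetD[OF ab(2)]]])
      then show "(f has_vector_derivative f' x) (at x within {a..b})"
        by (simp add: has_real_derivative_iff_has_vector_derivative)
    qed
    moreover have si: "set_integrable lborel {a..b} f'"
      unfolding set_integrable_def by (rule integrable_mult_indicator; use f' in simp)
    ultimately have "f b - f a = (LINT x:{a..b}|lborel. f' x)"
      using set_borel_integral_eq_integral(2)[OF si] by (simp add: integral_unique)
    then have "\<bar>f b - f a\<bar> \<le> (\<integral>x. \<bar>indicator {a..b} x * f' x\<bar> \<partial>lborel)"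
      using integral_abs_bound[of lborel "\<lambda>x. indicator {a..b} x * f' x"]
      by (simp add: set_lebesgue_integral_def)
    also have "\<dots> = (\<integral>x. indicator {a<..<b} x * \<bar>f' x\<bar> \<partial>lborel)"
    proof (rule integral_cong_AE)
      show "AE x in lborel. \<bar>indicator {a..b} x * f' x\<bar> = indicator {a<..<b} x * \<bar>f' x\<bar>"
        using AE_lborel_singleton[of a] AE_lborel_singleton[of b]
        by eventually_elim (auto simp: indicator_def)
    qed (use f' in auto)
    also have "\<dots> \<le> (\<integral>x. indicator {a<..<b} x * h x + real n * indicator {a<..<b} x \<partial>lborel)"
    proof (rule integral_mono)
      show "integrable lborel (\<lambda>x. indicator {a<..<b} x * \<bar>f' x\<bar>)"
        using f' by (intro integrable_indicator_mult) auto
      show "integrable lborel (\<lambda>x. indicator {a<..<b} x * h x + real n * indicator {a<..<b} x)"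
        using h ab by (intro Bochner_Integration.integrable_add integrable_indicator_mult integrable_mult_right integrable_real_indicator) auto
    qed (auto simp: h_def indicator_def)
    also have "\<dots> = (\<integral>x. indicator {a<..<b} x * h x \<partial>lborel) + real n * (b - a)"
      using f' h ab by (subst Bochner_Integration.integral_add)
        (auto intro!: integrable_indicator_mult integrable_mult_right integrable_real_indicator)
    finally show ?thesis .
  qed
  show "\<exists>\<delta>>0. \<forall>D. finite D \<longrightarrow> (\<forall>(a, b)\<in>D. a \<le> b \<and> {a..b} \<subseteq> s) \<longrightarrow>
        pairwise (\<lambda>(a, b) (c, d). {a<..<b} \<inter> {c<..<d} = {}) D \<longrightarrow>
        (\<Sum>(a, b)\<in>D. b - a) < \<delta> \<longrightarrow> (\<Sum>(a, b)\<in>D. \<bar>f b - f a\<bar>) < e"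
  proof (intro exI[of _ \<delta>] conjI allI impI \<delta>)
    fix D :: "(real \<times> real) set"
    assume D: "finite D" "\<forall>(a, b)\<in>D. a \<le> b \<and> {a..b} \<subseteq> s"
      "pairwise (\<lambda>(a, b) (c, d). {a<..<b} \<inter> {c<..<d} = {}) D" "(\<Sum>(a, b)\<in>D. b - a) < \<delta>"
    let ?I = "\<lambda>d. {fst d<..<snd d}"
    have disj: "disjoint_family_on ?I D"
      using D(3) by (force simp: disjoint_family_on_def pairwise_def case_prod_beta)
    have "(\<Sum>(a, b)\<in>D. \<bar>f b - f a\<bar>) \<le> (\<Sum>d\<in>D. (\<integral>x. indicator (?I d) x * h x \<partial>lborel) + real n * (snd d - fst d))"
      using D(2) incr by (intro sum_mono) auto
    also have "\<dots> = (\<integral>x. (\<Sum>d\<in>D. indicator (?I d) x * h x) \<partial>lborel) + real n * (\<Sum>(a, b)\<in>D. b - a)"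
      using h by (subst Bochner_Integration.integral_sum)
        (auto intro!: integrable_indicator_mult simp: sum.distrib sum_distrib_left case_prod_beta)
    also have "(\<integral>x. (\<Sum>d\<in>D. indicator (?I d) x * h x) \<partial>lborel) \<le> (\<integral>x. h x \<partial>lborel)"
    proof (rule integral_mono)
      show "integrable lborel (\<lambda>x. \<Sum>d\<in>D. indicator (?I d) x * h x)"
        using h by (intro Bochner_Integration.integrable_sum integrable_indicator_mult) auto
      fix x
      have "(\<Sum>d\<in>D. indicator (?I d) x) * h x \<le> 1 * h x"
        unfolding indicator_UN_disjoint[OF D(1) disj, of x, symmetric]
        by (intro mult_right_mono h) (simp add: indicator_def)
      then show "(\<Sum>d\<in>D. indicator (?I d) x * h x) \<le> h x"
        by (simp add: sum_distrib_right)
    qed (rule h)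
    also have "(\<integral>x. h x \<partial>lborel) < e / 2" using n by (simp add: h_def)
    also have "real n * (\<Sum>(a, b)\<in>D. b - a) \<le> real n * \<delta>"
      using D(4) by (intro mult_left_mono) auto
    also have "real n * \<delta> \<le> e / 2"
      using e by (simp add: \<delta>_def field_simps)
    finally show "(\<Sum>(a, b)\<in>D. \<bar>f b - f a\<bar>) < e" by simp
  qed
qed

lemma A_op_intro_C1:
  fixes F F' :: "S \<Rightarrow> real"
  assumes rep: "represents F \<phi>" "represents (\<lambda>(x, i). - sgn_of i * F' (x, i)) \<psi>"
    and deriv: "\<And>x i. x \<noteq> 0 \<Longrightarrow> ((\<lambda>y. F (y, i)) has_real_derivative F' (x, i)) (at x)"
    and F': "\<And>i. integrable lborel (\<lambda>x. F' (x, i))"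
    and lim: "\<And>i. ((\<lambda>x. F (x, i)) \<longlongrightarrow> l i) (at_left 0)" "\<And>i. ((\<lambda>x. F (x, i)) \<longlongrightarrow> r i) (at_right 0)"
    and bc: "r Pos = p * l Pos + q' * r Neg" "l Neg = p' * l Pos + q * r Neg"
  shows "(\<phi>, \<psi>) \<in> A_op p p' q q'"
proof -
  have "abs_continuous_on {0<..} (\<lambda>x. F (x, i))" "abs_continuous_on {..<0} (\<lambda>x. F (x, i))" for i
    by (rule abs_continuous_on_integrable_deriv[OF _ deriv F']; simp add: is_interval_1)+
  moreover have "AE x in lborel. ((\<lambda>y. F (y, i)) has_real_derivative F' (x, i)) (at x)" for i
    using AE_lborel_singleton[of "0::real"] by eventually_elim (rule deriv)
  ultimately show ?thesis
    unfolding A_op_def using rep lim bc by blast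
qed

section \<open>A compactly supported cutoff function\<close>

lemma pos_part_power_deriv:
  fixes y :: real
  assumes "n \<ge> 1"
  shows "((\<lambda>y. max 0 y ^ Suc n) has_real_derivative real (Suc n) * max 0 y ^ n) (at y)"
proof (cases y "0::real" rule: linorder_cases)
  case less
  have "((\<lambda>y. 0) has_real_derivative real (Suc n) * max 0 y ^ n) (at y)"
    using less assms by (simp add: max_def power_0_left)
  then show ?thesis
    by (rule has_field_derivative_transform_within_open[of _ _ _ "{..<0}"]) (use less in \<open>auto simp: max_def\<close>)
next
  case equal
  have "((\<lambda>h::real. max 0 h ^ Suc n / h) \<longlongrightarrow> 0) (at 0)"
  proof (rule Lim_null_comparison)
    show "((\<lambda>h::real. \<bar>h\<bar> ^ n) \<longlongrightarrow> 0) (at 0)"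
      using assms by (auto intro!: tendsto_eq_intros simp: power_0_left)
    show "eventually (\<lambda>h::real. norm (max 0 h ^ Suc n / h) \<le> \<bar>h\<bar> ^ n) (at 0)"
      by (rule always_eventually) (auto simp: max_def power_abs)
  qed
  then show ?thesis using equal assms by (simp add: DERIV_def power_0_left)
next
  case greater
  have "((\<lambda>y. y ^ Suc n) has_real_derivative real (Suc n) * max 0 y ^ n) (at y)"
    using greater DERIV_pow[of "Suc n" y] by (simp add: max_def)
  then show ?thesis
    by (rule has_field_derivative_transform_within_open[of _ _ _ "{0<..}"]) (use greater in \<open>auto simp: max_def\<close>)
qed

text \<open>The third power is used to make the second derivative continuous, as the correctors
  involve derivatives of the cutoff up to order two. Value 1 and slope 0 at the origin let it carry
  a prescribed jump without disturbing one-sided derivatives.\<close>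

definition bump :: "real \<Rightarrow> real" where "bump x = max 0 (1 - x\<^sup>2) ^ 3"
definition bump' :: "real \<Rightarrow> real" where "bump' x = - 6 * x * max 0 (1 - x\<^sup>2) ^ 2"
definition bump'' :: "real \<Rightarrow> real" where
  "bump'' x = - 6 * max 0 (1 - x\<^sup>2) ^ 2 + 24 * x\<^sup>2 * max 0 (1 - x\<^sup>2)"

lemma bump_deriv: "(bump has_real_derivative bump' x) (at x)"
proof -
  have 1: "((\<lambda>x. 1 - x\<^sup>2) has_real_derivative (- 2 * x)) (at x)"
    by (auto intro!: derivative_eq_intros)
  have "((\<lambda>x. max 0 (1 - x\<^sup>2) ^ Suc 2) has_real_derivative (real (Suc 2) * max 0 (1 - x\<^sup>2) ^ 2) * (- 2 * x)) (at x)"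
    by (rule DERIV_chain2[OF pos_part_power_deriv 1]) simp
  then show ?thesis
    unfolding bump_def bump'_def by (simp add: mult_ac eval_nat_numeral)
qed

lemma bump'_deriv: "(bump' has_real_derivative bump'' x) (at x)"
proof -
  have 1: "((\<lambda>x. 1 - x\<^sup>2) has_real_derivative (- 2 * x)) (at x)"
    by (auto intro!: derivative_eq_intros)
  have "((\<lambda>x. max 0 (1 - x\<^sup>2) ^ Suc 1) has_real_derivative (real (Suc 1) * max 0 (1 - x\<^sup>2) ^ 1) * (- 2 * x)) (at x)"
    by (rule DERIV_chain2[OF pos_part_power_deriv 1]) simp
  then have 2: "((\<lambda>x. max 0 (1 - x\<^sup>2) ^ 2) has_real_derivative - 4 * x * max 0 (1 - x\<^sup>2)) (at x)"
    by (simp add: mult_ac numeral_2_eq_2)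
  have "((\<lambda>x. - 6 * x) has_real_derivative - 6) (at x)"
    by (auto intro!: derivative_eq_intros)
  from DERIV_mult[OF this 2] show ?thesis
    unfolding bump'_def bump''_def by (simp add: power2_eq_square algebra_simps)
qed

lemma bump_at_zero [simp]: "bump 0 = 1" "bump' 0 = 0"
  by (simp_all add: bump_def bump'_def)

lemma bump_continuous: "continuous_on UNIV bump" "continuous_on UNIV bump'" "continuous_on UNIV bump''"
  unfolding bump_def bump'_def bump''_def by (intro continuous_intros)+

lemma bump_zero_outside: "\<bar>x\<bar> \<ge> 1 \<Longrightarrow> bump x = 0 \<and> bump' x = 0 \<and> bump'' x = 0"
  using abs_le_square_iff[of 1 x] by (simp add: bump_def bump'_def bump''_def max_def)

lemma integrable_supported_in_unit:
  fixes h :: "real \<Rightarrow> real"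
  assumes "continuous_on UNIV h" "\<And>x. \<bar>x\<bar> \<ge> 1 \<Longrightarrow> h x = 0"
  shows "integrable lborel h"
proof -
  have "integrable lborel (\<lambda>x. indicator {-1..1} x *\<^sub>R h x)"
    by (rule borel_integrable_compact) (auto intro: continuous_on_subset[OF assms(1)])
  moreover have "(\<lambda>x. indicator {-1..1} x *\<^sub>R h x) = h"
  proof
    show "indicator {-1..1} x *\<^sub>R h x = h x" for x
      by (cases "\<bar>x\<bar> \<le> 1") (use assms(2)[of x] in \<open>auto simp: indicator_def abs_le_iff\<close>)
  qed
  ultimately show ?thesis by simp
qed

lemma bump_integrable: "integrable lborel bump" "integrable lborel bump'" "integrable lborel bump''"
  using bump_zero_outside by (auto intro!: integrable_supported_in_unit bump_continuous)

section \<open>Regularity in the domain of the Laplace operator\<close>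

lemma set_integrable_mult_bounded:
  fixes g h :: "real \<Rightarrow> real"
  assumes g: "integrable lborel g" and h: "h \<in> borel_measurable lborel"
    and s: "s \<in> sets borel" and bound: "\<And>y. y \<in> s \<Longrightarrow> \<bar>h y\<bar> \<le> K"
  shows "set_integrable lborel s (\<lambda>y. h y * g y)"
  unfolding set_integrable_def
proof (rule Bochner_Integration.integrable_bound)
  show "integrable lborel (\<lambda>y. K * g y)" using g by simp
  have [measurable]: "g \<in> borel_measurable lborel" by (rule borel_measurable_integrable[OF g])
  show "(\<lambda>y. indicator s y *\<^sub>R (h y * g y)) \<in> borel_measurable lborel"
    using h s by measurable
  show "AE y in lborel. norm (indicator s y *\<^sub>R (h y * g y)) \<le> norm (K * g y)"
  proof (rule AE_I2)
    fix y
    have "\<bar>h y\<bar> \<le> \<bar>K\<bar>" if "y \<in> s" using bound[OF that] by linarith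
    then show "norm (indicator s y *\<^sub>R (h y * g y)) \<le> norm (K * g y)"
      by (auto simp: indicator_def abs_mult intro: mult_right_mono)
  qed
qed

lemma set_integrable_Icc: "integrable lborel g \<Longrightarrow> set_integrable lborel {a..b} (g :: real \<Rightarrow> real)"
  using set_integrable_mult_bounded[of g "\<lambda>_. 1" "{a..b}" 1] by simp

lemma indefinite_LINT_continuous:
  fixes h :: "real \<Rightarrow> real"
  assumes "\<And>b. set_integrable lborel {0..b} h"
  shows "continuous_on {0..} (\<lambda>x. LINT y:{0..x}|lborel. h y)"
proof -
  have eq: "(LINT y:{0..x}|lborel. h y) = integral {0..x} h" for x
    by (rule set_borel_integral_eq_integral(2)[OF assms])
  have cont: "continuous (at x within {0..}) (\<lambda>x. integral {0..x} h)" if "x \<ge> 0" for x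
  proof -
    have "continuous_on {0..x + 1} (\<lambda>x. integral {0..x} h)"
      by (intro indefinite_integral_continuous_1 set_borel_integral_eq_integral(1) assms)
    then have "continuous (at x within {0..x + 1}) (\<lambda>x. integral {0..x} h)"
      using that by (simp add: continuous_on_eq_continuous_within)
    moreover have "at x within {0..x + 1} = at x within {0..}"
      using that by (intro at_within_nhd[of _ "{..<x + 1}"]) auto
    ultimately show ?thesis by simp
  qed
  then show ?thesis unfolding eq by (simp add: continuous_on_eq_continuous_within)
qed

lemma indefinite_LINT_deriv:
  fixes h :: "real \<Rightarrow> real"
  assumes h: "\<And>b. set_integrable lborel {0..b} h" and x: "x > 0" and cont: "continuous_on {0<..} h"
  shows "((\<lambda>x. LINT y:{0..x}|lborel. h y) has_real_derivative h x) (at x)"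
proof -
  have eq: "(LINT y:{0..x}|lborel. h y) = integral {0..x} h" for x
    by (rule set_borel_integral_eq_integral(2)[OF h])
  have "isCont h x" using cont x by (simp add: continuous_on_eq_continuous_at)
  then have "((\<lambda>u. integral {0..u} h) has_vector_derivative h x) (at x within ({0..x + 1} - {}))"
    using x by (intro integral_has_vector_derivative_continuous_at set_borel_integral_eq_integral(1) h)
      (auto intro: continuous_at_imp_continuous_at_within)
  moreover have "at x within ({0..x + 1} - {}) = at x"
    using x by (intro at_within_interior) (simp add: interior_atLeastAtMost_real)
  ultimately show ?thesis
    unfolding eq by (simp add: has_real_derivative_iff_has_vector_derivative)
qed

text \<open>By Fubini: each \<open>y\<close> lies in the windows starting in
  \<open>[y - 1, y]\<close>, a set of measure 1, so the double integral equals that of the modulus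
  of \<open>g\<close>.\<close>

lemma window_integrable:
  fixes g :: "real \<Rightarrow> real"
  assumes g: "integrable lborel g"
  shows "integrable lborel (\<lambda>x. LINT y:{x..x + 1}|lborel. \<bar>g y\<bar>)"
proof -
  have [measurable]: "g \<in> borel_measurable lborel" by (rule borel_measurable_integrable[OF g])
  let ?k = "\<lambda>(y, x). indicator {0..1} (y - x) * \<bar>g y\<bar>"
  have ind: "indicator {0..1} (y - x) = (indicator {y - 1..y} x :: real)" for x y :: real
    by (auto simp: indicator_def)
  have "integrable (lborel \<Otimes>\<^sub>M lborel) ?k"
  proof (rule lborel_pair.Fubini_integrable)
    show "integrable lborel (\<lambda>y. \<integral>x. norm (?k (y, x)) \<partial>lborel)"
      using g by (simp add: abs_mult ind)
    show "AE y in lborel. integrable lborel (\<lambda>x. ?k (y, x))"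
      by (simp add: ind)
  qed measurable
  then have "integrable (lborel \<Otimes>\<^sub>M lborel) (\<lambda>(x, y). ?k (y, x))"
    by (rule lborel_pair.integrable_product_swap)
  then have "integrable lborel (\<lambda>x. \<integral>y. (\<lambda>(x, y). ?k (y, x)) (x, y) \<partial>lborel)"
    by (rule lborel_pair.integrable_fst')
  moreover have "(\<integral>y. (\<lambda>(x, y). ?k (y, x)) (x, y) \<partial>lborel) = (LINT y:{x..x + 1}|lborel. \<bar>g y\<bar>)" for x
    unfolding set_lebesgue_integral_def
    by (intro Bochner_Integration.integral_cong) (auto simp: indicator_def)
  ultimately show ?thesis by simp
qed

text \<open>One half-line of the description of the Laplace domain, with \<open>g\<close> the second
  derivative and \<open>u1\<close> the candidate for the first. The left half-line is an instance
  after the reflection of x to -x, which changes the sign of \<open>d\<close>.\<close>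

locale half_line_potential =
  fixes g u :: "real \<Rightarrow> real" and c d :: real
  assumes g: "integrable lborel g"
    and u: "\<And>x. x > 0 \<Longrightarrow> u x = c + d * x + (LINT y:{0..x}|lborel. (x - y) * g y)"
begin

definition u1 :: "real \<Rightarrow> real" where "u1 x = d + (LINT y:{0..x}|lborel. g y)"

lemma g_Icc: "set_integrable lborel {a..b} g"
  by (rule set_integrable_Icc[OF g])

lemma yg_Icc: "set_integrable lborel {0..b} (\<lambda>y. y * g y)"
  by (rule set_integrable_mult_bounded[OF g, where K=b]) auto

text \<open>Taking \<open>x\<close> out of the integral leaves integrands that do not depend on
  \<open>x\<close>, so that \<open>u\<close> can be differentiated by the product rule.\<close>

lemma u_expand:
  assumes "x > 0"
  shows "u x = c + d * x + x * (LINT y:{0..x}|lborel. g y) - (LINT y:{0..x}|lborel. y * g y)"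
proof -
  have "(LINT y:{0..x}|lborel. (x - y) * g y) = (LINT y:{0..x}|lborel. x * g y - y * g y)"
    by (simp add: algebra_simps)
  also have "\<dots> = (LINT y:{0..x}|lborel. x * g y) - (LINT y:{0..x}|lborel. y * g y)"
    by (rule set_integral_diff) (use yg_Icc g_Icc in \<open>auto intro: set_integrable_mult_right\<close>)
  finally show ?thesis using u[OF assms] by simp
qed

lemma G_cont: "continuous_on {0..} (\<lambda>x. LINT y:{0..x}|lborel. g y)"
  by (rule indefinite_LINT_continuous[OF g_Icc])

lemma H_cont: "continuous_on {0..} (\<lambda>x. LINT y:{0..x}|lborel. y * g y)"
  by (rule indefinite_LINT_continuous[OF yg_Icc])

lemma at_right_zero:
  fixes h :: "real \<Rightarrow> real"
  assumes "continuous_on {0..} h"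
  shows "(h \<longlongrightarrow> h 0) (at_right 0)"
proof -
  have "(h \<longlongrightarrow> h 0) (at 0 within {0..})" using assms by (simp add: continuous_on_def)
  then show ?thesis by (simp only: at_within_Ici_at_right)
qed

lemma LINT_zero: "(LINT y:{0}|lborel. h y) = (0 :: real)" for h :: "real \<Rightarrow> real"
proof -
  have "(\<lambda>y::real. indicator {0} y *\<^sub>R h y) = (\<lambda>y. indicator {0} y * h 0)"
    by (auto simp: indicator_def)
  then show ?thesis by (simp add: set_lebesgue_integral_def)
qed

lemma u_cont: "continuous_on {0<..} u"
proof -
  have "continuous_on {0<..} (\<lambda>x. c + d * x + x * (LINT y:{0..x}|lborel. g y) - (LINT y:{0..x}|lborel. y * g y))"
    by (intro continuous_intros continuous_on_subset[OF G_cont] continuous_on_subset[OF H_cont]) auto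
  then show ?thesis by (rule continuous_on_eq) (simp add: u_expand)
qed

lemma u_limit: "(u \<longlongrightarrow> c) (at_right 0)"
proof -
  have "((\<lambda>x. c + d * x + x * (LINT y:{0..x}|lborel. g y) - (LINT y:{0..x}|lborel. y * g y)) \<longlongrightarrow>
      c + d * 0 + 0 * (LINT y:{0..0}|lborel. g y) - (LINT y:{0..0}|lborel. y * g y)) (at_right 0)"
    by (intro tendsto_intros at_right_zero[OF G_cont] at_right_zero[OF H_cont])
  then have "((\<lambda>x. c + d * x + x * (LINT y:{0..x}|lborel. g y) - (LINT y:{0..x}|lborel. y * g y)) \<longlongrightarrow> c) (at_right 0)"
    by (simp add: LINT_zero)
  moreover have "eventually (\<lambda>x. c + d * x + x * (LINT y:{0..x}|lborel. g y) - (LINT y:{0..x}|lborel. y * g y) = u x) (at_right 0)"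
    using eventually_at_right_less[of "0::real"] by eventually_elim (simp add: u_expand)
  ultimately show ?thesis by (rule Lim_transform_eventually)
qed

lemma u1_limit: "(u1 \<longlongrightarrow> d) (at_right 0)"
proof -
  have "(u1 \<longlongrightarrow> d + (LINT y:{0..0}|lborel. g y)) (at_right 0)"
    unfolding u1_def by (intro tendsto_intros at_right_zero[OF G_cont])
  then show ?thesis by (simp add: LINT_zero)
qed

lemma u1_cont: "continuous_on {0<..} u1"
  unfolding u1_def by (intro continuous_intros continuous_on_subset[OF G_cont]) auto

lemma u1_deriv:
  assumes "continuous_on {0<..} g" "x > 0"
  shows "(u1 has_real_derivative g x) (at x)"
  unfolding u1_def
  using DERIV_add[OF DERIV_const indefinite_LINT_deriv[OF g_Icc assms(2,1)], of d] by simp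

lemma u_deriv:
  assumes "continuous_on {0<..} g" "x > 0"
  shows "(u has_real_derivative u1 x) (at x)"
proof -
  have G: "((\<lambda>x. LINT y:{0..x}|lborel. g y) has_real_derivative g x) (at x)"
    by (rule indefinite_LINT_deriv[OF g_Icc assms(2,1)])
  have H: "((\<lambda>x. LINT y:{0..x}|lborel. y * g y) has_real_derivative x * g x) (at x)"
    using assms by (intro indefinite_LINT_deriv[OF yg_Icc] continuous_intros) auto
  have "((\<lambda>x. c + d * x + x * (LINT y:{0..x}|lborel. g y) - (LINT y:{0..x}|lborel. y * g y)) has_real_derivative u1 x) (at x)"
    by (rule derivative_eq_intros G H refl)+ (simp add: u1_def algebra_simps)
  then show ?thesis
    by (rule has_field_derivative_transform_within_open[of _ _ _ "{0<..}"]) (use assms in \<open>auto simp: u_expand\<close>)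
qed

text \<open>By the mean value theorem \<open>u (x + 1) - u x\<close> is a value of \<open>u1\<close> on \<open>[x, x + 1]\<close>, where \<open>u1\<close>
  varies by at most the integral of \<open>\<bar>g\<bar>\<close>.\<close>

lemma u1_bound:
  assumes "continuous_on {0<..} g" "x > 0"
  shows "\<bar>u1 x\<bar> \<le> \<bar>u (x + 1)\<bar> + \<bar>u x\<bar> + (LINT y:{x..x + 1}|lborel. \<bar>g y\<bar>)"
proof -
  have "\<exists>z>x. z < x + 1 \<and> u (x + 1) - u x = (x + 1 - x) * u1 z"
    by (rule MVT2) (use assms u_deriv in auto)
  then obtain z where z: "x < z" "z < x + 1" "u (x + 1) - u x = u1 z" by auto
  have "(g has_integral u1 z - u1 x) {x..z}"
    using u1_deriv[OF assms(1)] assms(2) z by (intro fundamental_theorem_of_calculus)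
      (auto intro: has_field_derivative_at_within simp: has_real_derivative_iff_has_vector_derivative[symmetric])
  then have "u1 z - u1 x = (LINT y:{x..z}|lborel. g y)"
    using set_borel_integral_eq_integral(2)[OF g_Icc] by (simp add: integral_unique)
  then have "\<bar>u1 z - u1 x\<bar> \<le> (\<integral>y. \<bar>indicator {x..z} y * g y\<bar> \<partial>lborel)"
    using integral_abs_bound[of lborel "\<lambda>y. indicator {x..z} y * g y"]
    by (simp add: set_lebesgue_integral_def)
  also have "\<dots> \<le> (LINT y:{x..x + 1}|lborel. \<bar>g y\<bar>)"
    unfolding set_lebesgue_integral_def
  proof (rule integral_mono)
    show "integrable lborel (\<lambda>y. \<bar>indicator {x..z} y * g y\<bar>)"
      using g_Icc[of x z] by (intro integrable_abs) (simp add: set_integrable_def)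
    show "integrable lborel (\<lambda>y. indicator {x..x + 1} y *\<^sub>R \<bar>g y\<bar>)"
      by (rule integrable_mult_indicator) (use g in auto)
  qed (use z in \<open>auto simp: indicator_def\<close>)
  finally show ?thesis using z by linarith
qed

text \<open>Integrability of the first derivative is not part of the Laplace domain, but the
  corrector must lie in L1. It follows from \<open>u1_bound\<close>, whose terms are a translate of
  \<open>u\<close>, \<open>u\<close> itself and a window integral.\<close>

lemma u1_integrable:
  assumes "continuous_on {0<..} g" and ui: "integrable lborel (\<lambda>x. indicator {0<..} x * u x)"
  shows "integrable lborel (\<lambda>x. indicator {0<..} x * u1 x)"
proof (rule Bochner_Integration.integrable_bound)
  let ?v = "\<lambda>x. indicator {0<..} x * u x"
  show "integrable lborel (\<lambda>x. \<bar>?v (1 + x)\<bar> + \<bar>?v x\<bar> + (LINT y:{x..x + 1}|lborel. \<bar>g y\<bar>))"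
    using lborel_integrable_real_affine[OF ui, of 1 1]
    by (intro Bochner_Integration.integrable_add integrable_abs window_integrable[OF g] ui) auto
  have "(\<lambda>x. indicator {0<..} x *\<^sub>R u1 x) \<in> borel_measurable borel"
    by (rule borel_measurable_continuous_on_indicator[OF _ u1_cont]) auto
  then show "(\<lambda>x. indicator {0<..} x * u1 x) \<in> borel_measurable lborel" by simp
  show "AE x in lborel. norm (indicator {0<..} x * u1 x)
      \<le> norm (\<bar>?v (1 + x)\<bar> + \<bar>?v x\<bar> + (LINT y:{x..x + 1}|lborel. \<bar>g y\<bar>))"
  proof (rule AE_I2)
    fix x :: real
    have "0 \<le> (LINT y:{x..x + 1}|lborel. \<bar>g y\<bar>)"
      unfolding set_lebesgue_integral_def by (rule integral_nonneg_AE) auto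
    then show "norm (indicator {0<..} x * u1 x)
      \<le> norm (\<bar>?v (1 + x)\<bar> + \<bar>?v x\<bar> + (LINT y:{x..x + 1}|lborel. \<bar>g y\<bar>))"
      using u1_bound[OF assms(1), of x] by (auto simp: indicator_def add.commute)
  qed
qed

end


lemma LINT_reflect:
  fixes g :: "real \<Rightarrow> real"
  assumes "x < 0"
  shows "(LINT y:{x..0}|lborel. (x - y) * g y) = - (LINT y:{0..- x}|lborel. (- x - y) * g (- y))"
proof -
  have "(LINT y:{x..0}|lborel. (x - y) * g y) = (\<integral>y. indicator {x..0} (- y) *\<^sub>R ((x - (- y)) * g (- y)) \<partial>lborel)"
    unfolding set_lebesgue_integral_def
    using lborel_integral_real_affine[of "-1" "\<lambda>y. indicator {x..0} y *\<^sub>R ((x - y) * g y)" 0] by simp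
  also have "\<dots> = (\<integral>y. - (indicator {0..- x} y *\<^sub>R ((- x - y) * g (- y))) \<partial>lborel)"
    by (intro Bochner_Integration.integral_cong) (auto simp: indicator_def algebra_simps)
  also have "\<dots> = - (LINT y:{0..- x}|lborel. (- x - y) * g (- y))"
    by (simp add: set_lebesgue_integral_def)
  finally show ?thesis .
qed

lemma Laplace_op_potentials:
  assumes "(\<phi>, \<psi>) \<in> Laplace_op p q"
  obtains f g C D where "represents f \<phi>" "represents g \<psi>"
    "half_line_potential g f (p * C) D" "half_line_potential (\<lambda>y. g (- y)) (\<lambda>x. f (- x)) (q * C) (- D)"
proof -
  obtain f g C D where f: "represents f \<phi>" and g: "represents g \<psi>"
    and neg: "\<forall>x<0. f x = q * C + D * x - (LBINT y:{x..0}. (x - y) * g y)"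
    and pos: "\<forall>x>0. f x = p * C + D * x + (LBINT y:{0..x}. (x - y) * g y)"
    using assms unfolding Laplace_op_def by blast
  have int: "integrable lborel g"
    using represents_integrable[OF g] by (simp add: base_measure_real_def)
  show ?thesis
  proof (rule that[OF f g])
    show "half_line_potential g f (p * C) D"
      using int pos by unfold_locales auto
    show "half_line_potential (\<lambda>y. g (- y)) (\<lambda>x. f (- x)) (q * C) (- D)"
      using integrable_lborel_reflect[OF int] neg by unfold_locales (auto simp: LINT_reflect)
  qed
qed

text \<open>Two descriptions of the same class may use different representatives; this lets the one
  known to be continuous off 0 replace the other.\<close>

lemma half_line_potential_cong_AE:
  assumes "half_line_potential g u c d" "integrable lborel k" "AE x in lborel. g x = k x"
  shows "half_line_potential k u c d"
proof -
  interpret half_line_potential g u c d by (rule assms(1))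
  have [measurable]: "g \<in> borel_measurable lborel" "k \<in> borel_measurable lborel"
    by (rule borel_measurable_integrable, use g assms(2) in blast)+
  have "(LINT y:{0..x}|lborel. (x - y) * g y) = (LINT y:{0..x}|lborel. (x - y) * k y)" for x
    unfolding set_lebesgue_integral_def
    by (rule integral_cong_AE) (use assms(3) in \<open>auto elim: eventually_mono\<close>)
  then show ?thesis
    using u assms(2) by unfold_locales auto
qed

lemma AE_lborel_reflect_eq:
  fixes g k :: "real \<Rightarrow> real"
  assumes "integrable lborel g" "integrable lborel k" "AE x in lborel. g x = k x"
  shows "AE x in lborel. g (- x) = k (- x)"
proof -
  have [measurable]: "g \<in> borel_measurable borel" "k \<in> borel_measurable borel"
    using borel_measurable_integrable[OF assms(1)] borel_measurable_integrable[OF assms(2)] by simp_all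
  have "Measurable.pred borel (\<lambda>x. g x = k x)" by measurable
  from AE_borel_affine[OF _ this assms(3), of "-1" 0] show ?thesis by simp
qed

text \<open>The second pair shows that \<open>\<psi>\<close> has a representative \<open>k\<close>
  that is a potential itself, hence continuous off 0. With \<open>k\<close> as the density, the
  potential formula for \<open>\<phi>\<close> can be differentiated twice at every point other than
  0.\<close>

theorem Laplace_op_regularity:
  assumes "(\<phi>, \<psi>) \<in> Laplace_op p q" "(\<psi>, \<zeta>) \<in> Laplace_op p q"
  obtains f f1 k C D where "represents f \<phi>" "represents k \<psi>" "integrable lborel f1"
    "\<And>x. x \<noteq> 0 \<Longrightarrow> (f has_real_derivative f1 x) (at x)"
    "\<And>x. x \<noteq> 0 \<Longrightarrow> (f1 has_real_derivative k x) (at x)"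
    "(f \<longlongrightarrow> q * C) (at_left 0)" "(f \<longlongrightarrow> p * C) (at_right 0)"
    "(f1 \<longlongrightarrow> D) (at_left 0)" "(f1 \<longlongrightarrow> D) (at_right 0)"
proof -
  obtain f g C D where f: "represents f \<phi>" and g: "represents g \<psi>"
    and pos0: "half_line_potential g f (p * C) D"
    and neg0: "half_line_potential (\<lambda>y. g (- y)) (\<lambda>x. f (- x)) (q * C) (- D)"
    by (rule Laplace_op_potentials[OF assms(1)])
  obtain k h C' D' where k: "represents k \<psi>"
    and kpos: "half_line_potential h k (p * C') D'"
    and kneg: "half_line_potential (\<lambda>y. h (- y)) (\<lambda>x. k (- x)) (q * C') (- D')"
    by (rule Laplace_op_potentials[OF assms(2)])
  have kint: "integrable lborel k" and fint: "integrable lborel f"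
    using represents_integrable[OF k] represents_integrable[OF f] by (simp_all add: base_measure_real_def)
  have ae: "AE x in lborel. g x = k x"
    using represents_AE[OF g k] unfolding base_measure_real_def .
  have gint: "integrable lborel g" by (rule half_line_potential.g[OF pos0])
  interpret P: half_line_potential k f "p * C" D
    by (rule half_line_potential_cong_AE[OF pos0 kint ae])
  interpret N: half_line_potential "\<lambda>y. k (- y)" "\<lambda>x. f (- x)" "q * C" "- D"
    by (rule half_line_potential_cong_AE[OF neg0 integrable_lborel_reflect[OF kint] AE_lborel_reflect_eq[OF gint kint ae]])
  have kc: "continuous_on {0<..} k" "continuous_on {0<..} (\<lambda>x. k (- x))"
    by (rule half_line_potential.u_cont[OF kpos], rule half_line_potential.u_cont[OF kneg])
  \<comment> \<open>The value 0 at 0 makes \<open>f1\<close> equal everywhere to the difference of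
    the two pieces cut off by indicators, from which its integrability is read off.\<close>
  define f1 where "f1 x = (if x > 0 then P.u1 x else if x < 0 then - N.u1 (- x) else 0)" for x
  show ?thesis
  proof (rule that[OF f k])
    show "(f has_real_derivative f1 x) (at x)" if "x \<noteq> 0" for x
    proof (cases "x > 0")
      case True
      then show ?thesis using P.u_deriv[OF kc(1) True] by (simp add: f1_def)
    next
      case False
      then have x: "- x > 0" using that by simp
      have "((\<lambda>x. (\<lambda>x. f (- x)) (- x)) has_real_derivative N.u1 (- x) * (- 1)) (at x)"
        by (rule DERIV_chain2[where f="\<lambda>x. f (- x)" and g=uminus, OF N.u_deriv[OF kc(2) x]]) (auto intro!: derivative_eq_intros)
      then show ?thesis using x by (simp add: f1_def)
    qed
    show "(f1 has_real_derivative k x) (at x)" if "x \<noteq> 0" for x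
    proof (cases "x > 0")
      case True
      show ?thesis
        by (rule has_field_derivative_transform_within_open[OF P.u1_deriv[OF kc(1) True], of "{0<..}"])
          (use True in \<open>auto simp: f1_def\<close>)
    next
      case False
      then have x: "- x > 0" using that by simp
      have "((\<lambda>x. - N.u1 (- x)) has_real_derivative - (k (- (- x)) * (- 1))) (at x)"
        by (intro DERIV_minus DERIV_chain2[where f=N.u1 and g=uminus, OF N.u1_deriv[OF kc(2) x]]) (auto intro!: derivative_eq_intros)
      then have "((\<lambda>x. - N.u1 (- x)) has_real_derivative k x) (at x)" by simp
      then show ?thesis
        by (rule has_field_derivative_transform_within_open[of _ _ _ "{..<0}"])
          (use x in \<open>auto simp: f1_def\<close>)
    qed
    show "(f \<longlongrightarrow> p * C) (at_right 0)" by (rule P.u_limit)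
    show "(f \<longlongrightarrow> q * C) (at_left 0)"
      using N.u_limit by (simp add: at_left_minus filterlim_filtermap)
    have "eventually (\<lambda>x. P.u1 x = f1 x) (at_right 0)"
      using eventually_at_right_less[of "0::real"] by eventually_elim (simp add: f1_def)
    with P.u1_limit show "(f1 \<longlongrightarrow> D) (at_right 0)" by (rule Lim_transform_eventually)
    have "eventually (\<lambda>x. - N.u1 x = f1 (- x)) (at_right 0)"
      using eventually_at_right_less[of "0::real"] by eventually_elim (simp add: f1_def)
    moreover have "((\<lambda>x. - N.u1 x) \<longlongrightarrow> D) (at_right 0)"
      using tendsto_minus[OF N.u1_limit] by simp
    ultimately have "((\<lambda>x. f1 (- x)) \<longlongrightarrow> D) (at_right 0)" by (rule Lim_transform_eventually[rotated])
    then show "(f1 \<longlongrightarrow> D) (at_left 0)"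
      by (simp add: at_left_minus filterlim_filtermap)
    have "integrable lborel (\<lambda>x. indicator {0<..} x * f x)" "integrable lborel (\<lambda>x. indicator {0<..} x * f (- x))"
      by (intro integrable_indicator_mult fint integrable_lborel_reflect; simp)+
    then have P1: "integrable lborel (\<lambda>x. indicator {0<..} x * P.u1 x)"
      and N1: "integrable lborel (\<lambda>x. indicator {0<..} x * N.u1 x)"
      by (auto intro: P.u1_integrable N.u1_integrable kc)
    have "integrable lborel (\<lambda>x. indicator {0<..} x * P.u1 x - indicator {0<..} (- x) * N.u1 (- x))"
      by (intro Bochner_Integration.integrable_diff P1 integrable_lborel_reflect[OF N1])
    moreover have "(\<lambda>x. indicator {0<..} x * P.u1 x - indicator {0<..} (- x) * N.u1 (- x)) = f1"
      by (auto simp: fun_eq_iff f1_def indicator_def)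
    ultimately show "integrable lborel f1" by simp
  qed
qed

section \<open>Approximants\<close>

definition jump :: "real \<Rightarrow> real \<Rightarrow> real \<Rightarrow> real" where
  "jump \<alpha> \<beta> x = (if x > 0 then \<alpha> else \<beta>)"

lemma jump_mult_deriv:
  assumes "x \<noteq> 0" "(b has_real_derivative b') (at x)"
  shows "((\<lambda>x. jump \<alpha> \<beta> x * b x) has_real_derivative jump \<alpha> \<beta> x * b') (at x)"
proof (cases "x > 0")
  case True
  have "((\<lambda>x. \<alpha> * b x) has_real_derivative \<alpha> * b') (at x)"
    using assms(2) by (rule DERIV_cmult)
  then have "((\<lambda>x. jump \<alpha> \<beta> x * b x) has_real_derivative \<alpha> * b') (at x)"
    by (rule has_field_derivative_transform_within_open[of _ _ _ "{0<..}"]) (use True in \<open>auto simp: jump_def\<close>)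
  then show ?thesis using True by (simp add: jump_def)
next
  case False
  have "((\<lambda>x. \<beta> * b x) has_real_derivative \<beta> * b') (at x)"
    using assms(2) by (rule DERIV_cmult)
  then have "((\<lambda>x. jump \<alpha> \<beta> x * b x) has_real_derivative \<beta> * b') (at x)"
    by (rule has_field_derivative_transform_within_open[of _ _ _ "{..<0}"])
      (use False assms(1) in \<open>auto simp: jump_def\<close>)
  then show ?thesis using False by (simp add: jump_def)
qed

lemma jump_mult_integrable:
  assumes "integrable lborel b"
  shows "integrable lborel (\<lambda>x. jump \<alpha> \<beta> x * b x)"
proof (rule Bochner_Integration.integrable_bound)
  show "integrable lborel (\<lambda>x. (\<bar>\<alpha>\<bar> + \<bar>\<beta>\<bar>) * b x)" using assms by simp
  have [measurable]: "b \<in> borel_measurable borel" using borel_measurable_integrable[OF assms] by simp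
  show "(\<lambda>x. jump \<alpha> \<beta> x * b x) \<in> borel_measurable lborel"
    unfolding jump_def by measurable
  show "AE x in lborel. norm (jump \<alpha> \<beta> x * b x) \<le> norm ((\<bar>\<alpha>\<bar> + \<bar>\<beta>\<bar>) * b x)"
    by (rule AE_I2) (auto simp: jump_def abs_mult intro!: mult_right_mono)
qed

lemma jump_mult_tendsto:
  assumes "isCont b 0"
  shows "((\<lambda>x. jump \<alpha> \<beta> x * b x) \<longlongrightarrow> \<beta> * b 0) (at_left 0)"
    "((\<lambda>x. jump \<alpha> \<beta> x * b x) \<longlongrightarrow> \<alpha> * b 0) (at_right 0)"
proof -
  have b: "(b \<longlongrightarrow> b 0) (at_left 0)" "(b \<longlongrightarrow> b 0) (at_right 0)"
    using assms by (auto simp: isCont_def filterlim_at_split)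
  have "eventually (\<lambda>x. \<beta> * b x = jump \<alpha> \<beta> x * b x) (at_left 0)"
    unfolding eventually_at_left_field by (rule exI[of _ "-1"]) (auto simp: jump_def)
  with tendsto_mult_left[OF b(1), of \<beta>]
  show "((\<lambda>x. jump \<alpha> \<beta> x * b x) \<longlongrightarrow> \<beta> * b 0) (at_left 0)" by (rule Lim_transform_eventually)
  have "eventually (\<lambda>x. \<alpha> * b x = jump \<alpha> \<beta> x * b x) (at_right 0)"
    using eventually_at_right_less[of "0::real"] by eventually_elim (simp add: jump_def)
  with tendsto_mult_left[OF b(2), of \<alpha>]
  show "((\<lambda>x. jump \<alpha> \<beta> x * b x) \<longlongrightarrow> \<alpha> * b 0) (at_right 0)" by (rule Lim_transform_eventually)
qed

lemma bump_isCont: "isCont bump x" "isCont bump' x" "isCont bump'' x"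
  using bump_continuous by (auto simp: continuous_on_eq_continuous_at)

lemma represents_J:
  assumes "represents f \<phi>" shows "represents (\<lambda>(x, i). f x / 2) (J \<phi>)"
  using assms
proof transfer
  fix f g :: "real \<Rightarrow> real"
  assume "L1_eq g g" "integrable base_measure f \<and> (AE x in base_measure. f x = g x)"
  then have "L1_eq f g" by (auto simp: L1_eq_def)
  then have "L1_eq (\<lambda>(x, i :: direction). f x / 2) (\<lambda>(x, i). g x / 2)"
    using J.rsp by (simp add: rel_fun_def)
  then show "integrable base_measure (\<lambda>(x, i :: direction). f x / 2) \<and>
      (AE z in base_measure. (case z of (x, i :: direction) \<Rightarrow> f x / 2) = (case z of (x, i) \<Rightarrow> g x / 2))"
    by (auto simp: L1_eq_def)
qed

lemma represents_B:
  assumes "represents f \<phi>" shows "represents (\<lambda>(x, i). f (x, opposite i)) (B_op \<phi>)"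
  using assms
proof transfer
  fix f g :: "S \<Rightarrow> real"
  assume "L1_eq g g" "integrable base_measure f \<and> (AE x in base_measure. f x = g x)"
  then have "L1_eq f g" by (auto simp: L1_eq_def)
  then have "L1_eq (\<lambda>(x, i). f (x, opposite i)) (\<lambda>(x, i). g (x, opposite i))"
    using B_op.rsp by (simp add: rel_fun_def)
  then show "integrable base_measure (\<lambda>(x, i). f (x, opposite i)) \<and>
      (AE z in base_measure. (case z of (x, i) \<Rightarrow> f (x, opposite i)) = (case z of (x, i) \<Rightarrow> g (x, opposite i)))"
    by (auto simp: L1_eq_def)
qed

lemma sgn_of_opposite [simp]: "sgn_of (opposite i) = - sgn_of i" by (cases i) simp_all

text \<open>For \<open>i = \<plusminus>1\<close> the function \<open>f / 2 - \<epsilon> i f' / 4\<close> makes the terms of order \<open>1 / \<epsilon>\<close> cancel, but it violates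
  the transmission conditions by a multiple of \<open>\<epsilon> f' 0\<close>. A function \<open>\<epsilon> \<beta>\<close> independent of \<open>i\<close>, jumping at 0
  with one-sided derivatives 0 there, repairs them, and it costs only \<open>O(\<epsilon>)\<close> once its own
  corrector \<open>- \<epsilon>\<^sup>2 i \<beta>' / 2\<close> is added.\<close>

theorem diffusive_approximants:
  assumes pq: "p + p' = 1" "q + q' = 1" "p + q > 0"
    and L: "(\<phi>, \<psi>) \<in> Laplace_op p q" "(\<psi>, \<zeta>) \<in> Laplace_op p q"
  shows "\<exists>c1 c2 c3. \<forall>\<epsilon>>0. (J \<phi> + \<epsilon> *\<^sub>R c1 + \<epsilon>\<^sup>2 *\<^sub>R c2, (1 / 2) *\<^sub>R J \<psi> + \<epsilon> *\<^sub>R c3) \<in> G_op p p' q q' \<epsilon>"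
proof -
  obtain f f1 k C D where f: "represents f \<phi>" and k: "represents k \<psi>" and f1: "integrable lborel f1"
    and df: "\<And>x. x \<noteq> 0 \<Longrightarrow> (f has_real_derivative f1 x) (at x)"
    and df1: "\<And>x. x \<noteq> 0 \<Longrightarrow> (f1 has_real_derivative k x) (at x)"
    and lim: "(f \<longlongrightarrow> q * C) (at_left 0)" "(f \<longlongrightarrow> p * C) (at_right 0)"
    "(f1 \<longlongrightarrow> D) (at_left 0)" "(f1 \<longlongrightarrow> D) (at_right 0)"
    by (rule Laplace_op_regularity[OF L]) (rule that)
  have fint: "integrable lborel f" and kint: "integrable lborel k"
    using represents_integrable[OF f] represents_integrable[OF k] by (simp_all add: base_measure_real_def)
  \<comment> \<open>At order \<open>\<epsilon>\<close> the one-sided limits are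
    \<open>- sgn_of i * D / 4\<close> plus \<open>m\<close> on the right and minus \<open>m\<close>
    on the left. Both transmission conditions then reduce to
    \<open>m * (p + q) = D / 4 * (p' + q')\<close>.\<close>
  define m where "m = (D / 4 * (p' + q')) / (p + q)"
  have m: "m * (p + q) = D / 4 * (p' + q')" using m_def pq(3) unfolding eq_divide_eq[of m] by simp
  define j where "j = jump m (- m)"
  define v where "v = (\<lambda>(x, i). - sgn_of i * f1 x / 4 + j x * bump x)"
  define w where "w = (\<lambda>(x, i). - sgn_of i * (j x * bump' x) / 2)"
  \<comment> \<open>This is the image under the transport operator of the last corrector
    \<open>w\<close>, the only contribution that nothing cancels.\<close>
  define e3 where "e3 = (\<lambda>(x, i :: direction). j x * bump'' x / 2)"
  have jb: "integrable lborel (\<lambda>x. j x * bump x)" "integrable lborel (\<lambda>x. j x * bump' x)"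
    "integrable lborel (\<lambda>x. j x * bump'' x)"
    unfolding j_def by (intro jump_mult_integrable bump_integrable)+
  have vw: "integrable base_measure v" "integrable base_measure w" "integrable base_measure e3"
    unfolding integrable_S_iff(1) v_def w_def e3_def using f1 jb by auto
  obtain c1 c2 c3 where c: "represents v c1" "represents w c2" "represents e3 c3"
    using integrable_represents[OF vw(1)] integrable_represents[OF vw(2)] integrable_represents[OF vw(3)] by blast
  have "(J \<phi> + \<epsilon> *\<^sub>R c1 + \<epsilon>\<^sup>2 *\<^sub>R c2, (1 / 2) *\<^sub>R J \<psi> + \<epsilon> *\<^sub>R c3) \<in> G_op p p' q q' \<epsilon>" if \<epsilon>: "\<epsilon> > 0" for \<epsilon>
  proof -
    let ?\<Phi> = "J \<phi> + \<epsilon> *\<^sub>R c1 + \<epsilon>\<^sup>2 *\<^sub>R c2"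
    define F where "F = (\<lambda>(x, i). f x / 2 + \<epsilon> * v (x, i) + \<epsilon>\<^sup>2 * w (x, i))"
    define F' where "F' = (\<lambda>(x, i). f1 x / 2 + \<epsilon> * (- sgn_of i * k x / 4 + j x * bump' x)
      + \<epsilon>\<^sup>2 * (- sgn_of i * (j x * bump'' x) / 2))"
    have rep: "represents F ?\<Phi>"
    proof -
      have "represents (\<lambda>z. (case z of (x, i) \<Rightarrow> f x / 2) + \<epsilon> * v z + \<epsilon>\<^sup>2 * w z) ?\<Phi>"
        by (intro represents_add represents_scaleR represents_J f c)
      then show ?thesis by (simp add: F_def case_prod_unfold)
    qed
    have F'int: "integrable lborel (\<lambda>x. F' (x, i))" for i
      unfolding F'_def using f1 kint jb by auto
    then have "integrable base_measure (\<lambda>(x, i). - sgn_of i * F' (x, i))"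
      unfolding integrable_S_iff(1) by auto
    then obtain \<Psi> where \<Psi>: "represents (\<lambda>(x, i). - sgn_of i * F' (x, i)) \<Psi>"
      using integrable_represents by blast
    have A: "(?\<Phi>, \<Psi>) \<in> A_op p p' q q'"
    proof (rule A_op_intro_C1[OF rep \<Psi> _ F'int])
      fix x :: real and i assume x: "x \<noteq> 0"
      have d: "((\<lambda>x. j x * bump x) has_real_derivative j x * bump' x) (at x)"
        "((\<lambda>x. j x * bump' x) has_real_derivative j x * bump'' x) (at x)"
        unfolding j_def by (rule jump_mult_deriv[OF x bump_deriv], rule jump_mult_deriv[OF x bump'_deriv])
      have 0: "((\<lambda>x. f x / 2) has_real_derivative f1 x / 2) (at x)"
        by (rule DERIV_cdivide[OF df[OF x]])
      have 1: "((\<lambda>x. - sgn_of i * f1 x / 4 + j x * bump x) has_real_derivative - sgn_of i * k x / 4 + j x * bump' x) (at x)"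
        by (intro DERIV_add DERIV_cdivide DERIV_cmult df1[OF x] d)
      have 2: "((\<lambda>x. - sgn_of i * (j x * bump' x) / 2) has_real_derivative - sgn_of i * (j x * bump'' x) / 2) (at x)"
        by (intro DERIV_cdivide DERIV_cmult d)
      show "((\<lambda>y. F (y, i)) has_real_derivative F' (x, i)) (at x)"
        unfolding F_def F'_def v_def w_def prod.case
        by (intro DERIV_add 0 DERIV_cmult 1 2)
    next
      fix i
      have t: "((\<lambda>x. j x * bump x) \<longlongrightarrow> - m) (at_left 0)" "((\<lambda>x. j x * bump x) \<longlongrightarrow> m) (at_right 0)"
        "((\<lambda>x. j x * bump' x) \<longlongrightarrow> 0) (at_left 0)" "((\<lambda>x. j x * bump' x) \<longlongrightarrow> 0) (at_right 0)"
        using jump_mult_tendsto[OF bump_isCont(1), of m "- m"] jump_mult_tendsto[OF bump_isCont(2), of m "- m"]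
        by (simp_all add: j_def)
      show "((\<lambda>x. F (x, i)) \<longlongrightarrow> (\<lambda>i. q * C / 2 + \<epsilon> * (- sgn_of i * D / 4 + - m) + \<epsilon>\<^sup>2 * (- sgn_of i * 0 / 2)) i) (at_left 0)"
        unfolding F_def v_def w_def prod.case by (intro tendsto_intros lim t) auto
      show "((\<lambda>x. F (x, i)) \<longlongrightarrow> (\<lambda>i. p * C / 2 + \<epsilon> * (- sgn_of i * D / 4 + m) + \<epsilon>\<^sup>2 * (- sgn_of i * 0 / 2)) i) (at_right 0)"
        unfolding F_def v_def w_def prod.case by (intro tendsto_intros lim t) auto
    next
      have p': "p' = 1 - p" "q' = 1 - q" using pq by auto
      have mm: "m * p + m * q = D / 4 * (2 - p - q)" using m by (simp add: p' algebra_simps)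
      \<comment> \<open>The terms of order 0 cancel because \<open>q + q' = 1\<close>, and those of
        order \<open>\<epsilon>\<close> by the choice of \<open>m\<close>; in the second condition
        the latter appear with the opposite sign.\<close>
      have "p * C / 2 + \<epsilon> * (- D / 4 + m) - (p * (q * C / 2 + \<epsilon> * (- D / 4 - m)) + q' * (p * C / 2 + \<epsilon> * (D / 4 + m)))
        = \<epsilon> * (m * p + m * q - D / 4 * (2 - p - q))"
        by (simp add: p' field_simps)
      also have "\<dots> = 0" unfolding mm by simp
      finally show "p * C / 2 + \<epsilon> * (- sgn_of Pos * D / 4 + m) + \<epsilon>\<^sup>2 * (- sgn_of Pos * 0 / 2) =
          p * (q * C / 2 + \<epsilon> * (- sgn_of Pos * D / 4 + - m) + \<epsilon>\<^sup>2 * (- sgn_of Pos * 0 / 2)) +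
          q' * (p * C / 2 + \<epsilon> * (- sgn_of Neg * D / 4 + m) + \<epsilon>\<^sup>2 * (- sgn_of Neg * 0 / 2))"
        by (simp add: field_simps)
      have "q * C / 2 + \<epsilon> * (D / 4 - m) - (p' * (q * C / 2 + \<epsilon> * (- D / 4 - m)) + q * (p * C / 2 + \<epsilon> * (D / 4 + m)))
        = - \<epsilon> * (m * p + m * q - D / 4 * (2 - p - q))"
        by (simp add: p' field_simps)
      also have "\<dots> = 0" unfolding mm by simp
      finally show "q * C / 2 + \<epsilon> * (- sgn_of Neg * D / 4 + - m) + \<epsilon>\<^sup>2 * (- sgn_of Neg * 0 / 2) =
          p' * (q * C / 2 + \<epsilon> * (- sgn_of Pos * D / 4 + - m) + \<epsilon>\<^sup>2 * (- sgn_of Pos * 0 / 2)) +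
          q * (p * C / 2 + \<epsilon> * (- sgn_of Neg * D / 4 + m) + \<epsilon>\<^sup>2 * (- sgn_of Neg * 0 / 2))"
        by (simp add: field_simps)
    qed
    have lhs: "represents (\<lambda>z. 1 / 2 * (case z of (x, i) \<Rightarrow> k x / 2) + \<epsilon> * e3 z) ((1 / 2) *\<^sub>R J \<psi> + \<epsilon> *\<^sub>R c3)"
      by (intro represents_add represents_scaleR represents_J k c)
    have rhs: "represents (\<lambda>z. (1 / \<epsilon>) * (case z of (x, i) \<Rightarrow> - sgn_of i * F' (x, i))
        + (1 / \<epsilon>\<^sup>2) * ((case z of (x, i) \<Rightarrow> F (x, opposite i)) - F z))
        ((1 / \<epsilon>) *\<^sub>R \<Psi> + (1 / \<epsilon>\<^sup>2) *\<^sub>R (B_op ?\<Phi> - ?\<Phi>))"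
      by (intro represents_add represents_scaleR represents_diff represents_B rep \<Psi>)
    \<comment> \<open>On a function odd in the direction, B - I is multiplication by -2. This
      cancels the transport of \<open>f / 2\<close> at order \<open>1 / \<epsilon>\<close> and that
      of \<open>j * bump\<close> at order 0; what remains at order 0 is \<open>k / 4\<close>, half
      of \<open>k / 2\<close>.\<close>
    have "(1 / \<epsilon>) * (- sgn_of i * F' (x, i)) + (1 / \<epsilon>\<^sup>2) * (F (x, opposite i) - F (x, i))
        = 1 / 2 * (k x / 2) + \<epsilon> * e3 (x, i)" for x i
      using \<epsilon> by (cases i) (simp_all add: F_def F'_def v_def w_def e3_def field_simps power2_eq_square)
    then have "(\<lambda>z. (1 / \<epsilon>) * (case z of (x, i) \<Rightarrow> - sgn_of i * F' (x, i))
        + (1 / \<epsilon>\<^sup>2) * ((case z of (x, i) \<Rightarrow> F (x, opposite i)) - F z))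
      = (\<lambda>z. 1 / 2 * (case z of (x, i) \<Rightarrow> k x / 2) + \<epsilon> * e3 z)"
      by (auto simp: fun_eq_iff)
    with rhs have "represents (\<lambda>z. 1 / 2 * (case z of (x, i) \<Rightarrow> k x / 2) + \<epsilon> * e3 z)
        ((1 / \<epsilon>) *\<^sub>R \<Psi> + (1 / \<epsilon>\<^sup>2) *\<^sub>R (B_op ?\<Phi> - ?\<Phi>))" by simp
    from represents_unique[OF lhs this] A show ?thesis
      unfolding G_op_def by blast
  qed
  then show ?thesis by blast
qed

text \<open>Subtracting the boundary values of the odd part, cut off at scale \<open>\<delta>\<close>, makes all one-sided limits
  vanish, so that the transmission conditions hold trivially.\<close>

lemma odd_approximation:
  assumes A: "(\<phi>, \<psi>) \<in> A_op p p' q q'" and e: "e > 0"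
  shows "\<exists>z \<zeta>. (z, \<zeta>) \<in> A_op p p' q q' \<and> B_op z = - z \<and> norm (z - (\<phi> - P_op \<phi>)) < e"
proof -
  obtain f f' l r where rep: "represents f \<phi>" "represents (\<lambda>(x, i). - sgn_of i * f' (x, i)) \<psi>"
    and ac: "\<And>i. abs_continuous_on {0<..} (\<lambda>x. f (x, i))" "\<And>i. abs_continuous_on {..<0} (\<lambda>x. f (x, i))"
    and deriv: "\<And>i. AE x in lborel. ((\<lambda>y. f (y, i)) has_real_derivative f' (x, i)) (at x)"
    and lim: "\<And>i. ((\<lambda>x. f (x, i)) \<longlongrightarrow> l i) (at_left 0)" "\<And>i. ((\<lambda>x. f (x, i)) \<longlongrightarrow> r i) (at_right 0)"
    using A unfolding A_op_def by blast
  have fint: "integrable lborel (\<lambda>x. f (x, i))" for i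
    using represents_integrable[OF rep(1)] integrable_S_iff(1) by blast
  have sf': "integrable lborel (\<lambda>x. - sgn_of i * f' (x, i))" for i
    using represents_integrable[OF rep(2)] integrable_S_iff(1) by fastforce
  have f'int: "integrable lborel (\<lambda>x. f' (x, i))" for i
    using sf'[of i] by (cases i) auto
  \<comment> \<open>\<open>\<alpha>\<close> and \<open>\<beta>\<close> are the right and left limits
    at 0 of the odd part of \<open>f\<close> in the positive direction.\<close>
  define \<alpha> where "\<alpha> = (r Pos - r Neg) / 2"
  define \<beta> where "\<beta> = (l Pos - l Neg) / 2"
  \<comment> \<open>The subtracted function lives on both copies of the line, and rescaling the
    cutoff multiplies its integral by \<open>\<delta>\<close>; thus its norm is at most
    \<open>K * \<delta>\<close>.\<close>
  define K where "K = 2 * (\<bar>\<alpha>\<bar> + \<bar>\<beta>\<bar>) * (\<integral>x. \<bar>bump x\<bar> \<partial>lborel)"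
  have K: "K \<ge> 0" by (simp add: K_def)
  define \<delta> where "\<delta> = e / (K + 1)"
  have \<delta>: "\<delta> > 0" and K\<delta>: "K * \<delta> < e"
    using e K by (auto simp: \<delta>_def field_simps add_nonneg_pos)
  define g where "g x = bump (x / \<delta>)" for x
  define g' where "g' x = bump' (x / \<delta>) / \<delta>" for x
  have dg: "(g has_real_derivative g' x) (at x)" for x
  proof -
    have "((\<lambda>x. bump (x / \<delta>)) has_real_derivative bump' (x / \<delta>) * (1 / \<delta>)) (at x)"
      using DERIV_cdivide[OF DERIV_ident, of \<delta>] by (intro DERIV_chain2[where f=bump and g="\<lambda>x. x / \<delta>"] bump_deriv)
    then show ?thesis unfolding g_def g'_def by simp
  qed
  have gint: "integrable lborel g" "integrable lborel g'"
    unfolding g_def g'_def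
    using \<delta> lborel_integrable_real_affine[OF bump_integrable(1), of "1 / \<delta>" 0]
      lborel_integrable_real_affine[OF bump_integrable(2), of "1 / \<delta>" 0] by simp_all
  have g0: "isCont g 0" "g 0 = 1" using dg DERIV_isCont by (auto simp: g_def)
  define b where "b x = jump \<alpha> \<beta> x * g x" for x
  define b' where "b' x = jump \<alpha> \<beta> x * g' x" for x
  have bint: "integrable lborel b" "integrable lborel b'"
    unfolding b_def b'_def by (intro jump_mult_integrable gint)+
  have db: "(b has_real_derivative b' x) (at x)" if "x \<noteq> 0" for x
    unfolding b_def b'_def by (rule jump_mult_deriv[OF that dg])
  have acb: "abs_continuous_on {0<..} b" "abs_continuous_on {..<0} b"
    by (rule abs_continuous_on_integrable_deriv[OF _ db bint(2)]; simp add: is_interval_1)+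
  \<comment> \<open>The common profile of the odd function \<open>sgn_of i * h x\<close>, written as
    a sum of scalar multiples so that the closure lemmas for sums and multiples apply
    directly.\<close>
  define h where "h x = 1 / 2 * f (x, Pos) + (- 1 / 2) * f (x, Neg) + (- 1) * b x" for x
  define h' where "h' x = 1 / 2 * f' (x, Pos) + (- 1 / 2) * f' (x, Neg) + (- 1) * b' x" for x
  have hint: "integrable lborel h" "integrable lborel h'"
    unfolding h_def h'_def using fint f'int bint by auto
  have ach: "abs_continuous_on {0<..} h" "abs_continuous_on {..<0} h"
    unfolding h_def by (intro abs_continuous_on_add abs_continuous_on_scale ac acb)+
  have dh: "AE x in lborel. (h has_real_derivative h' x) (at x)"
    using deriv[of Pos] deriv[of Neg] AE_lborel_singleton[of "0::real"]
  proof eventually_elim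
    case (elim x)
    show ?case unfolding h_def h'_def
      by (intro DERIV_add DERIV_cmult elim db)
  qed
  have limh: "(h \<longlongrightarrow> 0) (at_left 0)" "(h \<longlongrightarrow> 0) (at_right 0)"
  proof -
    have bl: "(b \<longlongrightarrow> \<beta> * g 0) (at_left 0)" "(b \<longlongrightarrow> \<alpha> * g 0) (at_right 0)"
      unfolding b_def by (rule jump_mult_tendsto[OF g0(1)])+
    have "(h \<longlongrightarrow> 1 / 2 * l Pos + (- 1 / 2) * l Neg + (- 1) * (\<beta> * g 0)) (at_left 0)"
      "(h \<longlongrightarrow> 1 / 2 * r Pos + (- 1 / 2) * r Neg + (- 1) * (\<alpha> * g 0)) (at_right 0)"
      unfolding h_def by (rule tendsto_intros lim bl)+
    then show "(h \<longlongrightarrow> 0) (at_left 0)" "(h \<longlongrightarrow> 0) (at_right 0)"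
      by (simp_all add: \<alpha>_def \<beta>_def g0 field_simps)
  qed
  define F where "F = (\<lambda>(x, i). sgn_of i * h x)"
  define F' where "F' = (\<lambda>(x, i). sgn_of i * h' x)"
  have FF': "integrable base_measure F" "integrable base_measure (\<lambda>(x, i). - sgn_of i * F' (x, i))"
    unfolding integrable_S_iff(1) F_def F'_def using hint by auto
  obtain z \<zeta> where z: "represents F z" and \<zeta>: "represents (\<lambda>(x, i). - sgn_of i * F' (x, i)) \<zeta>"
    using integrable_represents[OF FF'(1)] integrable_represents[OF FF'(2)] by blast
  have "(z, \<zeta>) \<in> A_op p p' q q'"
    unfolding A_op_def
  proof (intro CollectI case_prodI exI conjI allI)
    show "represents F z" "represents (\<lambda>(x, i). - sgn_of i * F' (x, i)) \<zeta>" by fact+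
    fix i
    show "abs_continuous_on {0<..} (\<lambda>x. F (x, i))" "abs_continuous_on {..<0} (\<lambda>x. F (x, i))"
      unfolding F_def prod.case by (intro abs_continuous_on_scale ach)+
    show "AE x in lborel. ((\<lambda>y. F (y, i)) has_real_derivative F' (x, i)) (at x)"
      using dh by eventually_elim (auto simp: F_def F'_def intro: DERIV_cmult)
    show "((\<lambda>x. F (x, i)) \<longlongrightarrow> (\<lambda>_. 0) i) (at_left 0)" "((\<lambda>x. F (x, i)) \<longlongrightarrow> (\<lambda>_. 0) i) (at_right 0)"
      unfolding F_def prod.case using tendsto_mult_left[OF limh(1)] tendsto_mult_left[OF limh(2)] by simp_all
  qed simp_all
  moreover have "B_op z = - z"
  proof (rule represents_unique[OF represents_B[OF z]])
    have "represents (\<lambda>z. 0 - F z) (0 - z)" by (intro represents_diff represents_zero z)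
    then show "represents (\<lambda>(x, i). F (x, opposite i)) (- z)"
      by (simp add: F_def case_prod_unfold)
  qed
  moreover have "norm (z - (\<phi> - P_op \<phi>)) < e"
  proof -
    let ?h = "\<lambda>z. F z - (f z - 1 / 2 * ((case z of (x, i) \<Rightarrow> f (x, opposite i)) + f z))"
    have rd: "represents ?h (z - (\<phi> - P_op \<phi>))"
      unfolding P_op_def
      by (intro represents_diff represents_scaleR represents_add represents_B z rep)
    \<comment> \<open>Apart from the sign of the direction, the approximant differs from the odd
      part of \<open>f\<close> only by the cutoff function \<open>b\<close>.\<close>
    have eq: "\<bar>?h (x, i)\<bar> = \<bar>b x\<bar>" for x i
      by (cases i) (auto simp: F_def h_def field_simps)
    have "norm (z - (\<phi> - P_op \<phi>)) = 2 * (\<integral>x. \<bar>b x\<bar> \<partial>lborel)"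
      unfolding represents_norm[OF rd] integrable_S_iff(2)[OF integrable_abs[OF represents_integrable[OF rd]]] eq
      by simp
    also have "(\<integral>x. \<bar>b x\<bar> \<partial>lborel) \<le> (\<integral>x. (\<bar>\<alpha>\<bar> + \<bar>\<beta>\<bar>) * \<bar>g x\<bar> \<partial>lborel)"
    proof (rule integral_mono)
      show "\<bar>b x\<bar> \<le> (\<bar>\<alpha>\<bar> + \<bar>\<beta>\<bar>) * \<bar>g x\<bar>" for x
        by (auto simp: b_def jump_def abs_mult intro!: mult_right_mono)
    qed (use bint gint in auto)
    also have "\<dots> = (\<bar>\<alpha>\<bar> + \<bar>\<beta>\<bar>) * (\<integral>x. \<bar>g x\<bar> \<partial>lborel)" by simp
    also have "(\<integral>x. \<bar>g x\<bar> \<partial>lborel) = \<delta> * (\<integral>x. \<bar>bump x\<bar> \<partial>lborel)"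
      using \<delta> lborel_integral_real_affine[of "1 / \<delta>" "\<lambda>x. \<bar>bump x\<bar>" 0] by (simp add: g_def)
    finally show ?thesis using K\<delta> by (simp add: K_def algebra_simps)
  qed
  ultimately show ?thesis by blast
qed

section \<open>The semigroups of the theorem\<close>

text \<open>\<open>P\<close> is the identity on \<open>X\<close> and maps into \<open>X\<close>, so
  the fixed points of \<open>T 0\<close> after \<open>P\<close> are exactly the points of
  \<open>X\<close>, where difference quotients are unchanged. It serves for the identity on the
  whole space and for \<open>P_op\<close> onto \<open>L_zero\<close>.\<close>

lemma degenerate_semigroup_of_C0:
  assumes T: "C0_semigroup_on X T" and P: "bounded_linear P"
    and PX: "\<And>x. P x \<in> X" and id: "\<And>x. x \<in> X \<Longrightarrow> P x = x"
  shows "degenerate_semigroup (\<lambda>t x. T t (P x))"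
    and "degenerate_semigroup.gen (\<lambda>t x. T t (P x)) = generator_on X T"
proof -
  let ?S = "\<lambda>t x. T t (P x)"
  interpret P: bounded_linear P by (rule P)
  have inv: "T t x \<in> X" if "t \<ge> 0" "x \<in> X" for t x
    using T that unfolding C0_semigroup_on_def by blast
  have comb: "T t (a *\<^sub>R x + b *\<^sub>R y) = a *\<^sub>R T t x + b *\<^sub>R T t y" if "t \<ge> 0" "x \<in> X" "y \<in> X" for t x y a b
    using T that unfolding C0_semigroup_on_def by blast
  have bdd: "\<exists>K. \<forall>x\<in>X. norm (T t x) \<le> K * norm x" if "t \<ge> 0" for t
    using T that unfolding C0_semigroup_on_def by blast
  have zero: "T 0 x = x" if "x \<in> X" for x
    using T that unfolding C0_semigroup_on_def by blast
  have add: "T (s + t) x = T s (T t x)" if "s \<ge> 0" "t \<ge> 0" "x \<in> X" for s t x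
    using T that unfolding C0_semigroup_on_def by blast
  have cont: "((\<lambda>t. T t x) \<longlongrightarrow> x) (at_right 0)" if "x \<in> X" for x
    using T that unfolding C0_semigroup_on_def by blast
  show S: "degenerate_semigroup ?S"
  proof (rule degenerate_semigroup.intro)
    fix t :: real assume t: "t \<ge> 0"
    obtain K where K: "\<And>x. x \<in> X \<Longrightarrow> norm (T t x) \<le> K * norm x" using bdd[OF t] by blast
    obtain M where M: "\<And>x. norm (P x) \<le> norm x * M" "M > 0" using P.pos_bounded by blast
    show "bounded_linear (?S t)"
    proof (rule bounded_linear_intro[where K="\<bar>K\<bar> * M"])
      show "?S t (x + y) = ?S t x + ?S t y" for x y
        using comb[OF t PX PX, of 1 x 1 y] by (simp add: P.add)
      show "?S t (r *\<^sub>R x) = r *\<^sub>R ?S t x" for r x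
        using comb[OF t PX PX, of r x 0 x] by (simp add: P.scaleR)
      show "norm (?S t x) \<le> norm x * (\<bar>K\<bar> * M)" for x
      proof -
        have "norm (?S t x) \<le> K * norm (P x)" by (rule K[OF PX])
        also have "\<dots> \<le> \<bar>K\<bar> * (norm x * M)"
          using M(1)[of x] by (intro mult_mono) auto
        finally show ?thesis by (simp add: mult_ac)
      qed
    qed
  next
    fix s t :: real and x assume "s \<ge> 0" "t \<ge> 0"
    then show "?S (s + t) x = ?S s (?S t x)" by (simp add: add PX inv id)
  next
    fix x show "((\<lambda>t. ?S t x) \<longlongrightarrow> ?S 0 x) (at_right 0)"
      using cont[OF PX] by (simp add: zero PX)
  qed
  have fixed: "?S 0 x = x \<longleftrightarrow> x \<in> X" for x
    using zero[OF PX[of x]] PX[of x] id[of x] by auto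
  show "degenerate_semigroup.gen ?S = generator_on X T"
    unfolding degenerate_semigroup.gen_def[OF S] generator_on_def fixed
    by (auto simp: id)
qed

text \<open>Multiplying by \<open>exp (a * t)\<close> gives a semigroup again and adds
  \<open>a\<close> to the generator, so the pair becomes \<open>(x, y)\<close>. Its increment up to
  time \<open>s\<close> is at most \<open>s * exp (a * s) * norm y\<close>, and undoing the
  rescaling removes the exponential from this term.\<close>

lemma (in degenerate_semigroup) exponential_decay:
  assumes contr: "\<And>t x. t \<ge> 0 \<Longrightarrow> norm (S t x) \<le> norm x"
    and xy: "(x, y - a *\<^sub>R x) \<in> gen" and a: "a \<ge> 0" and s: "s \<ge> 0"
  shows "norm (S s x) \<le> exp (- a * s) * norm x + s * norm y"
proof -
  let ?R = "\<lambda>t x. exp (a * t) *\<^sub>R S t x"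
  have x0: "S 0 x = x" and "S 0 (y - a *\<^sub>R x) = y - a *\<^sub>R x" using xy by (auto simp: gen_def)
  then have y0: "S 0 y = y" by (simp add: S_minus S_scaleR)
  interpret R: degenerate_semigroup ?R
  proof (rule degenerate_semigroup.intro)
    show "bounded_linear (?R t)" if "t \<ge> 0" for t
      by (rule bounded_linear_compose[OF bounded_linear_scaleR_right lin[OF that]])
    show "?R (s + t) x = ?R s (?R t x)" if "s \<ge> 0" "t \<ge> 0" for s t x
      using that by (simp add: add S_scaleR distrib_left exp_add)
    show "((\<lambda>t. ?R t x) \<longlongrightarrow> ?R 0 x) (at_right 0)" for x
      by (intro tendsto_intros right_cont)
  qed
  have "((\<lambda>h. exp (a * h)) has_real_derivative a) (at 0)"
    by (auto intro!: derivative_eq_intros)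
  then have "((\<lambda>h. (exp (a * h) - 1) / h) \<longlongrightarrow> a) (at_right 0)"
    by (simp add: DERIV_def filterlim_at_split)
  moreover have "((\<lambda>h. (1 / h) *\<^sub>R (S h x - x)) \<longlongrightarrow> y - a *\<^sub>R x) (at_right 0)"
    using xy by (simp add: gen_def)
  ultimately have "((\<lambda>h. exp (a * h) *\<^sub>R ((1 / h) *\<^sub>R (S h x - x)) + ((exp (a * h) - 1) / h) *\<^sub>R x)
      \<longlongrightarrow> exp (a * 0) *\<^sub>R (y - a *\<^sub>R x) + a *\<^sub>R x) (at_right 0)"
    by (intro tendsto_intros)
  moreover have "exp (a * h) *\<^sub>R ((1 / h) *\<^sub>R (S h x - x)) + ((exp (a * h) - 1) / h) *\<^sub>R x
      = (1 / h) *\<^sub>R (?R h x - x)" for h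
    by (simp add: scaleR_diff_right scaleR_diff_left diff_divide_distrib)
  ultimately have "(x, y) \<in> R.gen"
    unfolding R.gen_def using x0 y0 by simp
  then have "norm (?R s x - x) \<le> s * (exp (a * s) * norm y)"
    using a s contr by (intro R.increment_bound_zero) (auto intro!: mult_mono)
  then have "norm (?R s x) \<le> norm x + s * (exp (a * s) * norm y)"
    using norm_triangle_ineq2[of "?R s x" x] by linarith
  then have "exp (- a * s) * norm (?R s x) \<le> exp (- a * s) * (norm x + s * (exp (a * s) * norm y))"
    by (intro mult_left_mono) auto
  then show ?thesis
    by (simp add: distrib_left mult.left_commute exp_minus field_simps)
qed

lemma B_op_add: "B_op (\<phi> + \<psi>) = B_op \<phi> + B_op \<psi>"
proof -
  obtain f g where fg: "represents f \<phi>" "represents g \<psi>" using ex_represents by metis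
  show ?thesis
    using represents_B[OF represents_add[OF fg]] represents_add[OF fg[THEN represents_B]]
    by (intro represents_unique) (auto simp: case_prod_unfold)
qed

lemma B_op_scaleR: "B_op (c *\<^sub>R \<phi>) = c *\<^sub>R B_op \<phi>"
proof -
  obtain f where f: "represents f \<phi>" using ex_represents by blast
  show ?thesis
    using represents_B[OF represents_scaleR[OF f]] represents_scaleR[OF represents_B[OF f]]
    by (intro represents_unique) (auto simp: case_prod_unfold)
qed

lemma norm_B_op: "norm (B_op \<phi>) = norm \<phi>"
proof -
  obtain f where f: "represents f \<phi>" using ex_represents by blast
  show ?thesis
    unfolding represents_norm[OF f] represents_norm[OF represents_B[OF f]]
      integrable_S_iff(2)[OF integrable_abs[OF represents_integrable[OF f]]]
      integrable_S_iff(2)[OF integrable_abs[OF represents_integrable[OF represents_B[OF f]]]]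
    by simp
qed

lemma bounded_linear_P_op: "bounded_linear P_op"
proof (rule bounded_linear_intro[where K=1])
  show "P_op (x + y) = P_op x + P_op y" for x y
    by (simp add: P_op_def B_op_add algebra_simps)
  show "P_op (r *\<^sub>R x) = r *\<^sub>R P_op x" for r x
    by (simp add: P_op_def B_op_scaleR algebra_simps)
  show "norm (P_op x) \<le> norm x * 1" for x
    using norm_triangle_ineq[of "B_op x" x] by (simp add: P_op_def norm_B_op)
qed

lemma P_op_in_L_zero: "P_op \<phi> \<in> L_zero"
proof -
  obtain f where f: "represents f \<phi>" using ex_represents by blast
  have "represents (\<lambda>z. 1 / 2 * ((case z of (x, i) \<Rightarrow> f (x, opposite i)) + f z)) (P_op \<phi>)"
    unfolding P_op_def by (intro represents_scaleR represents_add represents_B f)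
  then show ?thesis
    unfolding L_zero_def by (intro CollectI exI conjI) auto
qed

lemma P_op_on_L_zero: "\<phi> \<in> L_zero \<Longrightarrow> P_op \<phi> = \<phi>"
proof -
  assume "\<phi> \<in> L_zero"
  then obtain f where f: "represents f \<phi>" "\<And>x. f (x, Pos) = f (x, Neg)" by (auto simp: L_zero_def)
  have "f (x, opposite i) = f (x, i)" for x i using f(2) by (cases i) auto
  then have "B_op \<phi> = \<phi>"
    using represents_B[OF f(1)] by (intro represents_unique[OF _ f(1)]) (simp add: case_prod_unfold)
  then show "P_op \<phi> = \<phi>" by (simp add: P_op_def scaleR_2[symmetric])
qed

lemma J_scaleR: "J (c *\<^sub>R \<phi>) = c *\<^sub>R J \<phi>"
proof -
  obtain f where f: "represents f \<phi>" using ex_represents by blast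
  show ?thesis
    using represents_J[OF represents_scaleR[OF f]] represents_scaleR[OF represents_J[OF f]]
    by (intro represents_unique) (auto simp: case_prod_unfold)
qed

lemma J_diff: "J (\<phi> - \<psi>) = J \<phi> - J \<psi>"
proof -
  obtain f g where fg: "represents f \<phi>" "represents g \<psi>" using ex_represents by metis
  show ?thesis
    using represents_J[OF represents_diff[OF fg]] represents_diff[OF fg[THEN represents_J]]
    by (intro represents_unique) (auto simp: case_prod_unfold diff_divide_distrib)
qed

lemma norm_J: "norm (J \<phi>) = norm \<phi>"
proof -
  obtain f where f: "represents f \<phi>" using ex_represents by blast
  have "integrable lborel f" using represents_integrable[OF f] by (simp add: base_measure_real_def)
  then show ?thesis
    unfolding represents_norm[OF f] represents_norm[OF represents_J[OF f]]
      integrable_S_iff(2)[OF integrable_abs[OF represents_integrable[OF represents_J[OF f]]]]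
    by (simp add: base_measure_real_def)
qed

lemma J_inject: "J \<phi> = J \<psi> \<Longrightarrow> \<phi> = \<psi>"
  using norm_J[of "\<phi> - \<psi>"] by (simp add: J_diff)

text \<open>The generator of the limit carries the factor 1/2, so consecutive pairs of it match
  consecutive pairs of the Laplace operator only after rescaling.\<close>

lemma Laplace_op_scaleR:
  assumes "(\<phi>, \<psi>) \<in> Laplace_op p q"
  shows "(c *\<^sub>R \<phi>, c *\<^sub>R \<psi>) \<in> Laplace_op p q"
proof -
  obtain f g C D where f: "represents f \<phi>" and g: "represents g \<psi>"
    and neg: "\<forall>x<0. f x = q * C + D * x - (LBINT y:{x..0}. (x - y) * g y)"
    and pos: "\<forall>x>0. f x = p * C + D * x + (LBINT y:{0..x}. (x - y) * g y)"
    using assms unfolding Laplace_op_def by blast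
  have eq: "(LBINT y:s. (x - y) * (c * g y)) = c * (LBINT y:s. (x - y) * g y)" for s x
    by (simp add: mult.left_commute)
  show ?thesis
    unfolding Laplace_op_def
  proof (intro CollectI case_prodI exI conjI)
    show "represents (\<lambda>x. c * f x) (c *\<^sub>R \<phi>)" "represents (\<lambda>x. c * g x) (c *\<^sub>R \<psi>)"
      by (intro represents_scaleR f g)+
    show "\<forall>x<0. c * f x = q * (c * C) + (c * D) * x - (LBINT y:{x..0}. (x - y) * (c * g y))"
      unfolding eq using neg by (simp add: distrib_left right_diff_distrib[of c] mult.left_commute mult.assoc)
    show "\<forall>x>0. c * f x = p * (c * C) + (c * D) * x + (LBINT y:{0..x}. (x - y) * (c * g y))"
      unfolding eq using pos by (simp add: distrib_left mult.left_commute mult.assoc)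
  qed
qed

lemma Laplace_generator_approximants:
  assumes pq: "p + p' = 1" "q + q' = 1" "p + q > 0"
    and xy: "(x, y) \<in> scale_op (1 / 2) (Laplace_tilde p q)"
    and yz: "(y, z) \<in> scale_op (1 / 2) (Laplace_tilde p q)"
  shows "\<exists>xe ye. (\<forall>\<epsilon>>0. (xe \<epsilon>, ye \<epsilon>) \<in> G_op p p' q q' \<epsilon>) \<and>
    (xe \<longlongrightarrow> x) (at_right 0) \<and> (ye \<longlongrightarrow> y) (at_right 0)"
proof -
  obtain \<phi> \<psi> where 1: "(\<phi>, \<psi>) \<in> Laplace_op p q" "x = J \<phi>" "y = (1 / 2) *\<^sub>R J \<psi>"
    using xy by (auto simp: scale_op_def Laplace_tilde_def)
  obtain \<phi>2 \<psi>2 where 2: "(\<phi>2, \<psi>2) \<in> Laplace_op p q" "y = J \<phi>2"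
    using yz by (auto simp: scale_op_def Laplace_tilde_def)
  have "\<phi>2 = (1 / 2) *\<^sub>R \<psi>" using 1(3) 2(2) by (intro J_inject) (simp add: J_scaleR)
  then have "(\<psi>, 2 *\<^sub>R \<psi>2) \<in> Laplace_op p q"
    using Laplace_op_scaleR[OF 2(1), of 2] by simp
  from diffusive_approximants[OF pq 1(1) this] obtain c1 c2 c3 where
    c: "\<And>\<epsilon>. \<epsilon> > 0 \<Longrightarrow> (x + \<epsilon> *\<^sub>R c1 + \<epsilon>\<^sup>2 *\<^sub>R c2, y + \<epsilon> *\<^sub>R c3) \<in> G_op p p' q q' \<epsilon>"
    unfolding 1 by blast
  have "((\<lambda>\<epsilon>. x + \<epsilon> *\<^sub>R c1 + \<epsilon>\<^sup>2 *\<^sub>R c2) \<longlongrightarrow> x + 0 *\<^sub>R c1 + 0\<^sup>2 *\<^sub>R c2) (at_right 0)"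
    "((\<lambda>\<epsilon>. y + \<epsilon> *\<^sub>R c3) \<longlongrightarrow> y + 0 *\<^sub>R c3) (at_right 0)"
    by (intro tendsto_intros)+
  then show ?thesis
    using c by (intro exI[of _ "\<lambda>\<epsilon>. x + \<epsilon> *\<^sub>R c1 + \<epsilon>\<^sup>2 *\<^sub>R c2"] exI[of _ "\<lambda>\<epsilon>. y + \<epsilon> *\<^sub>R c3"]) simp
qed

text \<open>The reflection \<open>B_op\<close> is an isometry. With
  \<open>a = h / \<epsilon>\<^sup>2\<close> and \<open>c = h / \<epsilon>\<close>, the vector
  \<open>(1 + a) x - c \<psi>\<close> equals \<open>x - h y + a B x\<close>. Dissipativity of the
  transport operator bounds its norm below by \<open>(1 + a) * norm x\<close>, and the reflected
  term accounts for \<open>a * norm x\<close>.\<close>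

lemma G_op_dissipative:
  assumes pq: "p \<ge> 0" "p' \<ge> 0" "q \<ge> 0" "q' \<ge> 0" "p + p' = 1" "q + q' = 1"
    and \<epsilon>: "\<epsilon> > 0" and G: "(x, y) \<in> G_op p p' q q' \<epsilon>" and h: "h > 0"
  shows "norm x \<le> norm (x - h *\<^sub>R y)"
proof -
  obtain \<psi> where \<psi>: "(x, \<psi>) \<in> A_op p p' q q'" and y: "y = (1 / \<epsilon>) *\<^sub>R \<psi> + (1 / \<epsilon>\<^sup>2) *\<^sub>R (B_op x - x)"
    using G by (auto simp: G_op_def)
  define a where "a = h / \<epsilon>\<^sup>2"
  define c where "c = h / \<epsilon>"
  have ac: "a > 0" "c > 0" using \<epsilon> h by (auto simp: a_def c_def)
  have "(1 + a) * norm x = c * (((1 + a) / c) * norm x)" using ac by simp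
  also have "\<dots> \<le> c * norm (((1 + a) / c) *\<^sub>R x - \<psi>)"
    using ac by (intro mult_left_mono A_op_dissipative[OF pq \<psi>]) auto
  also have "\<dots> = norm (c *\<^sub>R (((1 + a) / c) *\<^sub>R x - \<psi>))" using ac by simp
  also have "c *\<^sub>R (((1 + a) / c) *\<^sub>R x - \<psi>) = (x - h *\<^sub>R y) + a *\<^sub>R B_op x"
  proof -
    have "c *\<^sub>R (((1 + a) / c) *\<^sub>R x - \<psi>) = (1 + a) *\<^sub>R x - c *\<^sub>R \<psi>"
      using ac by (simp add: scaleR_diff_right)
    moreover have "h *\<^sub>R y = c *\<^sub>R \<psi> + a *\<^sub>R (B_op x - x)"
      by (simp add: y a_def c_def scaleR_add_right)
    ultimately show ?thesis by (simp add: algebra_simps)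
  qed
  also have "norm \<dots> \<le> norm (x - h *\<^sub>R y) + a * norm x"
    using ac norm_triangle_ineq[of "x - h *\<^sub>R y" "a *\<^sub>R B_op x"] by (simp add: norm_B_op)
  finally show ?thesis by (simp add: algebra_simps)
qed

theorem theorem3p1:
  fixes p p' q q' :: real
    and T :: "real \<Rightarrow> real \<Rightarrow> S L1 \<Rightarrow> S L1"
    and U :: "real \<Rightarrow> S L1 \<Rightarrow> S L1"
  assumes "p \<ge> 0" "p' \<ge> 0" "q \<ge> 0" "q' \<ge> 0"
    and "p + p' = 1" "q + q' = 1" "p + q > 0"
    and "\<And>\<epsilon>. \<epsilon> > 0 \<Longrightarrow> generates_on UNIV (G_op p p' q q' \<epsilon>) (T \<epsilon>)"
    and "generates_on L_zero (scale_op (1 / 2) (Laplace_tilde p q)) U"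
  shows "(\<forall>\<phi>. \<forall>t>0. ((\<lambda>\<epsilon>. T \<epsilon> t \<phi>) \<longlongrightarrow> U t (P_op \<phi>)) (at_right 0)) \<and>
    (\<forall>\<phi> K. compact K \<and> K \<subseteq> {0<..} \<longrightarrow>
       uniform_limit K (\<lambda>\<epsilon> t. T \<epsilon> t \<phi>) (\<lambda>t. U t (P_op \<phi>)) (at_right 0)) \<and>
    (\<forall>\<phi>\<in>L_zero. ((\<lambda>\<epsilon>. T \<epsilon> 0 \<phi>) \<longlongrightarrow> U 0 (P_op \<phi>)) (at_right 0)) \<and>
    (\<forall>\<phi>\<in>L_zero. \<forall>K. compact K \<and> K \<subseteq> {0..} \<longrightarrow>
       uniform_limit K (\<lambda>\<epsilon> t. T \<epsilon> t \<phi>) (\<lambda>t. U t (P_op \<phi>)) (at_right 0))"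
proof -
  note pq = assms(1-6)
  have T_C0: "C0_semigroup_on UNIV (T \<epsilon>)" "generator_on UNIV (T \<epsilon>) = G_op p p' q q' \<epsilon>" if "\<epsilon> > 0" for \<epsilon>
    using assms(8)[OF that] by (auto simp: generates_on_def)
  have T: "degenerate_semigroup (T \<epsilon>)" if "\<epsilon> > 0" for \<epsilon>
    using degenerate_semigroup_of_C0(1)[OF T_C0(1)[OF that] bounded_linear_ident] by simp
  have T_gen: "degenerate_semigroup.gen (T \<epsilon>) = G_op p p' q q' \<epsilon>" if "\<epsilon> > 0" for \<epsilon>
    using degenerate_semigroup_of_C0(2)[OF T_C0(1)[OF that] bounded_linear_ident] T_C0(2)[OF that] by simp
  have T_zero: "T \<epsilon> 0 x = x" if "\<epsilon> > 0" for \<epsilon> x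
    using T_C0(1)[OF that] by (auto simp: C0_semigroup_on_def)
  have T_contraction: "norm (T \<epsilon> t x) \<le> norm x" if "\<epsilon> > 0" "t \<ge> 0" for \<epsilon> t x
    by (rule degenerate_semigroup.dissipative_imp_contraction[OF T[OF that(1)] _ T_zero[OF that(1)] that(2)])
      (use G_op_dissipative[OF pq that(1)] T_gen[OF that(1)] in auto)
  let ?U = "\<lambda>t x. U t (P_op x)"
  have U_C0: "C0_semigroup_on L_zero U" "generator_on L_zero U = scale_op (1 / 2) (Laplace_tilde p q)"
    using assms(9) by (auto simp: generates_on_def)
  note U = degenerate_semigroup_of_C0[OF U_C0(1) bounded_linear_P_op P_op_in_L_zero P_op_on_L_zero]
  interpret U: degenerate_semigroup ?U by (rule U(1))
  have U_gen: "U.gen = scale_op (1 / 2) (Laplace_tilde p q)" using U(2) U_C0(2) by simp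
  have "semigroup_approximation ?U T"
  proof (intro semigroup_approximation.intro semigroup_approximation_axioms.intro)
    show "degenerate_semigroup ?U" by (rule U(1))
    show "degenerate_semigroup (T \<epsilon>)" if "\<epsilon> > 0" for \<epsilon> by (rule T[OF that])
    show "norm (T \<epsilon> t x) \<le> norm x" if "\<epsilon> > 0" "t \<ge> 0" for \<epsilon> t x by (rule T_contraction[OF that])
    show "T \<epsilon> 0 x = x" if "\<epsilon> > 0" for \<epsilon> x by (rule T_zero[OF that])
    fix x y assume "(x, y) \<in> U.gen" "y \<in> U.iterated_domain 1"
    then obtain z where "(x, y) \<in> scale_op (1 / 2) (Laplace_tilde p q)" "(y, z) \<in> scale_op (1 / 2) (Laplace_tilde p q)"
      by (auto simp: U_gen)
    from Laplace_generator_approximants[OF assms(5-7) this]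
    show "\<exists>xe ye. (\<forall>\<epsilon>>0. (xe \<epsilon>, ye \<epsilon>) \<in> degenerate_semigroup.gen (T \<epsilon>)) \<and>
        (xe \<longlongrightarrow> x) (at_right 0) \<and> (ye \<longlongrightarrow> y) (at_right 0)"
      by (auto simp: T_gen)
  qed
  then interpret semigroup_approximation ?U T .
  have even: "uniform_limit {0..\<tau>} (\<lambda>\<epsilon> t. T \<epsilon> t \<phi>) (\<lambda>t. ?U t \<phi>) (at_right 0)" if "\<phi> \<in> L_zero" for \<phi> \<tau>
  proof (rule uniform_convergence)
    show "?U 0 \<phi> = \<phi>"
      using that U_C0(1) by (simp add: P_op_on_L_zero C0_semigroup_on_def)
  qed
  have odd: "eventually (\<lambda>\<epsilon>. \<forall>t\<ge>t0. norm (T \<epsilon> t (\<phi> - P_op \<phi>)) < e) (at_right 0)"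
    if t0: "t0 > 0" and e: "e > 0" for \<phi> t0 e
  proof -
    \<comment> \<open>The domain of the transport operator is the domain of the generator of
      \<open>T 1\<close>, hence dense.\<close>
    interpret T1: degenerate_semigroup "T 1" by (rule T) simp
    \<comment> \<open>Passing to the odd part at most doubles the distance \<open>e / 8\<close>;
      with \<open>e / 4\<close> from \<open>odd_approximation\<close> the total stays below
      \<open>e / 2\<close>.\<close>
    obtain \<phi>1 where \<phi>1: "\<phi>1 \<in> T1.iterated_domain 1" "norm (\<phi> - \<phi>1) < e / 8"
      using T1.iterated_domain_dense[OF T_zero, where x=\<phi> and e="e / 8" and k=1] e by auto
    then obtain \<psi>1 where "(\<phi>1, \<psi>1) \<in> A_op p p' q q'"
      using T_gen[of 1] by (auto simp: G_op_def)
    from odd_approximation[OF this, of "e / 4"] e obtain z \<zeta> where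
      z: "(z, \<zeta>) \<in> A_op p p' q q'" "B_op z = - z" "norm (z - (\<phi>1 - P_op \<phi>1)) < e / 4" by auto
    have "norm (z - (\<phi> - P_op \<phi>)) < e / 2"
    proof -
      have eq: "z - (\<phi> - P_op \<phi>) = (z - (\<phi>1 - P_op \<phi>1)) - ((\<phi> - \<phi>1) - P_op (\<phi> - \<phi>1))"
        by (simp add: linear_diff[OF bounded_linear.linear[OF bounded_linear_P_op]])
      have "norm ((\<phi> - \<phi>1) - P_op (\<phi> - \<phi>1)) \<le> 2 * norm (\<phi> - \<phi>1)"
      proof -
        have "norm (P_op (\<phi> - \<phi>1)) \<le> norm (\<phi> - \<phi>1)"
          using norm_triangle_ineq[of "B_op (\<phi> - \<phi>1)" "\<phi> - \<phi>1"] by (simp add: P_op_def norm_B_op)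
        then show ?thesis using norm_triangle_ineq4[of "\<phi> - \<phi>1" "P_op (\<phi> - \<phi>1)"] by linarith
      qed
      then show ?thesis
        unfolding eq
        using norm_triangle_ineq4[of "z - (\<phi>1 - P_op \<phi>1)" "(\<phi> - \<phi>1) - P_op (\<phi> - \<phi>1)"] z(3) \<phi>1(2)
        by linarith
    qed
    have "((\<lambda>\<epsilon>. sqrt \<epsilon> * (norm z + norm \<zeta>)) \<longlongrightarrow> sqrt 0 * (norm z + norm \<zeta>)) (at_right 0)"
      by (intro tendsto_intros)
    then have "eventually (\<lambda>\<epsilon>. sqrt \<epsilon> * (norm z + norm \<zeta>) < e / 2) (at_right 0)"
      using e by (intro order_tendstoD) auto
    moreover have "((\<lambda>\<epsilon>. \<epsilon> * sqrt \<epsilon>) \<longlongrightarrow> 0 * sqrt 0) (at_right 0)"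
      by (intro tendsto_intros)
    then have "eventually (\<lambda>\<epsilon>. \<epsilon> * sqrt \<epsilon> < t0) (at_right 0)"
      using t0 by (intro order_tendstoD) auto
    ultimately show ?thesis
      using eventually_at_right_less[of "0::real"]
    proof eventually_elim
      case (elim \<epsilon>)
      interpret T\<epsilon>: degenerate_semigroup "T \<epsilon>" by (rule T) (rule elim)
      \<comment> \<open>This time lies between the relaxation scale, the square of
        \<open>\<epsilon>\<close>, and the transport scale \<open>\<epsilon>\<close>: the damping
        exponent \<open>2 / sqrt \<epsilon>\<close> diverges while the transport contribution is of
        order \<open>sqrt \<epsilon>\<close>. Once \<open>s < t0\<close>, contraction keeps the norm
        small for all later times.\<close>
      define s where "s = \<epsilon> * sqrt \<epsilon>"
      have s: "s > 0" "s / \<epsilon> = sqrt \<epsilon>" "2 / \<epsilon>\<^sup>2 * s = 2 / sqrt \<epsilon>"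
        using elim by (auto simp: s_def power2_eq_square real_div_sqrt divide_simps)
      have "(z, (1 / \<epsilon>) *\<^sub>R \<zeta> + (1 / \<epsilon>\<^sup>2) *\<^sub>R (B_op z - z)) \<in> T\<epsilon>.gen"
        unfolding T_gen[OF elim(3)] G_op_def using z(1) by blast
      \<comment> \<open>Since \<open>B_op z = - z\<close>, the collision term is pure damping at
        rate \<open>2 / \<epsilon>\<^sup>2\<close>, the form expected by
        \<open>exponential_decay\<close>.\<close>
      moreover have "(1 / \<epsilon>\<^sup>2) *\<^sub>R (B_op z - z) = - ((2 / \<epsilon>\<^sup>2) *\<^sub>R z)"
        using scaleR_left_distrib[of "1 / \<epsilon>\<^sup>2" "1 / \<epsilon>\<^sup>2" z] by (simp add: z(2) scaleR_diff_right)
      ultimately have "(z, (1 / \<epsilon>) *\<^sub>R \<zeta> - (2 / \<epsilon>\<^sup>2) *\<^sub>R z) \<in> T\<epsilon>.gen" by simp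
      then have "norm (T \<epsilon> s z) \<le> exp (- (2 / \<epsilon>\<^sup>2) * s) * norm z + s * norm ((1 / \<epsilon>) *\<^sub>R \<zeta>)"
        using elim s T_contraction by (intro T\<epsilon>.exponential_decay) auto
      also have "\<dots> = exp (- (2 / sqrt \<epsilon>)) * norm z + sqrt \<epsilon> * norm \<zeta>"
      proof -
        have "s * norm ((1 / \<epsilon>) *\<^sub>R \<zeta>) = s / \<epsilon> * norm \<zeta>" "- (2 / \<epsilon>\<^sup>2) * s = - (2 / \<epsilon>\<^sup>2 * s)"
          using elim by simp_all
        then show ?thesis unfolding s(2,3) by (simp only:)
      qed
      \<comment> \<open>Replacing the exponential by the cruder \<open>sqrt \<epsilon>\<close> lets
        one smallness condition on \<open>sqrt \<epsilon>\<close> cover both terms.\<close>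
      also have "exp (- (2 / sqrt \<epsilon>)) \<le> sqrt \<epsilon>"
      proof -
        have "1 / sqrt \<epsilon> \<le> exp (2 / sqrt \<epsilon>)"
        proof -
          have "1 / sqrt \<epsilon> \<le> 2 / sqrt \<epsilon>" using elim by (intro divide_right_mono) auto
          then show ?thesis using exp_ge_add_one_self[of "2 / sqrt \<epsilon>"] by linarith
        qed
        then show ?thesis using elim by (simp add: exp_minus field_simps)
      qed
      finally have Tz: "norm (T \<epsilon> s z) < e / 2"
        using elim by (simp add: distrib_left mult_right_mono)
      show ?case
      proof (intro allI impI)
        fix t assume t: "t \<ge> t0"
        have ts: "t - s \<ge> 0" "t \<ge> 0" using t elim t0 by (auto simp: s_def)
        have "T \<epsilon> t z = T \<epsilon> (t - s) (T \<epsilon> s z)"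
          using T\<epsilon>.add[of "t - s" s z] ts s by simp
        then have "norm (T \<epsilon> t z) \<le> norm (T \<epsilon> s z)"
          using T_contraction[OF elim(3) ts(1)] by simp
        moreover have "norm (T \<epsilon> t (z - (\<phi> - P_op \<phi>))) < e / 2"
          using T_contraction[OF elim(3) ts(2), of "z - (\<phi> - P_op \<phi>)"] \<open>norm (z - (\<phi> - P_op \<phi>)) < e / 2\<close>
          by linarith
        moreover have eq: "T \<epsilon> t (\<phi> - P_op \<phi>) = T \<epsilon> t z - T \<epsilon> t (z - (\<phi> - P_op \<phi>))"
          using ts by (simp add: T\<epsilon>.S_minus)
        ultimately show "norm (T \<epsilon> t (\<phi> - P_op \<phi>)) < e"
          unfolding eq using Tz norm_triangle_ineq4[of "T \<epsilon> t z" "T \<epsilon> t (z - (\<phi> - P_op \<phi>))"] by linarith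
      qed
    qed
  qed
  \<comment> \<open>The part in \<open>L_zero\<close> converges uniformly from time 0 on; the lower
    bound \<open>t0\<close> is there for the decay of the odd part.\<close>
  have general: "uniform_limit {t0..\<tau>} (\<lambda>\<epsilon> t. T \<epsilon> t \<phi>) (\<lambda>t. ?U t \<phi>) (at_right 0)" if t0: "t0 > 0" for \<phi> t0 \<tau>
  proof (rule uniform_limitI)
    fix e :: real assume e: "e > 0"
    have "eventually (\<lambda>\<epsilon>. \<forall>t\<in>{0..\<tau>}. dist (T \<epsilon> t (P_op \<phi>)) (?U t (P_op \<phi>)) < e / 2) (at_right 0)"
      using e by (intro uniform_limitD[OF even[OF P_op_in_L_zero]]) simp
    moreover have "eventually (\<lambda>\<epsilon>. \<forall>t\<ge>t0. norm (T \<epsilon> t (\<phi> - P_op \<phi>)) < e / 2) (at_right 0)"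
      using t0 e by (intro odd) auto
    ultimately show "\<forall>\<^sub>F \<epsilon> in at_right 0. \<forall>t\<in>{t0..\<tau>}. dist (T \<epsilon> t \<phi>) (?U t \<phi>) < e"
      using eventually_at_right_less[of "0::real"]
    proof eventually_elim
      case (elim \<epsilon>)
      interpret T\<epsilon>: degenerate_semigroup "T \<epsilon>" by (rule T) (rule elim)
      show ?case
      proof
        fix t assume t: "t \<in> {t0..\<tau>}"
        \<comment> \<open>\<open>P_op\<close> is idempotent, so the limit orbits of
          \<open>\<phi>\<close> and \<open>P_op \<phi>\<close> coincide.\<close>
        have eq: "T \<epsilon> t \<phi> - ?U t \<phi> = T \<epsilon> t (\<phi> - P_op \<phi>) + (T \<epsilon> t (P_op \<phi>) - ?U t (P_op \<phi>))"
          using t t0 by (simp add: T\<epsilon>.S_minus P_op_on_L_zero[OF P_op_in_L_zero])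
        have "norm (T \<epsilon> t (\<phi> - P_op \<phi>)) < e / 2" "norm (T \<epsilon> t (P_op \<phi>) - ?U t (P_op \<phi>)) < e / 2"
          using elim t t0 by (auto simp: dist_norm)
        then show "dist (T \<epsilon> t \<phi>) (?U t \<phi>) < e"
          unfolding dist_norm eq using norm_triangle_ineq[of "T \<epsilon> t (\<phi> - P_op \<phi>)" "T \<epsilon> t (P_op \<phi>) - ?U t (P_op \<phi>)"]
          by linarith
      qed
    qed
  qed
  have compact_pos: "uniform_limit K (\<lambda>\<epsilon> t. T \<epsilon> t \<phi>) (\<lambda>t. ?U t \<phi>) (at_right 0)"
    if K: "compact K" "K \<subseteq> {0<..}" for \<phi> K
  proof (cases "K = {}")
    case False
    obtain t0 where t0: "t0 \<in> K" "\<And>t. t \<in> K \<Longrightarrow> t0 \<le> t" using compact_attains_inf[OF K(1) False] by blast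
    obtain \<tau> where "\<And>t. t \<in> K \<Longrightarrow> t \<le> \<tau>" using compact_attains_sup[OF K(1) False] by blast
    with t0 have "K \<subseteq> {t0..\<tau>}" by auto
    then show ?thesis
      using t0 K(2) by (intro uniform_limit_on_subset[OF general]) auto
  qed (simp add: uniform_limit_iff)
  have compact_even: "uniform_limit K (\<lambda>\<epsilon> t. T \<epsilon> t \<phi>) (\<lambda>t. ?U t \<phi>) (at_right 0)"
    if K: "compact K" "K \<subseteq> {0..}" and \<phi>: "\<phi> \<in> L_zero" for \<phi> K
  proof (cases "K = {}")
    case False
    obtain \<tau> where "\<And>t. t \<in> K \<Longrightarrow> t \<le> \<tau>" using compact_attains_sup[OF K(1) False] by blast
    with K(2) have "K \<subseteq> {0..\<tau>}" by auto
    then show ?thesis by (rule uniform_limit_on_subset[OF even[OF \<phi>]])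
  qed (simp add: uniform_limit_iff)
  show ?thesis
  proof (intro conjI allI impI ballI)
    show "((\<lambda>\<epsilon>. T \<epsilon> t \<phi>) \<longlongrightarrow> U t (P_op \<phi>)) (at_right 0)" if "t > 0" for \<phi> t
      by (rule tendsto_uniform_limitI[OF compact_pos[of "{t}"]]) (use that in auto)
    show "((\<lambda>\<epsilon>. T \<epsilon> 0 \<phi>) \<longlongrightarrow> U 0 (P_op \<phi>)) (at_right 0)" if "\<phi> \<in> L_zero" for \<phi>
      by (rule tendsto_uniform_limitI[OF compact_even[of "{0}", OF _ _ that]]) auto
  qed (use compact_pos compact_even in auto)
qed

end
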